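(* Let $(A,\alpha)$, $(B,\beta)$, $(C,\gamma)$ be Lebesgue spaces, and let $\mathsf X^{(i)}$, $\mathsf Y^{(j)}$, $\mathsf Z^{(k)}$ be approximating sequences of countable measurable partitions of $A$, $B$, $C$ respectively. For $\mathfrak P\in\mathrm{Pol}(A,B)$ and $\mathfrak Q\in\mathrm{Pol}(B,C)$ the product is given by the triple limits in $\mathrm{Pol}(A,C)$ $$\mathfrak Q\circ\mathfrak P=\lim_{i,j,k\to\infty}\mathfrak t[C;\mathsf Z^{(k)}]\circ\mathfrak Q\circ\mathfrak t[B;\mathsf Y^{(j)}]\circ\mathfrak P\circ\mathfrak t[A;\mathsf X^{(i)}]$$ $$=\lim_{i,j,k\to\infty}\mathfrak l[C;\mathsf Z^{(k)}]\circ\Bigl(\mathfrak m[C;\mathsf Z^{(k)}]\circ\mathfrak Q\circ\mathfrak l[B;\mathsf Y^{(j)}]\Bigr)\circ\Bigl(\mathfrak m[B;\mathsf Y^{(j)}]\circ\mathfrak P\circ\mathfrak l[A;\mathsf X^{(i)}]\Bigr)\circ\mathfrak m[A;\mathsf X^{(i)}].$$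
   Context: A Lebesgue space $(A,\alpha)$ is a space with a finite positive measure, $\alpha(A)>0$, isomorphic to a disjoint union of a finite (possibly empty) segment with Lebesgue measure and an at most countable collection of atoms. $\mathbb R^\times$ is the multiplicative group of positive reals, with coordinate $t$. $\mathcal M^{\triangledown}$ is the set of positive measures $\mu$ on $\mathbb R^\times$ with $\int d\mu<\infty$ and $\int t\,d\mu(t)<\infty$; it is closed under addition and under the convolution $\int f\,d(\mu*\nu)=\iint f(s_1s_2)\,d\mu(s_1)\,d\nu(s_2)$. Convergence $\mu_j\to\mu$ in $\mathcal M^{\triangledown}$ means that $\mu_j\to\mu$ and $t\mu_j\to t\mu$ weakly (tested against bounded continuous functions on $\mathbb R^\times$). A polymorphism from $(A,\alpha)$ to $(B,\beta)$ is a measure $\mathfrak P$ on $A\times B\times\mathbb R^\times$ such that the image of $\mathfrak P$ under the projection to $A$ is $\alpha$ and the image of $t\cdot\mathfrak P$ under the projection to $B$ is $\beta$. $\mathrm{Pol}(A,B)$ is the set of all polymorphisms. For measurable $M\subset A$, $N\subset B$, $\mathfrak p[M\times N]\in\mathcal M^{\triangledown}$ is the image of the restriction of $\mathfrak P$ to $M\times N\times\mathbb R^\times$ under the projection to $\mathbb R^\times$; similarly $\mathfrak q[\cdot]$ for $\mathfrak Q$, etc. Convergence $\mathfrak P^{(j)}\to\mathfrak P$ in $\mathrm{Pol}(A,B)$ means $\mathfrak p^{(j)}[M\times N]\to\mathfrak p[M\times N]$ in $\mathcal M^{\triangledown}$ for all measurable $M\subset A$, $N\subset B$ (and analogously for multi-indexed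 sequences). Product. Let $\mathfrak P\in\mathrm{Pol}(A,B)$, $\mathfrak Q\in\mathrm{Pol}(B,C)$. For measurable $M\subset A$ and $K\subset C$ there are measures $\mathfrak p_{M,b}$, $\mathfrak q_{b,K}\in\mathcal M^{\triangledown}$, defined for $\beta$-almost all $b\in B$, such that for every measurable $N\subset B$ one has $\mathfrak p[M\times N]=\int_N\mathfrak p_{M,b}\,d\beta(b)$ and $\mathfrak q[N\times K]=\int_N\mathfrak q_{b,K}\,d\beta(b)$. The product $\mathfrak R=\mathfrak Q\circ\mathfrak P\in\mathrm{Pol}(A,C)$ is the (well-defined) polymorphism determined by $\mathfrak r[M\times K]=\int_B\mathfrak q_{b,K}*\mathfrak p_{M,b}\,d\beta(b)$ for all measurable $M\subset A$, $K\subset C$. This product is associative. Partitions. A countable (or finite) partition $\mathsf X:A=\bigcup X_i$ into disjoint measurable sets has quotient $A/\mathsf X$, a discrete space with points $a_i$ of measure $\alpha(X_i)$; let $\pi:A\to A/\mathsf X$ be the projection. $\mathfrak m[A;\mathsf X]\in\mathrm{Pol}(A,A/\mathsf X)$ is the image of $\alpha$ under $a\mapsto(a,\pi(a),1)\in A\times(A/\mathsf X)\times\mathbb R^\times$; $\mathfrak l[A;\mathsf X]\in\mathrm{Pol}(A/\mathsf X,A)$ is the image of $\alpha$ under $a\mapsto(\pi(a),a,1)$; and $\mathfrak t[A;\mathsf X]=\mathfrak l[A;\mathsf X]\circ\mathfrak m[A;\mathsf X]\in\mathrm{Pol}(A,A)$. A sequence of partitions $\mathsf X^{(1)},\mathsf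 X^{(2)},\dots$ of $A$ is approximating if each $\mathsf X^{(p+1)}$ is a refinement of $\mathsf X^{(p)}$ and the sigma-algebra generated by all the partitions coincides with the sigma-algebra of all measurable subsets of $A$. *)

theory Defs
  imports "HOL-Analysis.Analysis"
begin

section \<open>Lebesgue spaces\<close>

definition sum_measure :: "'a measure \<Rightarrow> 'b measure \<Rightarrow> ('a + 'b) measure" where
  "sum_measure M N =
     measure_of (space M <+> space N) {S <+> T | S T. S \<in> sets M \<and> T \<in> sets N}
       (\<lambda>U. emeasure M (Inl -` U) + emeasure N (Inr -` U))"

text \<open>The segment is empty when \<open>b < a\<close>; the atoms are indexed by an arbitrary set of
  natural numbers.\<close>

definition lebesgue_model :: "real \<Rightarrow> real \<Rightarrow> nat set \<Rightarrow> (nat \<Rightarrow> ennreal) \<Rightarrow> (real + nat) measure" where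
  "lebesgue_model a b I w = sum_measure (lebesgue_on {a..b}) (point_measure I w)"

definition iso_mod0 :: "'a measure \<Rightarrow> 'b measure \<Rightarrow> bool" where
  "iso_mod0 M N \<longleftrightarrow>
     (\<exists>M' N' f g. M' \<in> sets M \<and> space M - M' \<in> null_sets M \<and>
        N' \<in> sets N \<and> space N - N' \<in> null_sets N \<and>
        f \<in> restrict_space M M' \<rightarrow>\<^sub>M restrict_space N N' \<and>
        g \<in> restrict_space N N' \<rightarrow>\<^sub>M restrict_space M M' \<and>
        (\<forall>x\<in>M'. g (f x) = x) \<and> (\<forall>y\<in>N'. f (g y) = y) \<and>
        distr (restrict_space M M') (restrict_space N N') f = restrict_space N N')"

text \<open>Isomorphisms of Lebesgue spaces are isomorphisms modulo null sets. Passing to the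
  completion changes nothing if the sigma-algebra of \<open>A\<close> is complete, and it also admits, for
  instance, a segment with its Borel sigma-algebra.\<close>

definition lebesgue_space :: "'a measure \<Rightarrow> bool" where
  "lebesgue_space A \<longleftrightarrow> finite_measure A \<and> emeasure A (space A) > 0 \<and>
     (\<exists>a b I w. (\<forall>i\<in>I. w i > 0) \<and> iso_mod0 (completion A) (lebesgue_model a b I w))"


section \<open>Measures on the multiplicative group of positive reals\<close>

definition Rpos :: "real measure" where
  "Rpos = restrict_space borel {0<..}"

definition t_times :: "real measure \<Rightarrow> real measure" where
  "t_times \<mu> = density \<mu> (\<lambda>t. ennreal t)"

definition Mtri :: "real measure set" where
  "Mtri = {\<mu>. sets \<mu> = sets Rpos \<and> emeasure \<mu> (space \<mu>) < \<infinity> \<and> (\<integral>\<^sup>+t. ennreal t \<partial>\<mu>) < \<infinity>}"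

definition mconv :: "real measure \<Rightarrow> real measure \<Rightarrow> real measure" where
  "mconv \<mu> \<nu> = distr (\<mu> \<Otimes>\<^sub>M \<nu>) Rpos (\<lambda>(s, t). s * t)"

definition weak_tendsto :: "'i filter \<Rightarrow> ('i \<Rightarrow> real measure) \<Rightarrow> real measure \<Rightarrow> bool" where
  "weak_tendsto F m \<mu> \<longleftrightarrow>
     (\<forall>f :: real \<Rightarrow> real. continuous_on {0<..} f \<and> bounded (f ` {0<..}) \<longrightarrow>
        ((\<lambda>i. \<integral>t. f t \<partial>m i) \<longlongrightarrow> (\<integral>t. f t \<partial>\<mu>)) F)"

definition Mtri_tendsto :: "'i filter \<Rightarrow> ('i \<Rightarrow> real measure) \<Rightarrow> real measure \<Rightarrow> bool" where
  "Mtri_tendsto F m \<mu> \<longleftrightarrow> (\<forall>i. m i \<in> Mtri) \<and> \<mu> \<in> Mtri \<and>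
     weak_tendsto F m \<mu> \<and> weak_tendsto F (\<lambda>i. t_times (m i)) (t_times \<mu>)"


section \<open>Polymorphisms\<close>

definition Pol :: "'a measure \<Rightarrow> 'b measure \<Rightarrow> ('a \<times> 'b \<times> real) measure set" where
  "Pol A B = {P. sets P = sets (A \<Otimes>\<^sub>M B \<Otimes>\<^sub>M Rpos) \<and>
     distr P A (\<lambda>(a, b, t). a) = A \<and>
     distr (density P (\<lambda>(a, b, t). ennreal t)) B (\<lambda>(a, b, t). b) = B}"

text \<open>\<open>pol_block P M N\<close> is the measure written \<open>\<pp>[M \<times> N]\<close>.\<close>

definition pol_block :: "('a \<times> 'b \<times> real) measure \<Rightarrow> 'a set \<Rightarrow> 'b set \<Rightarrow> real measure" where
  "pol_block P M N = distr (restrict_space P (M \<times> N \<times> {0<..})) Rpos (\<lambda>(a, b, t). t)"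

definition pol_tendsto ::
    "'a measure \<Rightarrow> 'b measure \<Rightarrow> 'i filter \<Rightarrow> ('i \<Rightarrow> ('a \<times> 'b \<times> real) measure) \<Rightarrow>
      ('a \<times> 'b \<times> real) measure \<Rightarrow> bool" where
  "pol_tendsto A B F R P \<longleftrightarrow> (\<forall>i. R i \<in> Pol A B) \<and> P \<in> Pol A B \<and>
     (\<forall>M\<in>sets A. \<forall>N\<in>sets B. Mtri_tendsto F (\<lambda>i. pol_block (R i) M N) (pol_block P M N))"

text \<open>\<open>is_disintegration B p \<rho>\<close>: \<open>\<rho> N = \<integral>\<^sub>N p b d\<beta>(b)\<close> for all measurable \<open>N\<close>. Densities that are
  only defined almost everywhere are extended to all of \<open>B\<close> by the zero measure.\<close>

definition is_disintegration :: "'b measure \<Rightarrow> ('b \<Rightarrow> real measure) \<Rightarrow> ('b set \<Rightarrow> real measure) \<Rightarrow> bool" where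
  "is_disintegration B p \<rho> \<longleftrightarrow> (\<forall>b\<in>space B. p b \<in> Mtri) \<and>
     (\<forall>S\<in>sets Rpos. (\<lambda>b. emeasure (p b) S) \<in> borel_measurable B \<and>
        (\<forall>N\<in>sets B. emeasure (\<rho> N) S = (\<integral>\<^sup>+b\<in>N. emeasure (p b) S \<partial>B)))"

definition is_pol_prod ::
    "'a measure \<Rightarrow> 'b measure \<Rightarrow> 'c measure \<Rightarrow> ('b \<times> 'c \<times> real) measure \<Rightarrow>
      ('a \<times> 'b \<times> real) measure \<Rightarrow> ('a \<times> 'c \<times> real) measure \<Rightarrow> bool" where
  "is_pol_prod A B C Q P R \<longleftrightarrow> R \<in> Pol A C \<and>
     (\<forall>M\<in>sets A. \<forall>K\<in>sets C. \<exists>p q.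
        is_disintegration B p (\<lambda>N. pol_block P M N) \<and>
        is_disintegration B q (\<lambda>N. pol_block Q N K) \<and>
        (\<forall>S\<in>sets Rpos. emeasure (pol_block R M K) S = (\<integral>\<^sup>+b. emeasure (mconv (q b) (p b)) S \<partial>B)))"

text \<open>\<open>Q \<circ>\<^bsub>(A,B,C)\<^esub> P\<close> is the product of \<open>P \<in> Pol A B\<close> and \<open>Q \<in> Pol B C\<close>; the spaces have to be
  named because a measure on \<open>A \<times> B \<times> \<real>\<close> does not determine the sigma-algebras of its factors.\<close>

definition pol_prod ::
    "('b \<times> 'c \<times> real) measure \<Rightarrow> 'a measure \<Rightarrow> 'b measure \<Rightarrow> 'c measure \<Rightarrow>
      ('a \<times> 'b \<times> real) measure \<Rightarrow> ('a \<times> 'c \<times> real) measure"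
    ("_ \<circ>\<^bsub>'(_,_,_')\<^esub> _" [56, 0, 0, 0, 55] 55) where
  "Q \<circ>\<^bsub>(A,B,C)\<^esub> P = (THE R. is_pol_prod A B C Q P R)"


section \<open>Partitions\<close>

definition countable_partition :: "'a measure \<Rightarrow> 'a set set \<Rightarrow> bool" where
  "countable_partition A X \<longleftrightarrow> partition_on (space A) X \<and> countable X \<and> X \<subseteq> sets A"

text \<open>The points of the quotient are the blocks of the partition.\<close>

definition quot_proj :: "'a set set \<Rightarrow> 'a \<Rightarrow> 'a set" where
  "quot_proj X a = (THE S. S \<in> X \<and> a \<in> S)"

definition quot_space :: "'a measure \<Rightarrow> 'a set set \<Rightarrow> 'a set measure" where
  "quot_space A X = point_measure X (emeasure A)"

definition pol_m :: "'a measure \<Rightarrow> 'a set set \<Rightarrow> ('a \<times> 'a set \<times> real) measure" where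
  "pol_m A X = distr A (A \<Otimes>\<^sub>M quot_space A X \<Otimes>\<^sub>M Rpos) (\<lambda>a. (a, quot_proj X a, 1))"

definition pol_l :: "'a measure \<Rightarrow> 'a set set \<Rightarrow> ('a set \<times> 'a \<times> real) measure" where
  "pol_l A X = distr A (quot_space A X \<Otimes>\<^sub>M A \<Otimes>\<^sub>M Rpos) (\<lambda>a. (quot_proj X a, a, 1))"

definition pol_t :: "'a measure \<Rightarrow> 'a set set \<Rightarrow> ('a \<times> 'a \<times> real) measure" where
  "pol_t A X = pol_l A X \<circ>\<^bsub>(A, quot_space A X, A)\<^esub> pol_m A X"

text \<open>The generated sigma-algebra is compared with \<open>sets A\<close> modulo null sets: for a complete
  non-atomic measure no countably generated sigma-algebra contains all measurable sets.\<close>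

definition approximating :: "'a measure \<Rightarrow> (nat \<Rightarrow> 'a set set) \<Rightarrow> bool" where
  "approximating A X \<longleftrightarrow> (\<forall>n. countable_partition A (X n)) \<and>
     (\<forall>n. refines (space A) (X (Suc n)) (X n)) \<and>
     (\<forall>S\<in>sets A. \<exists>T\<in>sigma_sets (space A) (\<Union>n. X n). sym_diff S T \<in> null_sets A)"

end

theory Submission
  imports Defs "HOL-Probability.Probability"
begin

text \<open>Write \<open>z = \<i> l\<close> or \<open>z = 1 + \<i> l\<close> with \<open>l\<close> real. For a polymorphism \<open>P\<close> from \<open>A\<close> to \<open>B\<close>, the form
\<open>\<integral> f(a) g(b) t\<^sup>z dP(a,b,t)\<close> defines an operator. If \<open>z = \<i> l\<close>, the condition on the image of \<open>P\<close> in \<open>A\<close>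
makes it a contraction from \<open>L\<^sup>1(A)\<close> to \<open>L\<^sup>1(B)\<close>; if \<open>z = 1 + \<i> l\<close>, the condition on the image of
\<open>t P\<close> in \<open>B\<close> makes its transpose a contraction from \<open>L\<^sup>1(B)\<close> to \<open>L\<^sup>1(A)\<close>. The function \<open>t\<^sup>z\<close> is
multiplicative, so the product of polymorphisms goes to the composition of operators
(\<open>fwd_prod\<close>, \<open>bwd_prod\<close>). The composite of the operators of \<open>pol_m\<close> and \<open>pol_l\<close> fixes the functions
that are constant on the blocks of the partition. As the partitions of an approximating sequence
get finer, such functions exhaust a dense subspace of \<open>L\<^sup>1\<close>, and the contractions converge strongly to
the identity (\<open>averaging_tendsto\<close>). Both expressions in the theorem have as operator the same chain of
five contractions \<open>E\<^sub>Z T\<^sub>Q E\<^sub>Y T\<^sub>P E\<^sub>X\<close>, bracketed differently. Since errors do not grow under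
contractions, the chain converges strongly to \<open>T\<^sub>Q T\<^sub>P\<close> when the three indices tend to infinity
jointly (\<open>chain_limit\<close>).

Applied to indicators, this says that \<open>\<integral> t\<^sup>z d\<rr>[M \<times> K]\<close> converges to the value for \<open>Q \<circ> P\<close>. In the
coordinate \<open>ln t\<close> these integrals are the characteristic functions of \<open>\<rr>[M \<times> K]\<close> and of
\<open>t \<rr>[M \<times> K]\<close>, so Levy's continuity theorem gives the two weak convergences
(\<open>Mtri_tendsto_of_mellin\<close>).

All this presupposes that products exist and are unique. Uniqueness (\<open>is_pol_prod_unique\<close>) is Fubini's
theorem: the defining integral can be rewritten as an integral over \<open>P\<close> that contains no
disintegration of \<open>P\<close>, and symmetrically for \<open>Q\<close>. For existence
(\<open>randomized_product_exists\<close>), \<open>Q\<close> is realised by independent randomness: if \<open>b\<close> has law \<open>\<beta>\<close> and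
\<open>w\<close> is uniform in the unit square, then \<open>Q\<close> is the law of \<open>(b, c(b,w), s(b,w))\<close> for suitable functions
\<open>c\<close> and \<open>s\<close> given by the quantile transform (\<open>randomization_pair\<close>); the image of \<open>P\<close> times the uniform
measure under \<open>(a,b,t,w) \<mapsto> (a, c(b,w), t s(b,w))\<close> is then the product. The quantile transform needs
\<open>C\<close> to be, modulo null sets, the real line with some finite measure, and this is what a Lebesgue space
and a countable quotient provide (\<open>real_model_lebesgue\<close>, \<open>real_model_quot\<close>).\<close>

section \<open>Contractions of L1 spaces\<close>

lemma integrable_times_indicator:
  fixes \<psi> :: "'e \<Rightarrow> complex"
  assumes \<psi>: "integrable m \<psi>" and [measurable]: "p \<in> m \<rightarrow>\<^sub>M B" "N \<in> sets B"
  shows "integrable m (\<lambda>e. \<psi> e * indicator N (p e))"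
  by (rule Bochner_Integration.integrable_bound[OF \<psi>])
     (use borel_measurable_integrable[OF \<psi>] in \<open>auto simp: indicator_def\<close>)

lemma L1_dist_triangle:
  fixes f g h :: "'b \<Rightarrow> complex"
  assumes "integrable B f" "integrable B g" "integrable B h"
  shows "(\<integral>x. norm (f x - h x) \<partial>B) \<le> (\<integral>x. norm (f x - g x) \<partial>B) + (\<integral>x. norm (g x - h x) \<partial>B)"
proof -
  have "(\<integral>x. norm (f x - h x) \<partial>B) \<le> (\<integral>x. norm (f x - g x) + norm (g x - h x) \<partial>B)"
    using assms by (intro integral_mono) (auto intro: norm_triangle_le order_trans[OF norm_triangle_ineq[of "f x - g x" "g x - h x" for x, simplified]])
  then show ?thesis using assms by simp
qed

text \<open>An operator between \<open>L\<^sup>1\<close> spaces acts on classes of functions modulo null sets. It is represented here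
by the relation that it induces between integrable representatives, so that no representatives have
to be chosen.\<close>

locale L1_contraction =
  fixes A :: "'a measure" and B :: "'b measure"
    and T :: "('a \<Rightarrow> complex) \<Rightarrow> ('b \<Rightarrow> complex) \<Rightarrow> bool"
  assumes dom: "T f h \<Longrightarrow> integrable A f"
    and ran: "T f h \<Longrightarrow> integrable B h"
    and total: "integrable A f \<Longrightarrow> \<exists>h. T f h"
    and add: "T f h \<Longrightarrow> T f' h' \<Longrightarrow> T (\<lambda>x. f x + f' x) (\<lambda>y. h y + h' y)"
    and scale: "T f h \<Longrightarrow> T (\<lambda>x. c * f x) (\<lambda>y. c * h y)"
    and contraction: "T f h \<Longrightarrow> (\<integral>y. norm (h y) \<partial>B) \<le> (\<integral>x. norm (f x) \<partial>A)"
    and cong: "T f h \<Longrightarrow> integrable A f' \<Longrightarrow> integrable B h' \<Longrightarrow>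
      AE x in A. f x = f' x \<Longrightarrow> AE y in B. h y = h' y \<Longrightarrow> T f' h'"
begin

lemma dist_le:
  assumes "T f h" "T f' h'"
  shows "(\<integral>y. norm (h y - h' y) \<partial>B) \<le> (\<integral>x. norm (f x - f' x) \<partial>A)"
  using contraction[OF add[OF assms(1) scale[OF assms(2), of "-1"]]] by simp

text \<open>A contraction is continuous, hence its graph is closed.\<close>

lemma closed:
  assumes f: "integrable A f" and h: "integrable B h" and T: "\<And>n. T (s n) (k n)"
    and s: "(\<lambda>n. \<integral>x. norm (s n x - f x) \<partial>A) \<longlonglongrightarrow> 0"
    and k: "(\<lambda>n. \<integral>x. norm (k n x - h x) \<partial>B) \<longlonglongrightarrow> 0"
  shows "T f h"
proof -
  obtain h' where h': "T f h'" using total[OF f] by blast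
  have le: "(\<integral>x. norm (h x - h' x) \<partial>B)
      \<le> (\<integral>x. norm (k n x - h x) \<partial>B) + (\<integral>x. norm (s n x - f x) \<partial>A)" for n
    using L1_dist_triangle[OF h ran[OF T[of n]] ran[OF h']] dist_le[OF T[of n] h']
    by (simp add: norm_minus_commute)
  have "(\<lambda>n. (\<integral>x. norm (k n x - h x) \<partial>B) + (\<integral>x. norm (s n x - f x) \<partial>A)) \<longlonglongrightarrow> 0"
    using tendsto_add[OF k s] by simp
  then have "(\<integral>x. norm (h x - h' x) \<partial>B) \<le> 0"
    by (rule LIMSEQ_le_const) (use le in auto)
  then have "(\<integral>x. norm (h x - h' x) \<partial>B) = 0"
    by (intro antisym) auto
  then have "AE x in B. h' x = h x"
    using h ran[OF h'] by (subst (asm) integral_nonneg_eq_0_iff_AE) auto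
  then show ?thesis using cong[OF h' f h] by simp
qed

lemma unique:
  assumes "T f h" "T f h'"
  shows "AE y in B. h y = h' y"
proof -
  have "(\<integral>x. norm (h x - h' x) \<partial>B) \<le> 0" using dist_le[OF assms] by simp
  then have "(\<integral>x. norm (h x - h' x) \<partial>B) = 0"
    by (intro antisym) auto
  then show ?thesis
    using ran[OF assms(1)] ran[OF assms(2)] by (subst (asm) integral_nonneg_eq_0_iff_AE) auto
qed

end

lemma L1_contraction_relcompp:
  assumes "L1_contraction A B T" "L1_contraction B C S"
  shows "L1_contraction A C (T OO S)"
proof -
  interpret T: L1_contraction A B T by fact
  interpret S: L1_contraction B C S by fact
  show ?thesis
  proof
    fix f f' :: "'a \<Rightarrow> complex" and h h' :: "'c \<Rightarrow> complex"
    assume *: "(T OO S) f h" "integrable A f'" "integrable C h'"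
      "AE x in A. f x = f' x" "AE y in C. h y = h' y"
    then obtain k where k: "T f k" "S k h" by auto
    have "T f' k" using T.cong[OF k(1) *(2) S.dom[OF k(2)] *(4)] by simp
    moreover have "S k h'" using S.cong[OF k(2) S.dom[OF k(2)] *(3)] *(5) by simp
    ultimately show "(T OO S) f' h'" by auto
  next
    fix f :: "'a \<Rightarrow> complex" assume "integrable A f"
    then show "\<exists>h. (T OO S) f h" using T.total T.ran S.total by blast
  qed (auto dest: T.dom S.ran T.total intro: T.add S.add T.scale S.scale
        intro: order_trans[OF S.contraction T.contraction])
qed

lemma L1_dist_simple_tendsto:
  fixes f :: "'a \<Rightarrow> complex"
  assumes "\<And>i. integrable M (s i)" "integrable M f"
    "\<And>x. x \<in> space M \<Longrightarrow> (\<lambda>i. s i x) \<longlonglongrightarrow> f x"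
    "\<And>i x. x \<in> space M \<Longrightarrow> norm (s i x) \<le> 2 * norm (f x)"
  shows "(\<lambda>i. \<integral>x. norm (s i x - f x) \<partial>M) \<longlonglongrightarrow> 0"
proof -
  have "(\<lambda>i. \<integral>x. norm (s i x - f x) \<partial>M) \<longlonglongrightarrow> (\<integral>x. 0 \<partial>M)"
  proof (rule integral_dominated_convergence[where w = "\<lambda>x. 3 * norm (f x)"])
    show "AE x in M. (\<lambda>i. norm (s i x - f x)) \<longlonglongrightarrow> 0"
      using assms(3) by (intro AE_I2 tendsto_norm_zero LIM_zero)
    show "AE x in M. norm (norm (s i x - f x)) \<le> 3 * norm (f x)" for i
      using assms(4)[of _ i] by (intro AE_I2) (smt (verit) norm_triangle_ineq4 real_norm_def norm_ge_zero)
  qed (use assms(1,2) in auto)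
  then show ?thesis by simp
qed

text \<open>Both graphs are closed and indicators span a dense subspace of \<open>L\<^sup>1\<close>.\<close>

lemma L1_contraction_eqI:
  assumes "L1_contraction A B T" "L1_contraction A B S"
    and ind: "\<And>M. M \<in> sets A \<Longrightarrow> emeasure A M < \<infinity> \<Longrightarrow> \<exists>h. T (indicator M) h \<and> S (indicator M) h"
    and "T f h"
  shows "S f h"
proof -
  interpret T: L1_contraction A B T by fact
  interpret S: L1_contraction A B S by fact
  have "integrable A f" using \<open>T f h\<close> by (rule T.dom)
  then have "\<exists>h. T f h \<and> S f h"
  proof induction
    case (base M c)
    then obtain h where "T (indicator M) h" "S (indicator M) h" using ind by blast
    then have "T (\<lambda>x. c * indicator M x) (\<lambda>x. c * h x)" "S (\<lambda>x. c * indicator M x) (\<lambda>x. c * h x)"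
      by (auto intro: T.scale S.scale)
    moreover have "(\<lambda>x. c * indicator M x) = (\<lambda>x. indicator M x *\<^sub>R c)"
      by (auto simp: fun_eq_iff indicator_def)
    ultimately show ?case by auto
  next
    case (add f g)
    then obtain h k where "T f h" "S f h" "T g k" "S g k" by blast
    then show ?case
      by (intro exI[of _ "\<lambda>y. h y + k y"] conjI T.add S.add)
  next
    case (lim f s)
    then obtain k where k: "\<And>i. T (s i) (k i)" "\<And>i. S (s i) (k i)" by metis
    obtain h where h: "T f h" using T.total lim by blast
    have s: "(\<lambda>i. \<integral>x. norm (s i x - f x) \<partial>A) \<longlonglongrightarrow> 0"
      by (rule L1_dist_simple_tendsto) (use lim in auto)
    have "(\<lambda>i. \<integral>x. norm (k i x - h x) \<partial>B) \<longlonglongrightarrow> 0"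
      by (rule tendsto_sandwich[OF _ _ tendsto_const s]) (auto intro!: always_eventually T.dist_le[OF k(1) h])
    then have "S f h" using S.closed[OF _ T.ran[OF h] k(2) s] lim by blast
    with h show ?case by blast
  qed
  then obtain h' where h': "T f h'" "S f h'" by blast
  show ?thesis
    by (rule S.cong[OF h'(2)]) (use T.unique[OF h'(1) \<open>T f h\<close>] T.dom[OF h'(1)] T.ran[OF \<open>T f h\<close>] in auto)
qed

section \<open>Integral operators of weighted correspondences\<close>

text \<open>By linearity the identity passes from indicators to simple functions. Simple functions \<open>s\<^sub>i\<close> with
\<open>\<bar>s\<^sub>i\<bar> \<le> 2 \<bar>\<sigma>\<bar>\<close> approximate \<open>\<sigma>\<close>, and dominated convergence applies because both products with \<open>\<sigma>\<close> are
integrable; so either \<open>\<sigma>\<close> or its partner may be the unbounded factor.\<close>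

lemma pairing_extend:
  fixes \<phi> :: "'e \<Rightarrow> complex" and g :: "'b \<Rightarrow> complex" and \<sigma> :: "'b \<Rightarrow> complex"
  assumes \<phi>: "integrable m \<phi>" and g: "integrable B g" and p[measurable]: "p \<in> m \<rightarrow>\<^sub>M B"
    and eq: "\<And>N. N \<in> sets B \<Longrightarrow> (\<integral>e. \<phi> e * indicator N (p e) \<partial>m) = (\<integral>b. g b * indicator N b \<partial>B)"
    and \<sigma>[measurable]: "\<sigma> \<in> borel_measurable B"
    and i1: "integrable m (\<lambda>e. \<phi> e * \<sigma> (p e))" and i2: "integrable B (\<lambda>b. g b * \<sigma> b)"
  shows "(\<integral>e. \<phi> e * \<sigma> (p e) \<partial>m) = (\<integral>b. g b * \<sigma> b \<partial>B)"
proof -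
  note [measurable] = borel_measurable_integrable[OF \<phi>] borel_measurable_integrable[OF g]
  from borel_measurable_implies_sequence_metric[OF \<sigma>, of 0]
  obtain s where s: "\<And>i. simple_function B (s i)" "\<And>x. x \<in> space B \<Longrightarrow> (\<lambda>i. s i x) \<longlonglongrightarrow> \<sigma> x"
    "\<And>i x. x \<in> space B \<Longrightarrow> norm (s i x) \<le> 2 * norm (\<sigma> x)"
    unfolding norm_conv_dist by metis
  have [measurable]: "s i \<in> borel_measurable B" for i
    by (rule borel_measurable_simple_function[OF s(1)])
  have simple: "(\<integral>e. \<phi> e * s i (p e) \<partial>m) = (\<integral>b. g b * s i b \<partial>B)" for i
  proof -
    let ?R = "s i ` space B" and ?S = "\<lambda>y. s i -` {y} \<inter> space B"
    have fin: "finite ?R" using s(1)[of i] by (rule simple_functionD)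
    have S[measurable]: "?S y \<in> sets B" for y by measurable
    have rep: "s i x = (\<Sum>y\<in>?R. y * indicator (?S y) x)" if "x \<in> space B" for x
    proof -
      have "(\<Sum>y\<in>?R. y * indicator (?S y) x) = (\<Sum>y\<in>?R. if y = s i x then y else 0)"
        using that by (intro sum.cong) (auto simp: indicator_def)
      also have "\<dots> = s i x" using that fin by (subst sum.delta) auto
      finally show ?thesis by simp
    qed
    have psp: "e \<in> space m \<Longrightarrow> p e \<in> space B" for e using p by (rule measurable_space)
    have int1: "integrable m (\<lambda>e. \<phi> e * indicator (?S y) (p e))" for y
      by (rule Bochner_Integration.integrable_bound[OF \<phi>]) (auto simp: indicator_def)
    have int2: "integrable B (\<lambda>e. g e * indicator (?S y) e)" for y
      by (rule Bochner_Integration.integrable_bound[OF g]) (auto simp: indicator_def)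
    have "(\<integral>e. \<phi> e * s i (p e) \<partial>m) = (\<integral>e. (\<Sum>y\<in>?R. y * (\<phi> e * indicator (?S y) (p e))) \<partial>m)"
      by (intro Bochner_Integration.integral_cong refl, subst rep)
         (auto simp: psp sum_distrib_left mult_ac)
    also have "\<dots> = (\<Sum>y\<in>?R. y * (\<integral>e. \<phi> e * indicator (?S y) (p e) \<partial>m))"
      using int1 by (subst Bochner_Integration.integral_sum) (auto simp: )
    also have "\<dots> = (\<Sum>y\<in>?R. y * (\<integral>e. g e * indicator (?S y) e \<partial>B))"
      using eq[OF S] by simp
    also have "\<dots> = (\<integral>e. (\<Sum>y\<in>?R. y * (g e * indicator (?S y) e)) \<partial>B)"
      using int2 by (subst Bochner_Integration.integral_sum) (auto simp: )
    also have "\<dots> = (\<integral>e. g e * s i e \<partial>B)"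
      by (intro Bochner_Integration.integral_cong refl, subst rep)
         (auto simp: sum_distrib_left mult_ac)
    finally show ?thesis .
  qed
  have bd: "norm (c * s i x) \<le> 2 * norm (c * \<sigma> x)" if "x \<in> space B" for c i x
    using mult_left_mono[OF s(3)[OF that, of i] norm_ge_zero[of c]] by (simp add: norm_mult mult_ac)
  have "(\<lambda>i. \<integral>e. \<phi> e * s i (p e) \<partial>m) \<longlonglongrightarrow> (\<integral>e. \<phi> e * \<sigma> (p e) \<partial>m)"
    by (rule integral_dominated_convergence[where w = "\<lambda>e. 2 * norm (\<phi> e * \<sigma> (p e))"])
       (use integrable_norm[OF i1] s(2) bd measurable_space[OF p] in \<open>auto intro!: tendsto_intros\<close>)
  moreover have "(\<lambda>i. \<integral>e. g e * s i e \<partial>B) \<longlonglongrightarrow> (\<integral>b. g b * \<sigma> b \<partial>B)"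
    by (rule integral_dominated_convergence[where w = "\<lambda>e. 2 * norm (g e * \<sigma> e)"])
       (use integrable_norm[OF i2] s(2) bd in \<open>auto intro!: tendsto_intros\<close>)
  ultimately show ?thesis unfolding simple by (rule LIMSEQ_unique)
qed

text \<open>The function \<open>h\<close> is the Radon-Nikodym density of the image of \<open>\<phi> m\<close> under \<open>p\<close>.\<close>

lemma nonneg_density_of_image:
  fixes \<phi> :: "'e \<Rightarrow> real"
  assumes \<phi>: "integrable m \<phi>" "\<And>e. 0 \<le> \<phi> e" and B: "finite_measure B" and p[measurable]: "p \<in> m \<rightarrow>\<^sub>M B"
    and ac: "\<And>N. N \<in> null_sets B \<Longrightarrow> AE e in m. p e \<notin> N"
  shows "\<exists>h. integrable B h \<and> (\<forall>N\<in>sets B. (\<integral>e. \<phi> e * indicator N (p e) \<partial>m) = (\<integral>b. h b * indicator N b \<partial>B))"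
proof -
  interpret B: finite_measure B by fact
  note [measurable] = borel_measurable_integrable[OF \<phi>(1)]
  let ?\<nu> = "distr (density m \<phi>) B p"
  have em: "emeasure ?\<nu> N = (\<integral>\<^sup>+e. ennreal (\<phi> e) * indicator N (p e) \<partial>m)" if [measurable]: "N \<in> sets B" for N
  proof -
    have "emeasure ?\<nu> N = (\<integral>\<^sup>+e. ennreal (\<phi> e) * indicator (p -` N \<inter> space m) e \<partial>m)"
      by (simp add: emeasure_distr emeasure_density)
    also have "\<dots> = (\<integral>\<^sup>+e. ennreal (\<phi> e) * indicator N (p e) \<partial>m)"
      by (intro nn_integral_cong) (auto simp: indicator_def)
    finally show ?thesis .
  qed
  have "absolutely_continuous B ?\<nu>"
    unfolding absolutely_continuous_def
  proof
    fix N assume N: "N \<in> null_sets B"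
    then have [measurable]: "N \<in> sets B" by auto
    have "emeasure ?\<nu> N = (\<integral>\<^sup>+e. 0 \<partial>m)"
      unfolding em[OF \<open>N \<in> sets B\<close>] by (intro nn_integral_cong_AE) (use ac[OF N] in eventually_elim, auto)
    then show "N \<in> null_sets ?\<nu>" by (auto simp: null_sets_def)
  qed
  from B.Radon_Nikodym[OF this] obtain f where f[measurable]: "f \<in> borel_measurable B"
    and fd: "density B f = ?\<nu>" by auto
  have eq: "(\<integral>\<^sup>+b. f b * indicator N b \<partial>B) = (\<integral>\<^sup>+e. ennreal (\<phi> e) * indicator N (p e) \<partial>m)"
    if "N \<in> sets B" for N
    using em[OF that] that by (simp add: fd[symmetric] emeasure_density)
  have "(\<integral>\<^sup>+b. f b \<partial>B) = (\<integral>\<^sup>+b. f b * indicator (space B) b \<partial>B)"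
    by (intro nn_integral_cong) auto
  also have "\<dots> = (\<integral>\<^sup>+e. ennreal (\<phi> e) * indicator (space B) (p e) \<partial>m)" by (rule eq) auto
  also have "\<dots> \<le> (\<integral>\<^sup>+e. ennreal (norm (\<phi> e)) \<partial>m)"
    using \<phi>(2) by (intro nn_integral_mono) (auto simp: indicator_def)
  also have "\<dots> < \<infinity>" using \<phi>(1) by (simp add: integrable_iff_bounded)
  finally have fin: "(\<integral>\<^sup>+b. f b \<partial>B) < \<infinity>" .
  then have AE: "AE b in B. ennreal (enn2real (f b)) = f b"
    using nn_integral_PInf_AE[OF f] by (auto simp: less_top elim!: eventually_mono)
  let ?h = "\<lambda>b. enn2real (f b)"
  have "(\<integral>\<^sup>+b. ennreal (?h b) \<partial>B) = (\<integral>\<^sup>+b. f b \<partial>B)"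
    by (rule nn_integral_cong_AE[OF AE])
  then have int: "integrable B ?h" using fin by (intro integrableI_nonneg) auto
  have "(\<integral>e. \<phi> e * indicator N (p e) \<partial>m) = (\<integral>b. ?h b * indicator N b \<partial>B)" if N[measurable]: "N \<in> sets B" for N
  proof -
    have "(\<integral>e. \<phi> e * indicator N (p e) \<partial>m) = enn2real (\<integral>\<^sup>+e. ennreal (\<phi> e * indicator N (p e)) \<partial>m)"
      using \<phi>(2) by (intro integral_eq_nn_integral) auto
    also have "(\<integral>\<^sup>+e. ennreal (\<phi> e * indicator N (p e)) \<partial>m) = (\<integral>\<^sup>+e. ennreal (\<phi> e) * indicator N (p e) \<partial>m)"
      by (intro nn_integral_cong) (auto simp: indicator_def)
    also have "\<dots> = (\<integral>\<^sup>+b. f b * indicator N b \<partial>B)" using eq[OF N] by simp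
    also have "\<dots> = (\<integral>\<^sup>+b. ennreal (?h b * indicator N b) \<partial>B)"
      by (rule nn_integral_cong_AE, use AE in eventually_elim) (auto simp: indicator_def)
    also have "enn2real \<dots> = (\<integral>b. ?h b * indicator N b \<partial>B)"
      by (intro integral_eq_nn_integral[symmetric]) auto
    finally show ?thesis .
  qed
  with int show ?thesis by blast
qed

lemma complex_density_of_image:
  fixes \<phi> :: "'e \<Rightarrow> complex" and B :: "'b measure"
  assumes \<phi>: "integrable m \<phi>" and B: "finite_measure B" and p[measurable]: "p \<in> m \<rightarrow>\<^sub>M B"
    and ac: "\<And>N. N \<in> null_sets B \<Longrightarrow> AE e in m. p e \<notin> N"
  shows "\<exists>h. integrable B h \<and> (\<forall>N\<in>sets B. (\<integral>e. \<phi> e * indicator N (p e) \<partial>m) = (\<integral>b. h b * indicator N b \<partial>B))"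
proof -
  have cut: "integrable B (\<lambda>b. h b * indicator N b)" if "integrable B h" "N \<in> sets B" for h :: "'b \<Rightarrow> complex" and N
    by (rule integrable_times_indicator[OF that(1) _ that(2)]) simp
  have cut_m: "integrable m (\<lambda>e. \<psi> e * indicator N (p e))" if "integrable m \<psi>" "N \<in> sets B" for \<psi> :: "'e \<Rightarrow> complex" and N
    by (rule integrable_times_indicator[OF that(1) _ that(2)]) simp
  have pos: "\<exists>h :: 'b \<Rightarrow> complex. integrable B h \<and> (\<forall>N\<in>sets B. (\<integral>e. c * complex_of_real (\<psi> e) * indicator N (p e) \<partial>m) = (\<integral>b. h b * indicator N b \<partial>B))"
    if \<psi>: "integrable m \<psi>" "\<And>e. 0 \<le> \<psi> e" for \<psi> c
  proof -
    from nonneg_density_of_image[OF \<psi> B p ac] obtain h where h: "integrable B h"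
      "\<And>N. N \<in> sets B \<Longrightarrow> (\<integral>e. \<psi> e * indicator N (p e) \<partial>m) = (\<integral>b. h b * indicator N b \<partial>B)" by blast
    have "(\<integral>e. c * complex_of_real (\<psi> e) * indicator N (p e) \<partial>m) = (\<integral>b. c * complex_of_real (h b) * indicator N b \<partial>B)"
      if "N \<in> sets B" for N
    proof -
      have "(\<integral>e. c * complex_of_real (\<psi> e) * indicator N (p e) \<partial>m) = (\<integral>e. c * complex_of_real (\<psi> e * indicator N (p e)) \<partial>m)"
        by (intro Bochner_Integration.integral_cong) (auto simp: indicator_def)
      also have "\<dots> = c * complex_of_real (\<integral>e. \<psi> e * indicator N (p e) \<partial>m)"
        by (simp only: integral_mult_right_zero integral_complex_of_real)
      also have "\<dots> = (\<integral>b. c * complex_of_real (h b * indicator N b) \<partial>B)"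
        using h(2)[OF that] by (simp only: integral_mult_right_zero integral_complex_of_real)
      also have "\<dots> = (\<integral>b. c * complex_of_real (h b) * indicator N b \<partial>B)"
        by (intro Bochner_Integration.integral_cong) (auto simp: indicator_def)
      finally show ?thesis .
    qed
    then show ?thesis using h(1) by (intro exI[of _ "\<lambda>b. c * complex_of_real (h b)"]) auto
  qed
  have sum: "\<exists>h. integrable B h \<and> (\<forall>N\<in>sets B. (\<integral>e. (\<psi>1 e + \<psi>2 e) * indicator N (p e) \<partial>m) = (\<integral>b. h b * indicator N b \<partial>B))"
    if "integrable m \<psi>1" "integrable m \<psi>2"
      and 1: "\<exists>h. integrable B h \<and> (\<forall>N\<in>sets B. (\<integral>e. \<psi>1 e * indicator N (p e) \<partial>m) = (\<integral>b. h b * indicator N b \<partial>B))"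
      and 2: "\<exists>h. integrable B h \<and> (\<forall>N\<in>sets B. (\<integral>e. \<psi>2 e * indicator N (p e) \<partial>m) = (\<integral>b. h b * indicator N b \<partial>B))"
    for \<psi>1 \<psi>2 :: "'e \<Rightarrow> complex"
  proof -
    from 1 obtain h1 where h1: "integrable B h1" "\<And>N. N \<in> sets B \<Longrightarrow> (\<integral>e. \<psi>1 e * indicator N (p e) \<partial>m) = (\<integral>b. h1 b * indicator N b \<partial>B)" by blast
    from 2 obtain h2 where h2: "integrable B h2" "\<And>N. N \<in> sets B \<Longrightarrow> (\<integral>e. \<psi>2 e * indicator N (p e) \<partial>m) = (\<integral>b. h2 b * indicator N b \<partial>B)" by blast
    show ?thesis
      using h1 h2 that(1,2) cut cut_m
      by (intro exI[of _ "\<lambda>b. h1 b + h2 b"]) (auto simp: distrib_right)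
  qed
  let ?re = "\<lambda>e. Re (\<phi> e)" and ?im = "\<lambda>e. Im (\<phi> e)"
  have re: "integrable m ?re" "integrable m ?im" using \<phi> by auto
  have ints: "integrable m (\<lambda>e. max 0 (?re e))" "integrable m (\<lambda>e. max 0 (- ?re e))"
    "integrable m (\<lambda>e. max 0 (?im e))" "integrable m (\<lambda>e. max 0 (- ?im e))"
    using re by auto
  have ex: "\<exists>h. integrable B h \<and> (\<forall>N\<in>sets B. (\<integral>e. ((1 * complex_of_real (max 0 (?re e)) + (-1) * complex_of_real (max 0 (- ?re e)))
      + (\<i> * complex_of_real (max 0 (?im e)) + (-\<i>) * complex_of_real (max 0 (- ?im e)))) * indicator N (p e) \<partial>m) = (\<integral>b. h b * indicator N b \<partial>B))"
    using ints by (intro sum pos) (auto intro!: Bochner_Integration.integrable_add integrable_mult_right integrable_of_real)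
  have "(1 * complex_of_real (max 0 (?re e)) + (-1) * complex_of_real (max 0 (- ?re e)))
      + (\<i> * complex_of_real (max 0 (?im e)) + (-\<i>) * complex_of_real (max 0 (- ?im e))) = \<phi> e" for e
    by (auto simp: complex_eq_iff max_def)
  with ex show ?thesis by simp
qed

text \<open>The integral operator with kernel \<open>u\<close> on the correspondence \<open>m\<close>: \<open>h\<close> is the density of the image of
the complex measure \<open>(f \<circ> p) u m\<close> under \<open>q\<close>.\<close>

definition coupling_op :: "'e measure \<Rightarrow> ('e \<Rightarrow> 'a) \<Rightarrow> ('e \<Rightarrow> 'b) \<Rightarrow> ('e \<Rightarrow> complex) \<Rightarrow>
    'a measure \<Rightarrow> 'b measure \<Rightarrow> ('a \<Rightarrow> complex) \<Rightarrow> ('b \<Rightarrow> complex) \<Rightarrow> bool" where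
  "coupling_op m p q u A B f h \<longleftrightarrow> integrable A f \<and> integrable B h \<and>
     (\<forall>N\<in>sets B. (\<integral>e. f (p e) * u e * indicator N (q e) \<partial>m) = (\<integral>b. h b * indicator N b \<partial>B))"

text \<open>The marginal condition says that the image of \<open>\<bar>u\<bar> m\<close> under \<open>p\<close> is \<open>A\<close>, which makes the operator a
contraction; the condition on null sets yields the density that defines its value.\<close>

locale coupling =
  fixes m :: "'e measure" and p :: "'e \<Rightarrow> 'a" and q :: "'e \<Rightarrow> 'b" and u :: "'e \<Rightarrow> complex"
    and A :: "'a measure" and B :: "'b measure"
  assumes p[measurable]: "p \<in> m \<rightarrow>\<^sub>M A" and q[measurable]: "q \<in> m \<rightarrow>\<^sub>M B"
    and u[measurable]: "u \<in> borel_measurable m" and B: "finite_measure B"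
    and marginal: "\<And>\<phi>. \<phi> \<in> borel_measurable A \<Longrightarrow>
      (\<integral>\<^sup>+e. \<phi> (p e) * ennreal (norm (u e)) \<partial>m) = (\<integral>\<^sup>+a. \<phi> a \<partial>A)"
    and null: "\<And>N. N \<in> null_sets B \<Longrightarrow> AE e in m. q e \<notin> N"
begin

lemma nn_integral_norm_pull:
  assumes f[measurable]: "f \<in> borel_measurable A"
  shows "(\<integral>\<^sup>+e. ennreal (norm (f (p e) * u e)) \<partial>m) = (\<integral>\<^sup>+a. ennreal (norm (f a)) \<partial>A)"
  using marginal[of "\<lambda>a. ennreal (norm (f a))"] by (simp add: norm_mult ennreal_mult)

lemma integrable_pull:
  assumes "integrable A f" shows "integrable m (\<lambda>e. f (p e) * u e)"
proof -
  note [measurable] = borel_measurable_integrable[OF assms]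
  show ?thesis using assms nn_integral_norm_pull[of f] by (auto simp: integrable_iff_bounded)
qed

lemma integral_norm_pull:
  assumes "integrable A f" shows "(\<integral>e. norm (f (p e) * u e) \<partial>m) = (\<integral>a. norm (f a) \<partial>A)"
proof -
  note [measurable] = borel_measurable_integrable[OF assms]
  show ?thesis
    using nn_integral_norm_pull[of f] by (simp add: integral_eq_nn_integral)
qed

text \<open>The norm of \<open>h\<close> is the integral of \<open>h\<close> against its conjugate phase \<open>\<sigma>\<close>. Since \<open>\<bar>\<sigma>\<bar> \<le> 1\<close>, pulling the
integral back to \<open>m\<close> bounds it by the integral of \<open>\<bar>f \<circ> p\<bar> \<bar>u\<bar>\<close>, which is the norm of \<open>f\<close>.\<close>

lemma L1_contraction_op: "L1_contraction A B (coupling_op m p q u A B)"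
proof
  fix f :: "'a \<Rightarrow> complex" and h :: "'b \<Rightarrow> complex"
  assume "coupling_op m p q u A B f h"
  then have f: "integrable A f" and h: "integrable B h"
    and eq: "\<And>N. N \<in> sets B \<Longrightarrow> (\<integral>e. f (p e) * u e * indicator N (q e) \<partial>m) = (\<integral>b. h b * indicator N b \<partial>B)"
    by (auto simp: coupling_op_def)
  note [measurable] = borel_measurable_integrable[OF f] borel_measurable_integrable[OF h]
  define \<sigma> where "\<sigma> b = cnj (sgn (h b))" for b
  have [measurable]: "cnj \<in> borel_measurable borel"
    by (intro borel_measurable_continuous_onI continuous_intros)
  have "(\<lambda>b. sgn (h b)) \<in> borel_measurable B"
    unfolding sgn_div_norm scaleR_conv_of_real by measurable
  then have [measurable]: "\<sigma> \<in> borel_measurable B" unfolding \<sigma>_def by measurable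
  have \<sigma>1: "norm (\<sigma> b) \<le> 1" for b by (simp add: \<sigma>_def norm_sgn)
  have h\<sigma>: "h b * \<sigma> b = complex_of_real (norm (h b))" for b
    by (simp add: \<sigma>_def sgn_div_norm scaleR_conv_of_real complex_norm_square[symmetric] power2_eq_square field_simps)
  have i1: "integrable m (\<lambda>e. f (p e) * u e * \<sigma> (q e))"
    using \<sigma>1 by (intro Bochner_Integration.integrable_bound[OF integrable_pull[OF f]]) (auto simp: norm_mult mult_left_le)
  have i2: "integrable B (\<lambda>b. h b * \<sigma> b)"
    unfolding h\<sigma> using h by (intro integrable_of_real integrable_norm)
  have "complex_of_real (\<integral>b. norm (h b) \<partial>B) = (\<integral>b. h b * \<sigma> b \<partial>B)"
    unfolding h\<sigma> by simp
  also have "\<dots> = (\<integral>e. f (p e) * u e * \<sigma> (q e) \<partial>m)"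
    by (rule pairing_extend[symmetric, OF integrable_pull[OF f] h q eq _ i1 i2]) auto
  finally have "norm (complex_of_real (\<integral>b. norm (h b) \<partial>B)) = norm (\<integral>e. f (p e) * u e * \<sigma> (q e) \<partial>m)"
    by (rule arg_cong)
  then have "(\<integral>b. norm (h b) \<partial>B) = norm (\<integral>e. f (p e) * u e * \<sigma> (q e) \<partial>m)"
    unfolding norm_of_real by (subst (asm) abs_of_nonneg) auto
  also have "\<dots> \<le> (\<integral>e. norm (f (p e) * u e * \<sigma> (q e)) \<partial>m)" by (rule integral_norm_bound)
  also have "\<dots> \<le> (\<integral>e. norm (f (p e) * u e) \<partial>m)"
    using i1 integrable_pull[OF f] \<sigma>1 by (intro integral_mono integrable_norm) (auto simp: norm_mult mult_left_le)
  also have "\<dots> = (\<integral>a. norm (f a) \<partial>A)" by (rule integral_norm_pull[OF f])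
  finally show "(\<integral>b. norm (h b) \<partial>B) \<le> (\<integral>a. norm (f a) \<partial>A)" .
next
  fix f f' :: "'a \<Rightarrow> complex" and h h' :: "'b \<Rightarrow> complex"
  assume *: "coupling_op m p q u A B f h" "integrable A f'" "integrable B h'"
    "AE x in A. f x = f' x" "AE y in B. h y = h' y"
  then have f: "integrable A f" "integrable B h" by (auto simp: coupling_op_def)
  note [measurable] = borel_measurable_integrable[OF f(1)] borel_measurable_integrable[OF *(2)]
     borel_measurable_integrable[OF f(2)] borel_measurable_integrable[OF *(3)]
  have "integrable A (\<lambda>a. f a - f' a)" using f *(2) by auto
  then have "(\<integral>e. norm ((f (p e) - f' (p e)) * u e) \<partial>m) = (\<integral>a. norm (f a - f' a) \<partial>A)"
    by (rule integral_norm_pull)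
  also have "\<dots> = (\<integral>a. 0 \<partial>A)" by (rule integral_cong_AE) (use *(4) in auto)
  finally have "(\<integral>e. norm ((f (p e) - f' (p e)) * u e) \<partial>m) = 0" by simp
  then have "AE e in m. (f (p e) - f' (p e)) * u e = 0"
    using integrable_pull[of "\<lambda>a. f a - f' a"] f *(2) by (subst (asm) integral_nonneg_eq_0_iff_AE) auto
  then have AE: "AE e in m. f (p e) * u e = f' (p e) * u e" by (auto simp: algebra_simps)
  have "(\<integral>e. f (p e) * u e * indicator N (q e) \<partial>m) = (\<integral>e. f' (p e) * u e * indicator N (q e) \<partial>m)"
    if [measurable]: "N \<in> sets B" for N
    by (rule integral_cong_AE) (use AE in \<open>auto elim!: eventually_mono\<close>)
  moreover have "(\<integral>b. h b * indicator N b \<partial>B) = (\<integral>b. h' b * indicator N b \<partial>B)"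
    if [measurable]: "N \<in> sets B" for N
    by (rule integral_cong_AE) (use *(5) in \<open>auto elim!: eventually_mono\<close>)
  ultimately show "coupling_op m p q u A B f' h'"
    using *(1-3) by (auto simp: coupling_op_def)
next
  fix f :: "'a \<Rightarrow> complex" assume f: "integrable A f"
  show "\<exists>h. coupling_op m p q u A B f h"
    using complex_density_of_image[OF integrable_pull[OF f] B q null] f by (auto simp: coupling_op_def)
next
  fix f f' :: "'a \<Rightarrow> complex" and h h' :: "'b \<Rightarrow> complex"
  assume *: "coupling_op m p q u A B f h" "coupling_op m p q u A B f' h'"
  have cut: "integrable B (\<lambda>b. h b * indicator N b)" if "integrable B h" "N \<in> sets B" for h :: "'b \<Rightarrow> complex" and N
    by (rule integrable_times_indicator[OF that(1) _ that(2)]) simp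
  have cut_m: "integrable m (\<lambda>e. \<psi> e * indicator N (q e))" if "integrable m \<psi>" "N \<in> sets B" for \<psi> :: "'e \<Rightarrow> complex" and N
    by (rule integrable_times_indicator[OF that(1) _ that(2)]) simp
  from * show "coupling_op m p q u A B (\<lambda>x. f x + f' x) (\<lambda>y. h y + h' y)"
    using integrable_pull by (auto simp: coupling_op_def distrib_right cut cut_m)
next
  fix f :: "'a \<Rightarrow> complex" and h :: "'b \<Rightarrow> complex" and c assume "coupling_op m p q u A B f h"
  then show "coupling_op m p q u A B (\<lambda>x. c * f x) (\<lambda>y. c * h y)"
    by (auto simp: coupling_op_def mult.assoc)
qed (auto simp: coupling_op_def)

end

section \<open>Realisation of measures by independent randomness\<close>

lemma emeasure_distr_eq_nn_integral:
  assumes "f \<in> M \<rightarrow>\<^sub>M N" "S \<in> sets N"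
  shows "emeasure (distr M N f) S = (\<integral>\<^sup>+x. indicator S (f x) \<partial>M)"
  using assms by (subst nn_integral_distr[where f = "indicator S", symmetric]) auto

lemma measure_eqI_Times:
  assumes sets: "sets \<mu> = sets (B \<Otimes>\<^sub>M L)" "sets \<nu> = sets (B \<Otimes>\<^sub>M L)"
    and fin: "emeasure \<mu> (space B \<times> space L) \<noteq> \<infinity>"
    and eq: "\<And>N S. N \<in> sets B \<Longrightarrow> S \<in> sets L \<Longrightarrow> emeasure \<mu> (N \<times> S) = emeasure \<nu> (N \<times> S)"
  shows "\<mu> = \<nu>"
proof (rule measure_eqI_generator_eq[OF Int_stable_pair_measure_generator[of B L]])
  show "{a \<times> b |a b. a \<in> sets B \<and> b \<in> sets L} \<subseteq> Pow (space B \<times> space L)"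
    using sets.sets_into_space[of _ B] sets.sets_into_space[of _ L] by auto
  show "sets \<mu> = sigma_sets (space B \<times> space L) {a \<times> b |a b. a \<in> sets B \<and> b \<in> sets L}"
    "sets \<nu> = sigma_sets (space B \<times> space L) {a \<times> b |a b. a \<in> sets B \<and> b \<in> sets L}"
    using sets by (auto simp: sets_pair_measure)
  show "range (\<lambda>_::nat. space B \<times> space L) \<subseteq> {a \<times> b |a b. a \<in> sets B \<and> b \<in> sets L}" by auto
qed (use eq fin in auto)

text \<open>For a fixed \<open>N\<close> the traces on the second factor are finite measures on the line, and these are
determined by their values on half-lines.\<close>

lemma measure_eqI_Times_greaterThan:
  fixes \<mu> \<nu> :: "('b \<times> real) measure"
  assumes sets: "sets \<mu> = sets (B \<Otimes>\<^sub>M borel)" "sets \<nu> = sets (B \<Otimes>\<^sub>M borel)"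
    and fin: "emeasure \<mu> (space \<mu>) \<noteq> \<infinity>"
    and eq: "\<And>N x. N \<in> sets B \<Longrightarrow> emeasure \<mu> (N \<times> {x<..}) = emeasure \<nu> (N \<times> {x<..})"
  shows "\<mu> = \<nu>"
proof (rule measure_eqI_Times[OF sets])
  have sp: "space \<mu> = space B \<times> UNIV" "space \<nu> = space B \<times> UNIV"
    using sets[THEN sets_eq_imp_space_eq] by (auto simp: space_pair_measure)
  show "emeasure \<mu> (space B \<times> space borel) \<noteq> \<infinity>" using fin by (simp add: sp)
  fix N and S :: "real set" assume N[measurable]: "N \<in> sets B" and S: "S \<in> sets borel"
  let ?d = "\<lambda>\<mu>. distr (density \<mu> (indicator (N \<times> UNIV))) borel snd"
  have em: "emeasure (?d \<kappa>) S = emeasure \<kappa> (N \<times> S)"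
    if [measurable_cong, simp]: "sets \<kappa> = sets (B \<Otimes>\<^sub>M borel)" and [measurable]: "S \<in> sets borel" for \<kappa> S
  proof -
    have sp: "space \<kappa> = space B \<times> UNIV"
      using sets_eq_imp_space_eq[OF that(1)] by (auto simp: space_pair_measure)
    have "emeasure (?d \<kappa>) S = (\<integral>\<^sup>+e. indicator (N \<times> UNIV) e * indicator (snd -` S \<inter> space \<kappa>) e \<partial>\<kappa>)"
      by (subst emeasure_distr, simp, simp, subst emeasure_density)
         (auto intro!: measurable_sets[of snd \<kappa> borel] simp del: that(1))
    also have "\<dots> = (\<integral>\<^sup>+e. indicator (N \<times> S) e \<partial>\<kappa>)"
      using sets.sets_into_space[OF N] by (intro nn_integral_cong) (auto simp: indicator_def sp)
    also have "\<dots> = emeasure \<kappa> (N \<times> S)" by (intro nn_integral_indicator) simp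
    finally show ?thesis .
  qed
  have "?d \<mu> = ?d \<nu>"
  proof (rule measure_eqI_lessThan)
    fix x :: real
    have "emeasure \<mu> (N \<times> {x<..}) \<le> emeasure \<mu> (space \<mu>)"
      using sets.sets_into_space[OF N] by (intro emeasure_mono) (auto simp: sp sets)
    then show "emeasure (?d \<mu>) {x<..} < \<infinity>" using fin by (auto simp: em[OF sets(1)] less_top[symmetric] top_unique)
    show "emeasure (?d \<mu>) {x<..} = emeasure (?d \<nu>) {x<..}" using eq[OF N] by (simp add: em sets)
  qed auto
  then show "emeasure \<mu> (N \<times> S) = emeasure \<nu> (N \<times> S)"
    using em[OF sets(1) S] em[OF sets(2) S] by simp
qed

text \<open>A source of randomness. It lives on all of the real line, with the Borel sets, to avoid restricted
spaces.\<close>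

definition unif :: "real measure" where
  "unif = uniform_measure lborel {0<..<1}"

lemma prob_space_unif: "prob_space unif"
  unfolding unif_def by (rule prob_space_uniform_measure) auto

lemma sets_unif[simp, measurable_cong]: "sets unif = sets borel"
  by (simp add: unif_def)

lemma space_unif[simp]: "space unif = UNIV"
  by (simp add: unif_def)

lemma emeasure_unif_less:
  assumes "c \<le> 1" shows "emeasure unif {u. ennreal u < c} = c"
proof (cases c)
  case (real r)
  then have r: "0 \<le> r" "r \<le> 1" "c = ennreal r" using assms by auto
  have "{0<..<1} \<inter> {u. ennreal u < c} = {0<..<r}"
    using r by (auto simp: ennreal_less_iff)
  then show ?thesis
    using r by (simp add: unif_def divide_ennreal_def)
qed (use assms in \<open>simp add: top_unique\<close>)

text \<open>An increasing bijection of the line onto the open unit interval, with an inverse that is Borel on the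
whole line.\<close>

definition to_unit :: "real \<Rightarrow> real" where
  "to_unit x = (1 + x / (1 + \<bar>x\<bar>)) / 2"

definition from_unit :: "real \<Rightarrow> real" where
  "from_unit y = (2 * y - 1) / (1 - \<bar>2 * y - 1\<bar>)"

lemma to_unit_measurable[measurable]: "to_unit \<in> borel_measurable borel"
  and from_unit_measurable[measurable]: "from_unit \<in> borel_measurable borel"
  unfolding to_unit_def[abs_def] from_unit_def[abs_def] by measurable

lemma to_unit: "0 < to_unit x" "to_unit x < 1"
  by (auto simp: to_unit_def field_simps abs_if)

lemma from_to_unit: "from_unit (to_unit x) = x"
  by (cases "0 \<le> x") (auto simp: to_unit_def from_unit_def field_simps abs_if)

text \<open>The quantile transform. Let \<open>F q b\<close> be the conditional probability of \<open>{q<..}\<close> given \<open>b\<close>, for rational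
\<open>q\<close>, and let \<open>X (b, u)\<close> be the supremum of the \<open>q\<close> with \<open>u < F q b\<close>. Then \<open>x < X (b, u)\<close> holds iff
\<open>u < F q b\<close> for some rational \<open>q > x\<close>, an event of probability \<open>sup {F q b | q > x}\<close>, and this is the
conditional probability of \<open>{x<..}\<close>. Values in the unit interval keep the supremum finite and make
\<open>0\<close> a harmless default for an empty set of \<open>q\<close>.\<close>

lemma unit_randomization:
  fixes \<mu> :: "('b \<times> real) measure"
  assumes B: "finite_measure B" and sets[simp, measurable_cong]: "sets \<mu> = sets (B \<Otimes>\<^sub>M borel)"
    and marg: "distr \<mu> B fst = B" and unit: "AE e in \<mu>. 0 < snd e \<and> snd e < 1"
  shows "\<exists>X\<in>borel_measurable (B \<Otimes>\<^sub>M borel). \<mu> = distr (B \<Otimes>\<^sub>M unif) (B \<Otimes>\<^sub>M borel) (\<lambda>(b, u). (b, X (b, u)))"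
proof -
  interpret B: finite_measure B by fact
  interpret unif: prob_space unif by (rule prob_space_unif)
  have sp: "space \<mu> = space B \<times> UNIV"
    using sets[THEN sets_eq_imp_space_eq] by (auto simp: space_pair_measure)
  have margN: "emeasure \<mu> (N \<times> UNIV) = emeasure B N" if [measurable]: "N \<in> sets B" for N
  proof -
    have "emeasure B N = emeasure (distr \<mu> B fst) N" by (simp add: marg)
    also have "\<dots> = emeasure \<mu> (fst -` N \<inter> space \<mu>)" by (rule emeasure_distr) auto
    also have "fst -` N \<inter> space \<mu> = N \<times> UNIV" using sets.sets_into_space[OF that] by (auto simp: sp)
    finally show ?thesis by simp
  qed
  have "emeasure \<mu> (space \<mu>) = emeasure B (space B)" using margN[of "space B"] by (simp add: sp)
  then have fin: "emeasure \<mu> (space \<mu>) \<noteq> \<infinity>" by simp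
  have "\<exists>F\<in>borel_measurable B. \<forall>N\<in>sets B. (\<integral>\<^sup>+b\<in>N. F b \<partial>B) = emeasure \<mu> (N \<times> {q<..})" for q :: real
  proof -
    have G[measurable]: "space B \<times> {q<..} \<in> sets \<mu>" by simp
    let ?\<nu> = "distr (density \<mu> (indicator (space B \<times> {q<..}))) B fst"
    have em: "emeasure ?\<nu> N = emeasure \<mu> (N \<times> {q<..})" if N[measurable]: "N \<in> sets B" for N
    proof -
      have "emeasure ?\<nu> N = (\<integral>\<^sup>+e. indicator (space B \<times> {q<..}) e * indicator (fst -` N \<inter> space \<mu>) e \<partial>\<mu>)"
        by (subst emeasure_distr, simp, simp, subst emeasure_density[OF borel_measurable_indicator[OF G]])
           (auto intro!: measurable_sets[of fst \<mu> B] simp del: sets)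
      also have "\<dots> = (\<integral>\<^sup>+e. indicator (N \<times> {q<..}) e \<partial>\<mu>)"
        using sets.sets_into_space[OF N] by (intro nn_integral_cong) (auto simp: indicator_def sp)
      also have "\<dots> = emeasure \<mu> (N \<times> {q<..})" by (intro nn_integral_indicator) simp
      finally show ?thesis .
    qed
    have "absolutely_continuous B ?\<nu>"
      unfolding absolutely_continuous_def
    proof
      fix N assume N: "N \<in> null_sets B"
      then have [measurable]: "N \<in> sets B" by auto
      have "emeasure \<mu> (N \<times> {q<..}) \<le> emeasure \<mu> (N \<times> UNIV)" by (intro emeasure_mono) auto
      also have "\<dots> = 0" using N margN by auto
      finally have "emeasure ?\<nu> N = 0" by (simp add: em)
      then show "N \<in> null_sets ?\<nu>" by (auto simp: null_sets_def)
    qed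
    from B.Radon_Nikodym[OF this] obtain f where f[measurable]: "f \<in> borel_measurable B"
      and fd: "density B f = ?\<nu>" by auto
    have "(\<integral>\<^sup>+b\<in>N. f b \<partial>B) = emeasure \<mu> (N \<times> {q<..})" if "N \<in> sets B" for N
      using em[OF that] that by (simp add: fd[symmetric] emeasure_density)
    then show ?thesis using f by blast
  qed
  then obtain F0 where F0[measurable]: "\<And>q. F0 q \<in> borel_measurable B"
    and F0eq: "\<And>q N. N \<in> sets B \<Longrightarrow> (\<integral>\<^sup>+b\<in>N. F0 q b \<partial>B) = emeasure \<mu> (N \<times> {q<..})" by metis
  define F where "F q = F0 (of_rat q)" for q
  have [measurable]: "F q \<in> borel_measurable B" for q by (simp add: F_def)
  have AE_le: "AE b in B. f b \<le> g b"
    if [measurable]: "f \<in> borel_measurable B" "g \<in> borel_measurable B"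
      and int: "(\<integral>\<^sup>+b. g b \<partial>B) < \<infinity>"
      and le: "\<And>N. N \<in> sets B \<Longrightarrow> (\<integral>\<^sup>+b\<in>N. f b \<partial>B) \<le> (\<integral>\<^sup>+b\<in>N. g b \<partial>B)" for f g :: "'b \<Rightarrow> ennreal"
  proof -
    let ?N = "{b\<in>space B. g b < f b}"
    have N[measurable]: "?N \<in> sets B" by measurable
    have fin: "(\<integral>\<^sup>+b\<in>?N. g b \<partial>B) < \<infinity>"
      by (rule le_less_trans[OF nn_integral_mono int]) (auto simp: indicator_def)
    have "(\<integral>\<^sup>+b\<in>?N. f b \<partial>B) = (\<integral>\<^sup>+b\<in>?N. g b \<partial>B) + (\<integral>\<^sup>+b\<in>?N. f b - g b \<partial>B)"
      by (subst nn_integral_add[symmetric]) (auto intro!: nn_integral_cong simp: indicator_def add_diff_inverse_ennreal less_imp_le)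
    with le[OF N] fin have "(\<integral>\<^sup>+b\<in>?N. f b - g b \<partial>B) = 0"
      by (metis (no_types, lifting) add.right_neutral ennreal_add_left_cancel_le infinity_ennreal_def le_zero_eq less_irrefl)
    then have "AE b in B. (f b - g b) * indicator ?N b = 0" by (subst (asm) nn_integral_0_iff_AE) auto
    then show ?thesis using AE_space
    proof eventually_elim
      case (elim b)
      show ?case
      proof (rule ccontr)
        assume "\<not> f b \<le> g b"
        then show False using elim
          by (auto simp: not_le dest: ennreal_minus_eq_0 leD)
      qed
    qed
  qed
  have F0_mono: "AE b in B. F0 q' b \<le> F0 q b" if "q \<le> q'" for q q'
  proof (rule AE_le)
    have "(\<integral>\<^sup>+b. F0 q b \<partial>B) = (\<integral>\<^sup>+b\<in>space B. F0 q b \<partial>B)"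
      by (intro nn_integral_cong) auto
    also have "\<dots> \<le> emeasure \<mu> (space \<mu>)"
      unfolding F0eq[OF sets.top] by (intro emeasure_mono) (auto simp: sp)
    finally show "(\<integral>\<^sup>+b. F0 q b \<partial>B) < \<infinity>" using fin by (auto simp: less_top[symmetric] top_unique)
    fix N assume "N \<in> sets B"
    then show "(\<integral>\<^sup>+b\<in>N. F0 q' b \<partial>B) \<le> (\<integral>\<^sup>+b\<in>N. F0 q b \<partial>B)"
      using that by (simp add: F0eq) (intro emeasure_mono, auto)
  qed auto
  have F0_le1: "AE b in B. F0 q b \<le> 1" for q
  proof (rule AE_le)
    fix N assume N: "N \<in> sets B"
    have "emeasure \<mu> (N \<times> {q<..}) \<le> emeasure \<mu> (N \<times> UNIV)"
      using N by (intro emeasure_mono) auto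
    then show "(\<integral>\<^sup>+b\<in>N. F0 q b \<partial>B) \<le> (\<integral>\<^sup>+b\<in>N. 1 \<partial>B)"
      using N by (simp add: F0eq margN)
  qed (auto simp: B.emeasure_finite less_top[symmetric])
  define R where "R x = {q::rat. x < of_rat q \<and> of_rat q < (1::real)}" for x :: real
  \<comment> \<open>Monotonicity of \<open>F q\<close> in \<open>q\<close> and the bound \<open>1\<close> hold almost everywhere for each pair of rationals;
    \<open>G\<close> has both properties everywhere.\<close>
  define G where "G q b = min 1 (SUP q'\<in>{q'::rat. q \<le> q'}. F q' b)" for q :: rat and b
  have [measurable]: "G q \<in> borel_measurable B" for q
    unfolding G_def by measurable
  have G_anti: "q \<le> q' \<Longrightarrow> G q' b \<le> G q b" for q q' b
    unfolding G_def by (intro min.mono order_refl SUP_subset_mono) auto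
  have G_le1: "G q b \<le> 1" for q b by (simp add: G_def)
  have "AE b in B. G q b = F q b" for q
  proof -
    have "AE b in B. \<forall>q'\<in>{q'. q \<le> q'}. F q' b \<le> F q b"
      unfolding F_def by (intro AE_ball_countable') (auto intro!: F0_mono simp: of_rat_less_eq)
    then show ?thesis using F0_le1[of "of_rat q"]
    proof eventually_elim
      case (elim b)
      have "(SUP q'\<in>{q'::rat. q \<le> q'}. F q' b) = F q b"
        using elim by (intro antisym SUP_least SUP_upper) auto
      then show ?case using elim by (simp add: G_def F_def min_def)
    qed
  qed
  then have Geq: "(\<integral>\<^sup>+b\<in>N. G q b \<partial>B) = emeasure \<mu> (N \<times> {of_rat q<..})" if "N \<in> sets B" for q N
  proof -
    have "(\<integral>\<^sup>+b\<in>N. G q b \<partial>B) = (\<integral>\<^sup>+b\<in>N. F q b \<partial>B)"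
      by (rule nn_integral_cong_AE) (use \<open>AE b in B. G q b = F q b\<close> in \<open>auto elim!: eventually_mono\<close>)
    then show ?thesis using F0eq[OF that] by (simp add: F_def)
  qed
  define X where "X e = Sup (insert (0::real) {of_rat q | q::rat. 0 \<le> q \<and> q < 1 \<and> ennreal (snd e) < G q (fst e)})"
    for e :: "'b \<times> real"
  have X_gt: "x < X e \<longleftrightarrow> x < 0 \<or> (\<exists>q\<in>R x. 0 \<le> q \<and> ennreal (snd e) < G q (fst e))" for x e
  proof -
    have "bdd_above (insert 0 {of_rat q | q::rat. 0 \<le> q \<and> q < 1 \<and> ennreal (snd e) < G q (fst e)} :: real set)"
      by (rule bdd_aboveI[of _ 1]) (auto simp: of_rat_le_1_iff)
    then have "x < X e \<longleftrightarrow> (\<exists>y\<in>insert 0 {of_rat q | q::rat. 0 \<le> q \<and> q < 1 \<and> ennreal (snd e) < G q (fst e)}. x < y)"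
      unfolding X_def by (intro less_cSup_iff) auto
    then show ?thesis
      by (auto simp: R_def max_def of_rat_less_1_iff split: if_splits)
  qed
  have X_gt0: "x < X e \<longleftrightarrow> (\<exists>q\<in>R x. ennreal (snd e) < G q (fst e))" if "0 \<le> x" for x e
  proof -
    have "0 \<le> q" if "q \<in> R x" for q
    proof -
      have "(0::real) < of_rat q"
        by (rule le_less_trans[OF \<open>0 \<le> x\<close>]) (use that in \<open>simp add: R_def\<close>)
      then show ?thesis by simp
    qed
    then show ?thesis using that unfolding X_gt by (auto simp: max_def)
  qed
  have X_neg: "x < X e" if "x < 0" for x e using that unfolding X_gt by simp
  have X[measurable]: "X \<in> borel_measurable (B \<Otimes>\<^sub>M borel)"
    unfolding borel_measurable_iff_greater
  proof
    fix x
    show "{e \<in> space (B \<Otimes>\<^sub>M borel). x < X e} \<in> sets (B \<Otimes>\<^sub>M borel)"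
      by (cases "x < 0") (simp_all add: X_neg X_gt0)
  qed
  let ?\<nu> = "distr (B \<Otimes>\<^sub>M unif) (B \<Otimes>\<^sub>M borel) (\<lambda>(b, u). (b, X (b, u)))"
  have em: "emeasure ?\<nu> (N \<times> {x<..}) = (\<integral>\<^sup>+b\<in>N. emeasure unif {u. x < X (b, u)} \<partial>B)"
    if N[measurable]: "N \<in> sets B" for N x
  proof -
    have "emeasure ?\<nu> (N \<times> {x<..}) = (\<integral>\<^sup>+e. indicator (N \<times> {x<..}) (fst e, X e) \<partial>(B \<Otimes>\<^sub>M unif))"
      by (subst emeasure_distr_eq_nn_integral) (auto simp: case_prod_unfold)
    also have "\<dots> = (\<integral>\<^sup>+b. \<integral>\<^sup>+u. indicator (N \<times> {x<..}) (b, X (b, u)) \<partial>unif \<partial>B)"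
      by (subst unif.nn_integral_fst[symmetric]) auto
    also have "\<dots> = (\<integral>\<^sup>+b\<in>N. emeasure unif {u. x < X (b, u)} \<partial>B)"
    proof (intro nn_integral_cong)
      fix b assume b: "b \<in> space B"
      have "(\<integral>\<^sup>+u. indicator (N \<times> {x<..}) (b, X (b, u)) \<partial>unif) = (\<integral>\<^sup>+u. indicator N b * indicator {u. x < X (b, u)} u \<partial>unif)"
        by (intro nn_integral_cong) (auto simp: indicator_def)
      also have "\<dots> = emeasure unif {u. x < X (b, u)} * indicator N b"
        using b by (subst nn_integral_cmult_indicator) (auto simp: mult.commute)
      finally show "(\<integral>\<^sup>+u. indicator (N \<times> {x<..}) (b, X (b, u)) \<partial>unif) = emeasure unif {u. x < X (b, u)} * indicator N b" .
    qed
    finally show ?thesis .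
  qed
  have "\<mu> = ?\<nu>"
  proof (rule measure_eqI_Times_greaterThan)
    fix N and x :: real assume N[measurable]: "N \<in> sets B"
    consider "x < 0" | "1 \<le> x" | "0 \<le> x" "x < 1" by linarith
    then show "emeasure \<mu> (N \<times> {x<..}) = emeasure ?\<nu> (N \<times> {x<..})"
    proof cases
      case 1
      have "emeasure \<mu> (N \<times> {x<..}) = emeasure \<mu> (N \<times> UNIV)"
        by (intro emeasure_eq_AE) (use unit 1 in \<open>auto elim!: eventually_mono\<close>)
      also have "\<dots> = emeasure ?\<nu> (N \<times> {x<..})"
        unfolding em[OF N] using 1 unif.emeasure_space_1 by (simp add: X_neg margN)
      finally show ?thesis .
    next
      case 2
      have "emeasure \<mu> (N \<times> {x<..}) = emeasure \<mu> {}"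
      proof (rule emeasure_eq_AE)
        show "AE e in \<mu>. e \<in> N \<times> {x<..} \<longleftrightarrow> e \<in> {}"
          using unit by eventually_elim (use 2 in auto)
      qed auto
      moreover have "R x = {}" using 2 unfolding R_def by (auto simp del: of_rat_less_1_iff)
      ultimately show ?thesis
        unfolding em[OF N] using 2 by (simp add: X_gt0)
    next
      case 3
      \<comment> \<open>Monotone convergence needs a sequence: the \<open>r n\<close> decrease and are cofinal in \<open>R x\<close>.\<close>
      have Rne: "R x \<noteq> {}" using of_rat_dense[OF 3(2)] by (auto simp: R_def)
      define r where "r n = Min (from_nat_into (R x) ` {..n})" for n
      have rR: "r n \<in> R x" for n
      proof -
        have "r n \<in> from_nat_into (R x) ` {..n}" unfolding r_def by (intro Min_in) auto
        then show ?thesis using from_nat_into[OF Rne] by auto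
      qed
      have r_dec: "r (Suc n) \<le> r n" for n
        unfolding r_def by (intro Min_antimono) auto
      have r_cof: "\<exists>n. r n \<le> q" if "q \<in> R x" for q
      proof -
        have "r (to_nat_on (R x) q) \<le> q"
          unfolding r_def using that by (intro Min_le) (auto intro!: image_eqI[of _ _ "to_nat_on (R x) q"])
        then show ?thesis by blast
      qed
      have sup: "(SUP q\<in>R x. G q b) = (SUP n. G (r n) b)" for b
      proof (rule antisym)
        show "(SUP q\<in>R x. G q b) \<le> (SUP n. G (r n) b)"
        proof (rule SUP_least)
          fix q assume "q \<in> R x"
          then obtain n where "r n \<le> q" using r_cof by blast
          then show "G q b \<le> (SUP n. G (r n) b)" by (intro SUP_upper2[of n] G_anti) auto
        qed
        show "(SUP n. G (r n) b) \<le> (SUP q\<in>R x. G q b)"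
          by (intro SUP_least SUP_upper rR)
      qed
      have "emeasure unif {u. x < X (b, u)} = (SUP n. G (r n) b)" for b
      proof -
        have "{u. x < X (b, u)} = {u. ennreal u < (SUP q\<in>R x. G q b)}"
          using 3 by (auto simp: X_gt0 less_SUP_iff)
        then show ?thesis
          using emeasure_unif_less[of "SUP q\<in>R x. G q b"] by (simp add: sup[symmetric] SUP_least G_le1)
      qed
      then have "emeasure ?\<nu> (N \<times> {x<..}) = (\<integral>\<^sup>+b. (SUP n. G (r n) b * indicator N b) \<partial>B)"
        unfolding em[OF N] by (simp add: SUP_mult_right_ennreal)
      also have "\<dots> = (SUP n. \<integral>\<^sup>+b\<in>N. G (r n) b \<partial>B)"
        by (intro nn_integral_monotone_convergence_SUP)
           (auto intro!: incseq_SucI le_funI mult_right_mono G_anti r_dec)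
      also have "\<dots> = (SUP n. emeasure \<mu> (N \<times> {of_rat (r n)<..}))"
        using Geq[OF N] by simp
      also have "\<dots> = emeasure \<mu> (\<Union>n. N \<times> {of_rat (r n)<..})"
      proof (intro SUP_emeasure_incseq)
        show "incseq (\<lambda>n. N \<times> {real_of_rat (r n)<..})"
          using r_dec by (intro incseq_SucI Sigma_mono) (auto intro: order_le_less_trans simp: of_rat_less_eq[symmetric, where 'a=real])
      qed auto
      also have "\<dots> = emeasure \<mu> (N \<times> {x<..})"
      proof -
        have "\<exists>n. of_rat (r n) < y" if "x < y" for y :: real
        proof -
          obtain q where "x < of_rat q" "of_rat q < min y 1" using of_rat_dense[of x "min y 1"] 3 \<open>x < y\<close> by auto
          then have "q \<in> R x" "of_rat q < y" by (auto simp: R_def)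
          then obtain n where "r n \<le> q" using r_cof by blast
          then show ?thesis using \<open>of_rat q < y\<close>
            by (metis of_rat_less_eq order_le_less_trans)
        qed
        moreover have "x < y" if "of_rat (r n) < y" for n y
          using rR[of n] that by (auto simp: R_def simp del: of_rat_less_1_iff)
        ultimately have "(\<Union>n. N \<times> {of_rat (r n)<..}) = N \<times> {x<..}"
          by fastforce
        then show ?thesis by simp
      qed
      finally show ?thesis by simp
    qed
  qed (use fin in auto)
  then show ?thesis using X by blast
qed

lemma randomization:
  fixes \<mu> :: "('b \<times> real) measure"
  assumes B: "finite_measure B" and sets[simp, measurable_cong]: "sets \<mu> = sets (B \<Otimes>\<^sub>M borel)"
    and marg: "distr \<mu> B fst = B"
  shows "\<exists>X\<in>borel_measurable (B \<Otimes>\<^sub>M borel). \<mu> = distr (B \<Otimes>\<^sub>M unif) (B \<Otimes>\<^sub>M borel) (\<lambda>(b, u). (b, X (b, u)))"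
proof -
  let ?\<mu> = "distr \<mu> (B \<Otimes>\<^sub>M borel) (\<lambda>(b, x). (b, to_unit x))"
  have "distr ?\<mu> B fst = distr \<mu> B fst"
    by (subst distr_distr) (auto simp: comp_def case_prod_unfold)
  then have "\<exists>X\<in>borel_measurable (B \<Otimes>\<^sub>M borel). ?\<mu> = distr (B \<Otimes>\<^sub>M unif) (B \<Otimes>\<^sub>M borel) (\<lambda>(b, u). (b, X (b, u)))"
    using B marg by (intro unit_randomization) (auto simp: AE_distr_iff to_unit case_prod_beta)
  then obtain X where [measurable]: "X \<in> borel_measurable (B \<Otimes>\<^sub>M borel)"
    and X: "?\<mu> = distr (B \<Otimes>\<^sub>M unif) (B \<Otimes>\<^sub>M borel) (\<lambda>(b, u). (b, X (b, u)))" by blast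
  have "\<mu> = distr \<mu> (B \<Otimes>\<^sub>M borel) (\<lambda>x. x)"
    by (rule distr_id2[symmetric]) simp
  also have "\<dots> = distr ?\<mu> (B \<Otimes>\<^sub>M borel) (\<lambda>(b, y). (b, from_unit y))"
    by (subst distr_distr) (auto simp: comp_def case_prod_beta from_to_unit)
  also have "\<dots> = distr (B \<Otimes>\<^sub>M unif) (B \<Otimes>\<^sub>M borel) (\<lambda>(b, u). (b, from_unit (X (b, u))))"
    unfolding X by (subst distr_distr) (auto simp: comp_def case_prod_unfold)
  finally show ?thesis
    by (intro bexI[of _ "\<lambda>e. from_unit (X e)"]) auto
qed

text \<open>Randomize \<open>d\<close> given \<open>\<beta>\<close>, and then \<open>s\<close> given the pair of \<open>\<beta>\<close> and \<open>d\<close>, with independent random numbers.\<close>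

lemma randomization_pair:
  fixes \<beta> :: "'e \<Rightarrow> 'b" and d s :: "'e \<Rightarrow> real"
  assumes B: "finite_measure B" and [measurable]: "\<beta> \<in> E \<rightarrow>\<^sub>M B" "d \<in> borel_measurable E" "s \<in> borel_measurable E"
    and marg: "distr E B \<beta> = B"
  obtains X T where "X \<in> borel_measurable (B \<Otimes>\<^sub>M (unif \<Otimes>\<^sub>M unif))" "T \<in> borel_measurable (B \<Otimes>\<^sub>M (unif \<Otimes>\<^sub>M unif))"
    "distr E (B \<Otimes>\<^sub>M borel \<Otimes>\<^sub>M borel) (\<lambda>e. (\<beta> e, d e, s e))
      = distr (B \<Otimes>\<^sub>M (unif \<Otimes>\<^sub>M unif)) (B \<Otimes>\<^sub>M borel \<Otimes>\<^sub>M borel) (\<lambda>(b, w). (b, X (b, w), T (b, w)))"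
proof -
  interpret B: finite_measure B by fact
  interpret unif: prob_space unif by (rule prob_space_unif)
  interpret noise2: pair_prob_space unif unif ..
  define D where "D = distr E (B \<Otimes>\<^sub>M borel) (\<lambda>e. (\<beta> e, d e))"
  have setsD[simp, measurable_cong]: "sets D = sets (B \<Otimes>\<^sub>M borel)" by (simp add: D_def)
  have "emeasure D (space D) = emeasure (distr E B \<beta>) (space B)"
    unfolding D_def by (subst (1 2) emeasure_distr) (auto intro!: arg_cong[where f = "emeasure E"] simp: measurable_space space_pair_measure)
  then have fin: "finite_measure D"
    unfolding marg by (intro finite_measureI) simp
  have "distr D B fst = B" unfolding D_def
    by (subst distr_distr) (auto simp: comp_def marg)
  from randomization[OF B setsD this] obtain X0
    where [measurable]: "X0 \<in> borel_measurable (B \<Otimes>\<^sub>M borel)"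
      and X0: "D = distr (B \<Otimes>\<^sub>M unif) (B \<Otimes>\<^sub>M borel) (\<lambda>(b, u). (b, X0 (b, u)))" by blast
  define D2 where "D2 = distr E (D \<Otimes>\<^sub>M borel) (\<lambda>e. ((\<beta> e, d e), s e))"
  have setsD2: "sets D2 = sets (D \<Otimes>\<^sub>M borel)" by (simp add: D2_def)
  have "distr D2 D fst = distr E D (\<lambda>e. (\<beta> e, d e))" unfolding D2_def
    by (subst distr_distr) (auto simp: comp_def)
  also have "\<dots> = D" unfolding D_def by (rule distr_cong) auto
  finally have "distr D2 D fst = D" .
  from randomization[OF fin setsD2 this] obtain T0
    where [measurable]: "T0 \<in> borel_measurable (D \<Otimes>\<^sub>M borel)"
      and T0: "D2 = distr (D \<Otimes>\<^sub>M unif) (D \<Otimes>\<^sub>M borel) (\<lambda>(b, u). (b, T0 (b, u)))" by blast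
  interpret D: finite_measure D by fact
  define X where "X = (\<lambda>(b, u, v::real). X0 (b, u))"
  define T where "T = (\<lambda>(b, u, v::real). T0 ((b, X0 (b, u)), v))"
  have [measurable]: "X \<in> borel_measurable (B \<Otimes>\<^sub>M (unif \<Otimes>\<^sub>M unif))" "T \<in> borel_measurable (B \<Otimes>\<^sub>M (unif \<Otimes>\<^sub>M unif))"
    unfolding X_def T_def by measurable
  have nnE: "(\<integral>\<^sup>+e. f ((\<beta> e, d e), s e) \<partial>E) = (\<integral>\<^sup>+b. \<integral>\<^sup>+u. \<integral>\<^sup>+v. f ((b, X0 (b, u)), T0 ((b, X0 (b, u)), v)) \<partial>unif \<partial>unif \<partial>B)"
    if [measurable]: "f \<in> borel_measurable ((B \<Otimes>\<^sub>M borel) \<Otimes>\<^sub>M borel)" for f :: "('b \<times> real) \<times> real \<Rightarrow> ennreal"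
  proof -
    have "(\<integral>\<^sup>+e. f ((\<beta> e, d e), s e) \<partial>E) = (\<integral>\<^sup>+y. f y \<partial>D2)"
      unfolding D2_def by (simp add: nn_integral_distr)
    also have "\<dots> = (\<integral>\<^sup>+x. f (fst x, T0 x) \<partial>(D \<Otimes>\<^sub>M unif))"
      unfolding T0 by (simp add: nn_integral_distr case_prod_beta)
    also have "\<dots> = (\<integral>\<^sup>+x. \<integral>\<^sup>+v. f (x, T0 (x, v)) \<partial>unif \<partial>D)"
      by (subst unif.nn_integral_fst[symmetric]) auto
    also have "\<dots> = (\<integral>\<^sup>+y. \<integral>\<^sup>+v. f ((fst y, X0 y), T0 ((fst y, X0 y), v)) \<partial>unif \<partial>(B \<Otimes>\<^sub>M unif))"
      by (subst X0, subst nn_integral_distr) (auto simp: case_prod_beta)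
    also have "\<dots> = (\<integral>\<^sup>+b. \<integral>\<^sup>+u. \<integral>\<^sup>+v. f ((b, X0 (b, u)), T0 ((b, X0 (b, u)), v)) \<partial>unif \<partial>unif \<partial>B)"
      by (subst unif.nn_integral_fst[symmetric]) auto
    finally show ?thesis .
  qed
  have "distr E (B \<Otimes>\<^sub>M borel \<Otimes>\<^sub>M borel) (\<lambda>e. (\<beta> e, d e, s e))
      = distr (B \<Otimes>\<^sub>M (unif \<Otimes>\<^sub>M unif)) (B \<Otimes>\<^sub>M borel \<Otimes>\<^sub>M borel) (\<lambda>(b, w). (b, X (b, w), T (b, w)))" (is "?l = ?r")
  proof (rule measure_eqI)
    fix S assume "S \<in> sets ?l"
    then have [measurable]: "S \<in> sets (B \<Otimes>\<^sub>M borel \<Otimes>\<^sub>M borel)" by simp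
    have "emeasure ?l S = (\<integral>\<^sup>+e. indicator S (\<beta> e, d e, s e) \<partial>E)"
      by (subst emeasure_distr_eq_nn_integral) auto
    also have "\<dots> = (\<integral>\<^sup>+b. \<integral>\<^sup>+u. \<integral>\<^sup>+v. indicator S (b, X (b, u, v), T (b, u, v)) \<partial>unif \<partial>unif \<partial>B)"
      using nnE[of "\<lambda>e. indicator S (fst (fst e), snd (fst e), snd e)"] by (simp add: X_def T_def)
    also have "\<dots> = (\<integral>\<^sup>+b. \<integral>\<^sup>+w. indicator S (b, X (b, w), T (b, w)) \<partial>(unif \<Otimes>\<^sub>M unif) \<partial>B)"
      by (intro nn_integral_cong, subst unif.nn_integral_fst[symmetric]) auto
    also have "\<dots> = (\<integral>\<^sup>+e. indicator S (fst e, X e, T e) \<partial>(B \<Otimes>\<^sub>M (unif \<Otimes>\<^sub>M unif)))"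
      by (subst noise2.nn_integral_fst[symmetric]) auto
    also have "\<dots> = emeasure ?r S"
      by (subst emeasure_distr_eq_nn_integral) (auto simp: case_prod_unfold)
    finally show "emeasure ?l S = emeasure ?r S" .
  qed simp
  then show ?thesis by (intro that) auto
qed

section \<open>Polymorphisms and their blocks\<close>

lemma space_Rpos[simp]: "space Rpos = {0<..}"
  by (simp add: Rpos_def space_restrict_space)

lemma measurable_to_Rpos: "f \<in> M \<rightarrow>\<^sub>M Rpos \<longleftrightarrow> f \<in> borel_measurable M \<and> (\<forall>x\<in>space M. 0 < f x)"
  by (auto simp: Rpos_def measurable_restrict_space2_iff)

lemma measurable_from_Rpos[measurable (raw)]: "f \<in> M \<rightarrow>\<^sub>M Rpos \<Longrightarrow> f \<in> borel_measurable M"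
  by (simp add: measurable_to_Rpos)

lemma measurable_Rpos_mult[measurable (raw)]:
  "f \<in> M \<rightarrow>\<^sub>M Rpos \<Longrightarrow> g \<in> M \<rightarrow>\<^sub>M Rpos \<Longrightarrow> (\<lambda>x. f x * g x) \<in> M \<rightarrow>\<^sub>M Rpos"
  by (auto simp: measurable_to_Rpos)

lemma measurable_borel_Rpos:
  assumes "f \<in> borel_measurable borel" shows "f \<in> borel_measurable Rpos"
  using assms unfolding Rpos_def by (rule measurable_restrict_space1)

text \<open>Makes a real function take values in the space \<open>Rpos\<close>; the default \<open>1\<close> is used only on null sets.\<close>

definition clip_pos :: "real \<Rightarrow> real" where
  "clip_pos x = (if 0 < x then x else 1)"

lemma clip_pos_measurable[measurable]: "clip_pos \<in> borel \<rightarrow>\<^sub>M Rpos"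
  unfolding measurable_to_Rpos clip_pos_def by auto

abbreviation (input) tgt :: "'a \<times> 'b \<times> real \<Rightarrow> 'b" where "tgt e \<equiv> fst (snd e)"
abbreviation (input) ratio :: "'a \<times> 'b \<times> real \<Rightarrow> real" where "ratio e \<equiv> snd (snd e)"

locale polymorphism =
  fixes A :: "'a measure" and B :: "'b measure" and P :: "('a \<times> 'b \<times> real) measure"
  assumes Pol: "P \<in> Pol A B"
begin

lemma sets_P[simp, measurable_cong]: "sets P = sets (A \<Otimes>\<^sub>M B \<Otimes>\<^sub>M Rpos)"
  using Pol by (simp add: Pol_def)

lemma space_P: "space P = space A \<times> space B \<times> {0<..}"
  using sets_eq_imp_space_eq[OF sets_P] by (simp add: space_pair_measure)

lemma measurable_source[measurable]: "fst \<in> P \<rightarrow>\<^sub>M A" by measurable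
lemma measurable_target[measurable]: "(\<lambda>e. tgt e) \<in> P \<rightarrow>\<^sub>M B" by measurable
lemma measurable_ratio[measurable]: "(\<lambda>e. ratio e) \<in> P \<rightarrow>\<^sub>M Rpos" by measurable

lemma nn_integral_source:
  assumes [measurable]: "\<phi> \<in> borel_measurable A"
  shows "(\<integral>\<^sup>+e. \<phi> (fst e) \<partial>P) = (\<integral>\<^sup>+a. \<phi> a \<partial>A)"
proof -
  have "A = distr P A fst"
    using Pol by (simp add: Pol_def case_prod_unfold)
  then have "(\<integral>\<^sup>+a. \<phi> a \<partial>A) = (\<integral>\<^sup>+a. \<phi> a \<partial>distr P A fst)" by simp
  also have "\<dots> = (\<integral>\<^sup>+e. \<phi> (fst e) \<partial>P)"
    by (rule nn_integral_distr) measurable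
  finally show ?thesis by simp
qed

lemma nn_integral_target:
  assumes [measurable]: "\<phi> \<in> borel_measurable B"
  shows "(\<integral>\<^sup>+e. \<phi> (tgt e) * ennreal (ratio e) \<partial>P) = (\<integral>\<^sup>+b. \<phi> b \<partial>B)"
proof -
  have "B = distr (density P (\<lambda>e. ennreal (ratio e))) B (\<lambda>e. tgt e)"
    using Pol by (simp add: Pol_def case_prod_unfold)
  then have "(\<integral>\<^sup>+b. \<phi> b \<partial>B) = (\<integral>\<^sup>+b. \<phi> b \<partial>distr (density P (\<lambda>e. ennreal (ratio e))) B (\<lambda>e. tgt e))" by simp
  also have "\<dots> = (\<integral>\<^sup>+e. \<phi> (tgt e) \<partial>density P (\<lambda>e. ennreal (ratio e)))"
    by (rule nn_integral_distr) measurable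
  also have "\<dots> = (\<integral>\<^sup>+e. \<phi> (tgt e) * ennreal (ratio e) \<partial>P)"
    by (subst nn_integral_density) (auto simp: mult.commute)
  finally show ?thesis by simp
qed

lemma null_source: "N \<in> null_sets A \<Longrightarrow> AE e in P. fst e \<notin> N"
proof -
  assume N: "N \<in> null_sets A"
  then have [measurable]: "N \<in> sets A" by auto
  have "(\<integral>\<^sup>+e. indicator N (fst e) \<partial>P) = 0"
    using N by (subst nn_integral_source) auto
  then show ?thesis by (subst (asm) nn_integral_0_iff_AE) (auto simp: indicator_def split: if_splits)
qed

text \<open>The condition on the image in \<open>B\<close> concerns \<open>t P\<close>, but \<open>t\<close> is positive, so \<open>P\<close> and \<open>t P\<close> have the same
null sets.\<close>

lemma null_target: "N \<in> null_sets B \<Longrightarrow> AE e in P. tgt e \<notin> N"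
proof -
  assume N: "N \<in> null_sets B"
  then have [measurable]: "N \<in> sets B" by auto
  have "(\<integral>\<^sup>+e. indicator N (tgt e) * ennreal (ratio e) \<partial>P) = 0"
    using N by (subst nn_integral_target) auto
  then have "AE e in P. indicator N (tgt e) * ennreal (ratio e) = 0"
    by (subst (asm) nn_integral_0_iff_AE) auto
  with AE_space show ?thesis
    by eventually_elim (auto simp: indicator_def space_P split: if_splits)
qed

lemma emeasure_space_P: "emeasure P (space P) = emeasure A (space A)"
  using nn_integral_source[of "\<lambda>_. 1"] by simp

lemma nn_integral_ratio: "(\<integral>\<^sup>+e. ennreal (ratio e) \<partial>P) = emeasure B (space B)"
  using nn_integral_target[of "\<lambda>_. 1"] by simp

lemma finite_P: "finite_measure A \<Longrightarrow> finite_measure P"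
  by (rule finite_measureI) (simp add: emeasure_space_P finite_measure.emeasure_finite)

lemma Times_in_sets[measurable]:
  "M \<in> sets A \<Longrightarrow> N \<in> sets B \<Longrightarrow> S \<in> sets Rpos \<Longrightarrow> M \<times> N \<times> S \<in> sets P"
  by simp

lemma sets_pol_block[simp, measurable_cong]: "sets (pol_block P M N) = sets Rpos"
  by (simp add: pol_block_def)

lemma nn_integral_block:
  assumes [measurable]: "M \<in> sets A" "N \<in> sets B" "\<phi> \<in> borel_measurable Rpos"
  shows "(\<integral>\<^sup>+t. \<phi> t \<partial>pol_block P M N) = (\<integral>\<^sup>+e. indicator M (fst e) * indicator N (tgt e) * \<phi> (ratio e) \<partial>P)"
proof -
  have sp: "M \<times> N \<times> {0<..} \<in> sets P"
    using assms sets.top[of Rpos] by (intro Times_in_sets) auto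
  have "(\<lambda>e. ratio e) \<in> restrict_space P (M \<times> N \<times> {0<..}) \<rightarrow>\<^sub>M Rpos"
    by (intro measurable_restrict_space1) measurable
  then have "(\<integral>\<^sup>+t. \<phi> t \<partial>pol_block P M N) = (\<integral>\<^sup>+e. \<phi> (ratio e) \<partial>restrict_space P (M \<times> N \<times> {0<..}))"
    unfolding pol_block_def case_prod_unfold by (rule nn_integral_distr) measurable
  also have "\<dots> = (\<integral>\<^sup>+e. \<phi> (ratio e) * indicator (M \<times> N \<times> {0<..}) e \<partial>P)"
    using sp sets.sets_into_space[OF sp] by (subst nn_integral_restrict_space) (auto simp: Int_absorb2)
  also have "\<dots> = (\<integral>\<^sup>+e. indicator M (fst e) * indicator N (tgt e) * \<phi> (ratio e) \<partial>P)"
    by (intro nn_integral_cong) (auto simp: space_P indicator_def)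
  finally show ?thesis .
qed

lemma emeasure_block:
  assumes "M \<in> sets A" "N \<in> sets B" "S \<in> sets Rpos"
  shows "emeasure (pol_block P M N) S = emeasure P (M \<times> N \<times> S)"
proof -
  have "emeasure (pol_block P M N) S = (\<integral>\<^sup>+e. indicator M (fst e) * indicator N (tgt e) * indicator S (ratio e) \<partial>P)"
    using assms nn_integral_block[of M N "indicator S"] by simp
  also have "\<dots> = (\<integral>\<^sup>+e. indicator (M \<times> N \<times> S) e \<partial>P)"
    by (intro nn_integral_cong) (auto simp: indicator_def)
  also have "\<dots> = emeasure P (M \<times> N \<times> S)" using assms by (intro nn_integral_indicator) simp
  finally show ?thesis .
qed

lemma block_in_Mtri:
  assumes "finite_measure A" "finite_measure B" and [measurable]: "M \<in> sets A" "N \<in> sets B"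
  shows "pol_block P M N \<in> Mtri"
proof -
  have sp: "space (pol_block P M N) = {0<..}"
    using sets_eq_imp_space_eq[OF sets_pol_block] by simp
  have "{0<..} \<in> sets Rpos" using sets.top[of Rpos] by simp
  then have "emeasure (pol_block P M N) (space (pol_block P M N)) = emeasure P (M \<times> N \<times> {0<..})"
    by (simp add: sp emeasure_block)
  also have "\<dots> \<le> emeasure P (space P)"
    by (rule emeasure_space)
  also have "\<dots> < \<infinity>" using assms(1) by (simp add: emeasure_space_P finite_measure.emeasure_finite less_top[symmetric])
  finally have 1: "emeasure (pol_block P M N) (space (pol_block P M N)) < \<infinity>" .
  have "(\<integral>\<^sup>+t. ennreal t \<partial>pol_block P M N) \<le> (\<integral>\<^sup>+e. ennreal (ratio e) \<partial>P)"
    by (subst nn_integral_block) (auto intro!: nn_integral_mono simp: indicator_def measurable_borel_Rpos)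
  also have "\<dots> < \<infinity>" using assms(2) by (simp add: nn_integral_ratio finite_measure.emeasure_finite less_top[symmetric])
  finally show ?thesis using 1 by (simp add: Mtri_def)
qed

end

text \<open>Products of three measurable sets generate the sigma-algebra and are closed under intersections.\<close>

lemma Pol_eqI:
  assumes A: "finite_measure A" and P: "P \<in> Pol A B" and R: "R \<in> Pol A B"
    and eq: "\<And>M N S. M \<in> sets A \<Longrightarrow> N \<in> sets B \<Longrightarrow> S \<in> sets Rpos \<Longrightarrow>
      emeasure P (M \<times> N \<times> S) = emeasure R (M \<times> N \<times> S)"
  shows "P = R"
proof -
  interpret P: polymorphism A B P by unfold_locales fact
  interpret R: polymorphism A B R by unfold_locales fact
  let ?G = "{M \<times> N \<times> S | M N S. M \<in> sets A \<and> N \<in> sets B \<and> S \<in> sets Rpos}"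
  let ?G' = "{N \<times> S | N S. N \<in> sets B \<and> S \<in> sets Rpos}"
  have eq2: "emeasure P (M \<times> E) = emeasure R (M \<times> E)" if M: "M \<in> sets A" and E: "E \<in> sets (B \<Otimes>\<^sub>M Rpos)" for M E
  proof -
    let ?d = "\<lambda>P. distr (density P (indicator (M \<times> space B \<times> {0<..}))) (B \<Otimes>\<^sub>M Rpos) snd"
    have em: "emeasure (?d P) E = emeasure P (M \<times> E)" if "P \<in> Pol A B" and E[measurable]: "E \<in> sets (B \<Otimes>\<^sub>M Rpos)" for P E
    proof -
      interpret P: polymorphism A B P by unfold_locales fact
      have "M \<times> space B \<times> {0<..} \<in> sets P"
        using M sets.top[of Rpos] by (intro P.Times_in_sets) auto
      then have "emeasure (?d P) E = (\<integral>\<^sup>+e. indicator (M \<times> space B \<times> {0<..}) e * indicator E (snd e) \<partial>P)"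
        by (subst emeasure_distr_eq_nn_integral) (auto simp: nn_integral_density)
      also have "\<dots> = (\<integral>\<^sup>+e. indicator (M \<times> E) e \<partial>P)"
        by (intro nn_integral_cong) (auto simp: indicator_def P.space_P)
      also have "\<dots> = emeasure P (M \<times> E)" using M by (intro nn_integral_indicator) simp
      finally show ?thesis .
    qed
    have "?d P = ?d R"
    proof (rule measure_eqI_Times)
      have "emeasure (?d P) (space B \<times> space Rpos) = emeasure P (M \<times> space B \<times> {0<..})"
        using sets.top[of "B \<Otimes>\<^sub>M Rpos"] by (subst em[OF P]) (auto simp: space_pair_measure)
      also have "\<dots> \<le> emeasure P (space P)"
        by (rule emeasure_space)
      finally show "emeasure (?d P) (space B \<times> space Rpos) \<noteq> \<infinity>"
        using finite_measure.emeasure_finite[OF P.finite_P[OF A], of "space P"] by (auto simp: top_unique)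
      show "emeasure (?d P) (N \<times> S) = emeasure (?d R) (N \<times> S)" if "N \<in> sets B" "S \<in> sets Rpos" for N S
        using that by (subst (1 2) em) (auto intro: P R eq M)
    qed auto
    then show ?thesis using em[OF P E] em[OF R E] by simp
  qed
  show ?thesis
  proof (rule measure_eqI_Times[OF P.sets_P R.sets_P _ eq2])
    show "emeasure P (space A \<times> space (B \<Otimes>\<^sub>M Rpos)) \<noteq> \<infinity>"
      using finite_measure.emeasure_finite[OF P.finite_P[OF A], of "space P"]
      by (simp add: P.space_P space_pair_measure)
  qed auto
qed

section \<open>Kernels and disintegrations\<close>

definition kernel :: "'b measure \<Rightarrow> ('b \<Rightarrow> real measure) \<Rightarrow> bool" where
  "kernel B p \<longleftrightarrow> (\<forall>b\<in>space B. p b \<in> Mtri) \<and> (\<forall>S\<in>sets Rpos. (\<lambda>b. emeasure (p b) S) \<in> borel_measurable B)"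

text \<open>The masses \<open>p b\<close> of a kernel are finite but need not be bounded. Division by one plus the mass turns
it into a kernel of subprobabilities, to which the Giry monad applies.\<close>

lemma kernel_normalized:
  assumes "kernel B p"
  obtains w \<kappa> where "w \<in> borel_measurable B" "\<kappa> \<in> B \<rightarrow>\<^sub>M subprob_algebra Rpos"
    "\<And>b \<phi>. b \<in> space B \<Longrightarrow> \<phi> \<in> borel_measurable Rpos \<Longrightarrow> (\<integral>\<^sup>+t. \<phi> t \<partial>p b) = w b * (\<integral>\<^sup>+t. \<phi> t \<partial>\<kappa> b)"
proof -
  have sp: "b \<in> space B \<Longrightarrow> sets (p b) = sets Rpos" for b
    using assms by (auto simp: kernel_def Mtri_def)
  have spc: "b \<in> space B \<Longrightarrow> space (p b) = {0<..}" for b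
    using sets_eq_imp_space_eq[OF sp] by simp
  have meas: "S \<in> sets Rpos \<Longrightarrow> (\<lambda>b. emeasure (p b) S) \<in> borel_measurable B" for S
    using assms by (auto simp: kernel_def)
  have fin: "b \<in> space B \<Longrightarrow> emeasure (p b) {0<..} < \<infinity>" for b
    using assms spc[of b] by (auto simp: kernel_def Mtri_def)
  define w where "w b = 1 + emeasure (p b) {0<..}" for b
  define \<kappa> where "\<kappa> b = scale_measure (inverse (w b)) (p b)" for b
  have top: "{0<..} \<in> sets Rpos" using sets.top[of Rpos] by simp
  have w[measurable]: "w \<in> borel_measurable B" unfolding w_def using meas[OF top] by simp
  have w0: "w b \<noteq> 0" for b by (simp add: w_def)
  have winf: "b \<in> space B \<Longrightarrow> w b \<noteq> \<infinity>" for b using fin[of b] by (simp add: w_def)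
  have \<kappa>: "\<kappa> \<in> B \<rightarrow>\<^sub>M subprob_algebra Rpos"
  proof (rule measurable_subprob_algebra)
    fix b assume b: "b \<in> space B"
    show "sets (\<kappa> b) = sets Rpos" using sp[OF b] by (simp add: \<kappa>_def)
    show "subprob_space (\<kappa> b)"
    proof
      have "emeasure (\<kappa> b) (space (\<kappa> b)) = inverse (w b) * emeasure (p b) {0<..}"
        by (simp add: \<kappa>_def space_scale_measure spc[OF b])
      also have "\<dots> \<le> inverse (w b) * w b" by (intro mult_left_mono) (auto simp: w_def)
      also have "\<dots> = 1" using w0 winf[OF b] by (subst mult.commute) (simp add: ennreal_divide_self less_top[symmetric] flip: divide_ennreal_def)
      finally show "emeasure (\<kappa> b) (space (\<kappa> b)) \<le> 1" .
      show "space (\<kappa> b) \<noteq> {}" by (auto simp: \<kappa>_def space_scale_measure spc[OF b] intro: exI[of _ 1])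
    qed
  next
    fix S assume "S \<in> sets Rpos"
    from meas[OF this] show "(\<lambda>b. emeasure (\<kappa> b) S) \<in> borel_measurable B"
      by (simp add: \<kappa>_def)
  qed
  have "(\<integral>\<^sup>+t. \<phi> t \<partial>p b) = w b * (\<integral>\<^sup>+t. \<phi> t \<partial>\<kappa> b)"
    if b: "b \<in> space B" and \<phi>: "\<phi> \<in> borel_measurable Rpos" for b \<phi>
  proof -
    have "\<phi> \<in> borel_measurable (p b)" using \<phi> sp[OF b] by (simp cong: measurable_cong_sets)
    then have "w b * (\<integral>\<^sup>+t. \<phi> t \<partial>\<kappa> b) = (w b * inverse (w b)) * (\<integral>\<^sup>+t. \<phi> t \<partial>p b)"
      by (simp add: \<kappa>_def nn_integral_scale_measure mult.assoc)
    also have "w b * inverse (w b) = 1"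
      using w0 winf[OF b] by (simp add: ennreal_divide_self less_top[symmetric] flip: divide_ennreal_def)
    finally show ?thesis by simp
  qed
  then show ?thesis using that[OF w \<kappa>] by blast
qed

lemma kernel_nn_integral_measurable:
  assumes p: "kernel B p" and f[measurable]: "(\<lambda>(b, t). f b t) \<in> borel_measurable (B \<Otimes>\<^sub>M Rpos)"
  shows "(\<lambda>b. \<integral>\<^sup>+t. f b t \<partial>p b) \<in> borel_measurable B"
proof -
  obtain w \<kappa> where w[measurable]: "w \<in> borel_measurable B" and \<kappa>: "\<kappa> \<in> B \<rightarrow>\<^sub>M subprob_algebra Rpos"
    and eq: "\<And>b \<phi>. b \<in> space B \<Longrightarrow> \<phi> \<in> borel_measurable Rpos \<Longrightarrow> (\<integral>\<^sup>+t. \<phi> t \<partial>p b) = w b * (\<integral>\<^sup>+t. \<phi> t \<partial>\<kappa> b)"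
    using kernel_normalized[OF p] by blast
  note [measurable] = nn_integral_measurable_subprob_algebra2[OF f \<kappa>]
  have "(\<lambda>b. w b * (\<integral>\<^sup>+t. f b t \<partial>\<kappa> b)) \<in> borel_measurable B" by measurable
  then show ?thesis
    by (rule measurable_cong[THEN iffD2, rotated]) (auto intro!: eq)
qed

text \<open>Integrating the normalized kernel against \<open>B\<close> gives a measure that agrees with \<open>\<mu>\<close> on products of sets,
hence everywhere.\<close>

lemma kernel_disintegrates_nn_integral:
  assumes p: "kernel B p" and B: "finite_measure B" "space B \<noteq> {}"
    and sets: "sets \<mu> = sets (B \<Otimes>\<^sub>M Rpos)" and fin: "finite_measure \<mu>"
    and eq: "\<And>N S. N \<in> sets B \<Longrightarrow> S \<in> sets Rpos \<Longrightarrow> emeasure \<mu> (N \<times> S) = (\<integral>\<^sup>+b\<in>N. emeasure (p b) S \<partial>B)"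
    and f[measurable]: "f \<in> borel_measurable (B \<Otimes>\<^sub>M Rpos)"
  shows "(\<integral>\<^sup>+e. f e \<partial>\<mu>) = (\<integral>\<^sup>+b. \<integral>\<^sup>+t. f (b, t) \<partial>p b \<partial>B)"
proof -
  obtain w \<kappa> where w[measurable]: "w \<in> borel_measurable B" and \<kappa>[measurable]: "\<kappa> \<in> B \<rightarrow>\<^sub>M subprob_algebra Rpos"
    and w\<kappa>: "\<And>b \<phi>. b \<in> space B \<Longrightarrow> \<phi> \<in> borel_measurable Rpos \<Longrightarrow> (\<integral>\<^sup>+t. \<phi> t \<partial>p b) = w b * (\<integral>\<^sup>+t. \<phi> t \<partial>\<kappa> b)"
    using kernel_normalized[OF p] by blast
  define \<kappa>' where "\<kappa>' b = distr (\<kappa> b) (B \<Otimes>\<^sub>M Rpos) (Pair b)" for b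
  have "\<kappa>' \<in> B \<rightarrow>\<^sub>M subprob_algebra (B \<Otimes>\<^sub>M Rpos)"
    unfolding \<kappa>'_def by (rule measurable_distr2[OF _ \<kappa>]) simp
  then have \<kappa>': "\<kappa>' \<in> density B w \<rightarrow>\<^sub>M subprob_algebra (B \<Otimes>\<^sub>M Rpos)"
    by (simp cong: measurable_cong_sets)
  let ?\<nu> = "density B w \<bind> \<kappa>'"
  have nn: "(\<integral>\<^sup>+e. g e \<partial>?\<nu>) = (\<integral>\<^sup>+b. \<integral>\<^sup>+t. g (b, t) \<partial>p b \<partial>B)"
    if [measurable]: "g \<in> borel_measurable (B \<Otimes>\<^sub>M Rpos)" for g
  proof -
    have "(\<integral>\<^sup>+e. g e \<partial>?\<nu>) = (\<integral>\<^sup>+b. \<integral>\<^sup>+e. g e \<partial>\<kappa>' b \<partial>density B w)"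
      by (rule nn_integral_bind[OF that \<kappa>'])
    also have "\<dots> = (\<integral>\<^sup>+b. w b * (\<integral>\<^sup>+e. g e \<partial>\<kappa>' b) \<partial>B)"
      using nn_integral_measurable_subprob_algebra[of g "B \<Otimes>\<^sub>M Rpos"] \<kappa>'
      by (intro nn_integral_density w measurable_compose[OF _ nn_integral_measurable_subprob_algebra])
         (auto cong: measurable_cong_sets)
    also have "\<dots> = (\<integral>\<^sup>+b. \<integral>\<^sup>+t. g (b, t) \<partial>p b \<partial>B)"
    proof (intro nn_integral_cong)
      fix b assume b: "b \<in> space B"
      then have [measurable_cong]: "sets (\<kappa> b) = sets Rpos"
        using subprob_measurableD(2)[OF \<kappa>] by simp
      have "(\<integral>\<^sup>+e. g e \<partial>\<kappa>' b) = (\<integral>\<^sup>+t. g (b, t) \<partial>\<kappa> b)"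
        using b unfolding \<kappa>'_def by (intro nn_integral_distr) auto
      then show "w b * (\<integral>\<^sup>+e. g e \<partial>\<kappa>' b) = (\<integral>\<^sup>+t. g (b, t) \<partial>p b)"
        using b by (subst w\<kappa>) auto
    qed
    finally show ?thesis .
  qed
  have "\<mu> = ?\<nu>"
  proof (rule measure_eqI_Times[OF sets])
    show sets\<nu>: "sets ?\<nu> = sets (B \<Otimes>\<^sub>M Rpos)"
      using B by (intro sets_bind) (auto simp: \<kappa>'_def)
    have "space \<mu> = space B \<times> space Rpos"
      using sets_eq_imp_space_eq[OF sets] by (simp add: space_pair_measure)
    then show "emeasure \<mu> (space B \<times> space Rpos) \<noteq> \<infinity>"
      using finite_measure.emeasure_finite[OF fin, of "space \<mu>"] by simp
    fix N S assume [measurable]: "N \<in> sets B" "S \<in> sets Rpos"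
    have "emeasure ?\<nu> (N \<times> S) = (\<integral>\<^sup>+e. indicator (N \<times> S) e \<partial>?\<nu>)"
      by (subst nn_integral_indicator) (auto simp: sets\<nu>)
    also have "\<dots> = (\<integral>\<^sup>+b. \<integral>\<^sup>+t. indicator (N \<times> S) (b, t) \<partial>p b \<partial>B)" by (rule nn) simp
    also have "\<dots> = (\<integral>\<^sup>+b\<in>N. emeasure (p b) S \<partial>B)"
    proof (intro nn_integral_cong)
      fix b assume b: "b \<in> space B"
      then have sp: "sets (p b) = sets Rpos" using p by (auto simp: kernel_def Mtri_def)
      have "(\<integral>\<^sup>+t. indicator (N \<times> S) (b, t) \<partial>p b) = (\<integral>\<^sup>+t. indicator N b * indicator S t \<partial>p b)"
        by (intro nn_integral_cong) (auto simp: indicator_def)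
      then show "(\<integral>\<^sup>+t. indicator (N \<times> S) (b, t) \<partial>p b) = emeasure (p b) S * indicator N b"
        by (simp add: nn_integral_cmult_indicator sp mult.commute)
    qed
    finally show "emeasure \<mu> (N \<times> S) = emeasure ?\<nu> (N \<times> S)" by (simp add: eq)
  qed
  then show ?thesis using nn[OF f] by simp
qed

text \<open>Let \<open>\<nu> = h B\<close> be the image of \<open>\<mu>\<close> in \<open>B\<close>. Randomizing \<open>\<mu>\<close> over \<open>\<nu>\<close> by a function \<open>T (b, u)\<close>, the
conditional measure at \<open>b\<close> is \<open>h b\<close> times the law of \<open>T (b, u)\<close> in \<open>u\<close>. Its mass and its first moment are
finite for almost all \<open>b\<close>; at the remaining points it is replaced by zero, because membership in
\<open>Mtri\<close> is required everywhere.\<close>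

lemma disintegration_exists:
  fixes \<mu> :: "('b \<times> real) measure"
  assumes B: "finite_measure B" and sets[simp, measurable_cong]: "sets \<mu> = sets (B \<Otimes>\<^sub>M Rpos)"
    and fin: "finite_measure \<mu>"
    and ac: "\<And>N. N \<in> null_sets B \<Longrightarrow> AE e in \<mu>. fst e \<notin> N"
    and t: "(\<integral>\<^sup>+e. ennreal (snd e) \<partial>\<mu>) < \<infinity>"
  shows "\<exists>p. kernel B p \<and> (\<forall>N\<in>sets B. \<forall>S\<in>sets Rpos. emeasure \<mu> (N \<times> S) = (\<integral>\<^sup>+b\<in>N. emeasure (p b) S \<partial>B))"
proof -
  interpret B: finite_measure B by fact
  interpret \<mu>: finite_measure \<mu> by fact
  interpret unif: prob_space unif by (rule prob_space_unif)
  have sp: "space \<mu> = space B \<times> {0<..}"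
    using sets_eq_imp_space_eq[OF sets] by (simp add: space_pair_measure)
  define \<nu> where "\<nu> = distr \<mu> B fst"
  have s\<nu>[simp, measurable_cong]: "sets \<nu> = sets B" by (simp add: \<nu>_def)
  have finn: "finite_measure \<nu>" unfolding \<nu>_def by (rule \<mu>.finite_measure_distr) simp
  interpret \<nu>: finite_measure \<nu> by fact
  have "absolutely_continuous B \<nu>"
    unfolding absolutely_continuous_def
  proof
    fix N assume N: "N \<in> null_sets B"
    then have [measurable]: "N \<in> sets B" by auto
    have "emeasure \<nu> N = (\<integral>\<^sup>+e. 0 \<partial>\<mu>)"
      unfolding \<nu>_def by (subst emeasure_distr_eq_nn_integral, simp, simp, rule nn_integral_cong_AE)
        (use ac[OF N] in eventually_elim, auto)
    then show "N \<in> null_sets \<nu>" by (auto simp: null_sets_def)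
  qed
  from B.Radon_Nikodym[OF this] obtain h where h[measurable]: "h \<in> borel_measurable B"
    and hd: "density B h = \<nu>" by auto
  have "(\<lambda>e. (fst e, snd e)) \<in> \<mu> \<rightarrow>\<^sub>M \<nu> \<Otimes>\<^sub>M borel" by measurable
  then have [measurable]: "(\<lambda>e. e) \<in> \<mu> \<rightarrow>\<^sub>M \<nu> \<Otimes>\<^sub>M borel" by simp
  let ?\<mu> = "distr \<mu> (\<nu> \<Otimes>\<^sub>M borel) (\<lambda>e. e)"
  have "distr ?\<mu> \<nu> fst = distr \<mu> \<nu> fst"
    by (subst distr_distr) (auto simp: comp_def)
  also have "\<dots> = \<nu>" unfolding \<nu>_def by (rule distr_cong) auto
  finally have "\<exists>X\<in>borel_measurable (\<nu> \<Otimes>\<^sub>M borel). ?\<mu> = distr (\<nu> \<Otimes>\<^sub>M unif) (\<nu> \<Otimes>\<^sub>M borel) (\<lambda>(b, u). (b, X (b, u)))"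
    by (intro randomization finn) auto
  then obtain X where [measurable]: "X \<in> borel_measurable (\<nu> \<Otimes>\<^sub>M borel)"
    and X: "?\<mu> = distr (\<nu> \<Otimes>\<^sub>M unif) (\<nu> \<Otimes>\<^sub>M borel) (\<lambda>(b, u). (b, X (b, u)))" by blast
  define T where "T e = clip_pos (X e)" for e
  have X'[measurable]: "X \<in> borel_measurable (B \<Otimes>\<^sub>M borel)"
    using \<open>X \<in> borel_measurable (\<nu> \<Otimes>\<^sub>M borel)\<close>
    by (subst measurable_cong_sets[OF sets_pair_measure_cong[OF s\<nu> refl] refl, symmetric])
  then have "X \<in> borel_measurable (B \<Otimes>\<^sub>M unif)"
    by (subst measurable_cong_sets[OF sets_pair_measure_cong[OF refl sets_unif] refl])
  from measurable_compose[OF this clip_pos_measurable]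
  have T[measurable]: "T \<in> B \<Otimes>\<^sub>M unif \<rightarrow>\<^sub>M Rpos" unfolding T_def .
  have nn: "(\<integral>\<^sup>+e. f e \<partial>\<mu>) = (\<integral>\<^sup>+b. h b * (\<integral>\<^sup>+u. f (b, T (b, u)) \<partial>unif) \<partial>B)"
    if [measurable]: "f \<in> borel_measurable (B \<Otimes>\<^sub>M Rpos)" for f
  proof -
    have [measurable]: "(\<lambda>e. f (fst e, clip_pos (snd e))) \<in> borel_measurable (\<nu> \<Otimes>\<^sub>M borel)"
      "(\<lambda>e. f (fst e, clip_pos (snd e))) \<in> borel_measurable (B \<Otimes>\<^sub>M borel)" by measurable
    have "(\<integral>\<^sup>+e. f e \<partial>\<mu>) = (\<integral>\<^sup>+e. f (fst e, clip_pos (snd e)) \<partial>\<mu>)"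
      by (intro nn_integral_cong) (auto simp: sp clip_pos_def)
    also have "\<dots> = (\<integral>\<^sup>+e. f (fst e, clip_pos (snd e)) \<partial>?\<mu>)"
      by (subst nn_integral_distr) auto
    also have "\<dots> = (\<integral>\<^sup>+e. f (fst e, T e) \<partial>(\<nu> \<Otimes>\<^sub>M unif))"
      unfolding X T_def by (subst nn_integral_distr) (auto simp: case_prod_unfold)
    also have "\<dots> = (\<integral>\<^sup>+b. \<integral>\<^sup>+u. f (b, T (b, u)) \<partial>unif \<partial>\<nu>)"
      by (subst unif.nn_integral_fst[symmetric]) auto
    also have "\<dots> = (\<integral>\<^sup>+b. h b * (\<integral>\<^sup>+u. f (b, T (b, u)) \<partial>unif) \<partial>B)"
      unfolding hd[symmetric] by (rule nn_integral_density) measurable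
    finally show ?thesis .
  qed
  define good where "good b \<longleftrightarrow> h b < \<infinity> \<and> h b * (\<integral>\<^sup>+u. ennreal (T (b, u)) \<partial>unif) < \<infinity>" for b
  have [measurable]: "Measurable.pred B good"
    unfolding good_def by measurable
  have "(\<integral>\<^sup>+b. h b \<partial>B) = emeasure \<mu> (space \<mu>)"
    using nn[of "\<lambda>_. 1"] unif.emeasure_space_1 by simp
  then have "AE b in B. h b \<noteq> \<infinity>"
    by (intro nn_integral_PInf_AE) auto
  moreover have "AE b in B. h b * (\<integral>\<^sup>+u. ennreal (T (b, u)) \<partial>unif) \<noteq> \<infinity>"
    using t by (intro nn_integral_PInf_AE) (auto simp: nn)
  ultimately have good: "AE b in B. good b"
    by eventually_elim (auto simp: good_def less_top)
  define p where "p b = (if good b then scale_measure (h b) (distr unif Rpos (\<lambda>u. T (b, u))) else null_measure Rpos)" for b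
  have Tb[measurable]: "(\<lambda>u. T (b, u)) \<in> unif \<rightarrow>\<^sub>M Rpos" if "b \<in> space B" for b
    using that by measurable
  have em: "emeasure (p b) S = (if good b then h b * (\<integral>\<^sup>+u. indicator S (T (b, u)) \<partial>unif) else 0)"
    if "b \<in> space B" "S \<in> sets Rpos" for b S
    using that by (simp add: p_def emeasure_distr_eq_nn_integral[OF Tb])
  have "kernel B p"
    unfolding kernel_def
  proof safe
    fix b assume b: "b \<in> space B"
    have "emeasure (p b) (space (p b)) = emeasure (p b) {0<..}"
      by (simp add: p_def space_scale_measure)
    also have "\<dots> = (if good b then h b else 0)"
      using sets.top[of Rpos] b measurable_space[OF Tb[OF b]] unif.emeasure_space_1
      by (subst em) (auto simp: indicator_def)
    also have "\<dots> < \<infinity>" by (auto simp: good_def)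
    finally have "emeasure (p b) (space (p b)) < \<infinity>" .
    moreover have "(\<integral>\<^sup>+t. ennreal t \<partial>p b) < \<infinity>"
    proof (cases "good b")
      case True
      then have "(\<integral>\<^sup>+t. ennreal t \<partial>p b) = h b * (\<integral>\<^sup>+u. ennreal (T (b, u)) \<partial>unif)"
        by (simp add: p_def nn_integral_scale_measure measurable_borel_Rpos nn_integral_distr[OF Tb[OF b]])
      then show ?thesis using True by (simp add: good_def)
    qed (simp add: p_def)
    ultimately show "p b \<in> Mtri" by (simp add: Mtri_def p_def)
  next
    fix S assume [measurable]: "S \<in> sets Rpos"
    have "(\<lambda>b. if good b then h b * (\<integral>\<^sup>+u. indicator S (T (b, u)) \<partial>unif) else 0) \<in> borel_measurable B"
      by measurable
    then show "(\<lambda>b. emeasure (p b) S) \<in> borel_measurable B"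
      by (rule measurable_cong[THEN iffD2, rotated]) (simp add: em)
  qed
  moreover have "emeasure \<mu> (N \<times> S) = (\<integral>\<^sup>+b\<in>N. emeasure (p b) S \<partial>B)"
    if [measurable]: "N \<in> sets B" "S \<in> sets Rpos" for N S
  proof -
    have "emeasure \<mu> (N \<times> S) = (\<integral>\<^sup>+e. indicator (N \<times> S) e \<partial>\<mu>)"
      by (rule nn_integral_indicator[symmetric]) simp
    also have "\<dots> = (\<integral>\<^sup>+b. h b * (\<integral>\<^sup>+u. indicator (N \<times> S) (b, T (b, u)) \<partial>unif) \<partial>B)"
      by (rule nn) simp
    also have "\<dots> = (\<integral>\<^sup>+b\<in>N. emeasure (p b) S \<partial>B)"
    proof (rule nn_integral_cong_AE, use good AE_space in eventually_elim)
      fix b assume b: "good b" "b \<in> space B"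
      have "(\<integral>\<^sup>+u. indicator (N \<times> S) (b, T (b, u)) \<partial>unif) = (\<integral>\<^sup>+u. indicator N b * indicator S (T (b, u)) \<partial>unif)"
        by (intro nn_integral_cong) (auto simp: indicator_def)
      also have "\<dots> = indicator N b * (\<integral>\<^sup>+u. indicator S (T (b, u)) \<partial>unif)"
        using b by (intro nn_integral_cmult) simp
      finally show "h b * (\<integral>\<^sup>+u. indicator (N \<times> S) (b, T (b, u)) \<partial>unif) = emeasure (p b) S * indicator N b"
        using b by (simp add: em mult_ac)
    qed
    finally show ?thesis .
  qed
  ultimately show ?thesis by blast
qed

lemma nn_integral_weighted_image:
  assumes "w \<in> borel_measurable m" "g \<in> m \<rightarrow>\<^sub>M L" "f \<in> borel_measurable L"
  shows "(\<integral>\<^sup>+x. f x \<partial>distr (density m w) L g) = (\<integral>\<^sup>+e. w e * f (g e) \<partial>m)"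
  using assms by (subst nn_integral_distr) (auto simp: nn_integral_density)

lemma emeasure_weighted_image:
  assumes "w \<in> borel_measurable m" "g \<in> m \<rightarrow>\<^sub>M L" "E \<in> sets L"
  shows "emeasure (distr (density m w) L g) E = (\<integral>\<^sup>+e. w e * indicator E (g e) \<partial>m)"
  using nn_integral_weighted_image[OF assms(1,2), of "indicator E"] assms(3) by simp

context polymorphism
begin

text \<open>The measure on \<open>B \<times> \<real>\<^sup>\<times>\<close> whose disintegration over \<open>B\<close> gives the densities of the blocks \<open>M \<times> N\<close>.\<close>

definition source_slice :: "'a set \<Rightarrow> ('b \<times> real) measure" where
  "source_slice M = distr (density P (\<lambda>e. indicator M (fst e))) (B \<Otimes>\<^sub>M Rpos) snd"

definition target_slice :: "'b set \<Rightarrow> ('a \<times> real) measure" where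
  "target_slice K = distr (density P (\<lambda>e. indicator K (tgt e))) (A \<Otimes>\<^sub>M Rpos) (\<lambda>e. (fst e, ratio e))"

lemma nn_integral_source_slice:
  assumes [measurable]: "M \<in> sets A" "f \<in> borel_measurable (B \<Otimes>\<^sub>M Rpos)"
  shows "(\<integral>\<^sup>+x. f x \<partial>source_slice M) = (\<integral>\<^sup>+e. indicator M (fst e) * f (snd e) \<partial>P)"
  unfolding source_slice_def by (rule nn_integral_weighted_image) measurable

lemma nn_integral_target_slice:
  assumes [measurable]: "K \<in> sets B" "f \<in> borel_measurable (A \<Otimes>\<^sub>M Rpos)"
  shows "(\<integral>\<^sup>+x. f x \<partial>target_slice K) = (\<integral>\<^sup>+e. indicator K (tgt e) * f (fst e, ratio e) \<partial>P)"
  unfolding target_slice_def by (rule nn_integral_weighted_image) measurable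

lemma sets_slice[simp, measurable_cong]:
  "sets (source_slice M) = sets (B \<Otimes>\<^sub>M Rpos)" "sets (target_slice K) = sets (A \<Otimes>\<^sub>M Rpos)"
  by (simp_all add: source_slice_def target_slice_def)

lemma emeasure_source_slice:
  assumes [measurable]: "M \<in> sets A" "N \<in> sets B" "S \<in> sets Rpos"
  shows "emeasure (source_slice M) (N \<times> S) = emeasure (pol_block P M N) S"
proof -
  have "emeasure (source_slice M) (N \<times> S) = (\<integral>\<^sup>+x. indicator (N \<times> S) x \<partial>source_slice M)"
    by (rule nn_integral_indicator[symmetric]) simp
  also have "\<dots> = (\<integral>\<^sup>+e. indicator M (fst e) * indicator (N \<times> S) (snd e) \<partial>P)"
    by (rule nn_integral_source_slice) auto
  also have "\<dots> = (\<integral>\<^sup>+e. indicator (M \<times> N \<times> S) e \<partial>P)"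
    by (intro nn_integral_cong) (auto simp: indicator_def)
  finally show ?thesis by (simp add: emeasure_block)
qed

lemma emeasure_target_slice:
  assumes [measurable]: "M \<in> sets A" "N \<in> sets B" "S \<in> sets Rpos"
  shows "emeasure (target_slice N) (M \<times> S) = emeasure (pol_block P M N) S"
proof -
  have "emeasure (target_slice N) (M \<times> S) = (\<integral>\<^sup>+x. indicator (M \<times> S) x \<partial>target_slice N)"
    by (rule nn_integral_indicator[symmetric]) simp
  also have "\<dots> = (\<integral>\<^sup>+e. indicator N (tgt e) * indicator (M \<times> S) (fst e, ratio e) \<partial>P)"
    by (rule nn_integral_target_slice) auto
  also have "\<dots> = (\<integral>\<^sup>+e. indicator (M \<times> N \<times> S) e \<partial>P)"
    by (intro nn_integral_cong) (auto simp: indicator_def)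
  finally show ?thesis by (simp add: emeasure_block)
qed

lemma finite_source_slice:
  assumes "finite_measure A" and [measurable]: "M \<in> sets A" shows "finite_measure (source_slice M)"
proof (rule finite_measureI)
  have "emeasure (source_slice M) (space (source_slice M)) = (\<integral>\<^sup>+x. 1 \<partial>source_slice M)" by simp
  also have "\<dots> = (\<integral>\<^sup>+e. indicator M (fst e) * 1 \<partial>P)" by (rule nn_integral_source_slice) auto
  also have "\<dots> \<le> (\<integral>\<^sup>+e. 1 \<partial>P)" by (intro nn_integral_mono) (auto simp: indicator_def)
  also have "\<dots> < \<infinity>" using assms(1) by (simp add: emeasure_space_P finite_measure.emeasure_finite less_top[symmetric])
  finally show "emeasure (source_slice M) (space (source_slice M)) \<noteq> \<infinity>" by simp
qed

lemma finite_target_slice: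
  assumes "finite_measure A" and [measurable]: "K \<in> sets B" shows "finite_measure (target_slice K)"
proof (rule finite_measureI)
  have "emeasure (target_slice K) (space (target_slice K)) = (\<integral>\<^sup>+x. 1 \<partial>target_slice K)" by simp
  also have "\<dots> = (\<integral>\<^sup>+e. indicator K (tgt e) * 1 \<partial>P)" by (rule nn_integral_target_slice) auto
  also have "\<dots> \<le> (\<integral>\<^sup>+e. 1 \<partial>P)" by (intro nn_integral_mono) (auto simp: indicator_def)
  also have "\<dots> < \<infinity>" using assms(1) by (simp add: emeasure_space_P finite_measure.emeasure_finite less_top[symmetric])
  finally show "emeasure (target_slice K) (space (target_slice K)) \<noteq> \<infinity>" by simp
qed

lemma block_disintegration_exists:
  assumes A: "finite_measure A" and B: "finite_measure B" and [measurable]: "M \<in> sets A"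
  shows "\<exists>p. is_disintegration B p (\<lambda>N. pol_block P M N)"
proof -
  have "AE e in source_slice M. fst e \<notin> N" if N: "N \<in> null_sets B" for N
  proof -
    from N have [measurable]: "N \<in> sets B" by auto
    have "(\<integral>\<^sup>+x. indicator N (fst x) \<partial>source_slice M) = (\<integral>\<^sup>+e. indicator M (fst e) * indicator N (tgt e) \<partial>P)"
      by (rule nn_integral_source_slice) auto
    also have "\<dots> = (\<integral>\<^sup>+e. 0 \<partial>P)"
      by (rule nn_integral_cong_AE) (use null_target[OF N] in \<open>eventually_elim, auto\<close>)
    also have "\<dots> = 0" by simp
    finally have "AE x in source_slice M. indicator N (fst x) = (0::ennreal)"
      by (subst (asm) nn_integral_0_iff_AE) auto
    then show ?thesis by (auto simp: indicator_def split: if_splits)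
  qed
  moreover have "(\<integral>\<^sup>+e. ennreal (snd e) \<partial>source_slice M) < \<infinity>"
  proof -
    have "(\<integral>\<^sup>+e. ennreal (snd e) \<partial>source_slice M) = (\<integral>\<^sup>+e. indicator M (fst e) * ennreal (ratio e) \<partial>P)"
      by (rule nn_integral_source_slice) auto
    also have "\<dots> \<le> (\<integral>\<^sup>+e. ennreal (ratio e) \<partial>P)" by (intro nn_integral_mono) (auto simp: indicator_def)
    also have "\<dots> < \<infinity>" using B by (simp add: nn_integral_ratio finite_measure.emeasure_finite less_top[symmetric])
    finally show ?thesis .
  qed
  ultimately obtain p where "kernel B p"
    "\<And>N S. N \<in> sets B \<Longrightarrow> S \<in> sets Rpos \<Longrightarrow> emeasure (source_slice M) (N \<times> S) = (\<integral>\<^sup>+b\<in>N. emeasure (p b) S \<partial>B)"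
    using disintegration_exists[OF B sets_slice(1) finite_source_slice[OF A assms(3)]] by blast
  then show ?thesis
    by (intro exI[of _ p]) (auto simp: is_disintegration_def kernel_def emeasure_source_slice)
qed

lemma nn_integral_source_disintegration:
  assumes A: "finite_measure A" and B: "finite_measure B" "space B \<noteq> {}" and M[measurable]: "M \<in> sets A"
    and p: "is_disintegration B p (\<lambda>N. pol_block P M N)" and f[measurable]: "f \<in> borel_measurable (B \<Otimes>\<^sub>M Rpos)"
  shows "(\<integral>\<^sup>+e. indicator M (fst e) * f (snd e) \<partial>P) = (\<integral>\<^sup>+b. \<integral>\<^sup>+t. f (b, t) \<partial>p b \<partial>B)"
  unfolding nn_integral_source_slice[OF M f, symmetric]
  by (rule kernel_disintegrates_nn_integral[OF _ B])
     (use p finite_source_slice[OF A M] in \<open>auto simp: is_disintegration_def kernel_def emeasure_source_slice\<close>)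

lemma nn_integral_target_disintegration:
  assumes A: "finite_measure A" "space A \<noteq> {}" and K[measurable]: "K \<in> sets B"
    and q: "is_disintegration A q (\<lambda>M. pol_block P M K)" and f[measurable]: "f \<in> borel_measurable (A \<Otimes>\<^sub>M Rpos)"
  shows "(\<integral>\<^sup>+e. indicator K (tgt e) * f (fst e, ratio e) \<partial>P) = (\<integral>\<^sup>+a. \<integral>\<^sup>+t. f (a, t) \<partial>q a \<partial>A)"
  unfolding nn_integral_target_slice[OF K f, symmetric]
  by (rule kernel_disintegrates_nn_integral[OF _ A])
     (use q finite_target_slice[OF A(1) K] in \<open>auto simp: is_disintegration_def kernel_def emeasure_target_slice\<close>)

end

section \<open>Uniqueness of the product\<close>

lemma is_disintegration_kernel: "is_disintegration B p \<rho> \<Longrightarrow> kernel B p"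
  by (auto simp: is_disintegration_def kernel_def)

lemma Mtri_finite:
  assumes "\<mu> \<in> Mtri"
  shows "finite_measure \<mu>" and "sets \<mu> = sets Rpos" and "space \<mu> = {0<..}"
  using assms sets_eq_imp_space_eq[of \<mu> Rpos] by (auto simp: Mtri_def intro: finite_measureI)

lemma emeasure_mconv:
  assumes \<mu>: "\<mu> \<in> Mtri" and \<nu>: "\<nu> \<in> Mtri" and S[measurable]: "S \<in> sets Rpos"
  shows "emeasure (mconv \<mu> \<nu>) S = (\<integral>\<^sup>+s. \<integral>\<^sup>+t. indicator S (t * s) \<partial>\<nu> \<partial>\<mu>)"
    and "emeasure (mconv \<mu> \<nu>) S = (\<integral>\<^sup>+t. \<integral>\<^sup>+s. indicator S (t * s) \<partial>\<mu> \<partial>\<nu>)"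
proof -
  note [measurable_cong] = Mtri_finite(2)[OF \<mu>] Mtri_finite(2)[OF \<nu>]
  interpret \<mu>: finite_measure \<mu> using Mtri_finite[OF \<mu>] by simp
  interpret \<nu>: finite_measure \<nu> using Mtri_finite[OF \<nu>] by simp
  interpret pair_sigma_finite \<mu> \<nu> ..
  have m: "(\<lambda>x. fst x * snd x) \<in> \<mu> \<Otimes>\<^sub>M \<nu> \<rightarrow>\<^sub>M Rpos"
    by measurable
  have "emeasure (mconv \<mu> \<nu>) S = (\<integral>\<^sup>+x. indicator S (snd x * fst x) \<partial>(\<mu> \<Otimes>\<^sub>M \<nu>))"
    unfolding mconv_def case_prod_unfold by (subst emeasure_distr_eq_nn_integral[OF m S]) (simp add: mult.commute)
  also have "\<dots> = (\<integral>\<^sup>+s. \<integral>\<^sup>+t. indicator S (t * s) \<partial>\<nu> \<partial>\<mu>)"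
    by (subst \<nu>.nn_integral_fst[symmetric]) auto
  finally show 1: "emeasure (mconv \<mu> \<nu>) S = (\<integral>\<^sup>+s. \<integral>\<^sup>+t. indicator S (t * s) \<partial>\<nu> \<partial>\<mu>)" .
  show "emeasure (mconv \<mu> \<nu>) S = (\<integral>\<^sup>+t. \<integral>\<^sup>+s. indicator S (t * s) \<partial>\<mu> \<partial>\<nu>)"
    unfolding 1 by (rule Fubini'[symmetric]) measurable
qed

lemma kernel_mult_measurable:
  assumes q: "kernel B q" and [measurable]: "S \<in> sets Rpos"
  shows "(\<lambda>x. \<integral>\<^sup>+s. indicator S (snd x * s) \<partial>q (fst x)) \<in> borel_measurable (B \<Otimes>\<^sub>M Rpos)"
proof -
  have q': "kernel (B \<Otimes>\<^sub>M Rpos) (\<lambda>x. q (fst x))"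
    using q unfolding kernel_def
    by (auto simp: space_pair_measure intro: measurable_compose[OF measurable_fst])
  show ?thesis
    by (rule kernel_nn_integral_measurable[OF q']) measurable
qed

text \<open>The right-hand side does not mention \<open>p\<close>: it is the defining integral of the product with the
disintegration of \<open>P\<close> integrated out.\<close>

lemma pol_prod_value_source:
  assumes A: "finite_measure A" and B: "finite_measure B" "space B \<noteq> {}"
    and P: "P \<in> Pol A B" and [measurable]: "M \<in> sets A" "S \<in> sets Rpos"
    and p: "is_disintegration B p (\<lambda>N. pol_block P M N)" and q: "kernel B q"
  shows "(\<integral>\<^sup>+b. emeasure (mconv (q b) (p b)) S \<partial>B)
    = (\<integral>\<^sup>+e. indicator M (fst e) * (\<integral>\<^sup>+s. indicator S (ratio e * s) \<partial>q (tgt e)) \<partial>P)"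
proof -
  interpret polymorphism A B P by unfold_locales fact
  have "(\<integral>\<^sup>+b. emeasure (mconv (q b) (p b)) S \<partial>B) = (\<integral>\<^sup>+b. \<integral>\<^sup>+t. \<integral>\<^sup>+s. indicator S (t * s) \<partial>q b \<partial>p b \<partial>B)"
    using p q by (intro nn_integral_cong emeasure_mconv(2)) (auto simp: is_disintegration_def kernel_def)
  also have "\<dots> = (\<integral>\<^sup>+e. indicator M (fst e) * (\<integral>\<^sup>+s. indicator S (ratio e * s) \<partial>q (tgt e)) \<partial>P)"
    using nn_integral_source_disintegration[OF A B _ p kernel_mult_measurable[OF q]] by simp
  finally show ?thesis .
qed

lemma pol_prod_value_target:
  assumes B: "finite_measure B" "space B \<noteq> {}"
    and Q: "Q \<in> Pol B C" and [measurable]: "K \<in> sets C" "S \<in> sets Rpos"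
    and q: "is_disintegration B q (\<lambda>N. pol_block Q N K)" and p: "kernel B p"
  shows "(\<integral>\<^sup>+b. emeasure (mconv (q b) (p b)) S \<partial>B)
    = (\<integral>\<^sup>+e. indicator K (tgt e) * (\<integral>\<^sup>+t. indicator S (ratio e * t) \<partial>p (fst e)) \<partial>Q)"
proof -
  interpret polymorphism B C Q by unfold_locales fact
  have "(\<integral>\<^sup>+b. emeasure (mconv (q b) (p b)) S \<partial>B) = (\<integral>\<^sup>+b. \<integral>\<^sup>+s. \<integral>\<^sup>+t. indicator S (s * t) \<partial>p b \<partial>q b \<partial>B)"
    using p q by (intro nn_integral_cong) (subst emeasure_mconv(1), auto simp: is_disintegration_def kernel_def mult.commute)
  also have "\<dots> = (\<integral>\<^sup>+e. indicator K (tgt e) * (\<integral>\<^sup>+t. indicator S (ratio e * t) \<partial>p (fst e)) \<partial>Q)"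
    using nn_integral_target_disintegration[OF B _ q kernel_mult_measurable[OF p]] by simp
  finally show ?thesis .
qed

text \<open>The two disintegrations \<open>p\<close> and \<open>p'\<close> of \<open>P\<close> are exchanged by the formula over \<open>P\<close>, the two
disintegrations \<open>q\<close> and \<open>q'\<close> of \<open>Q\<close> by the formula over \<open>Q\<close>. So the products agree on all
blocks.\<close>

lemma is_pol_prod_unique:
  assumes A: "finite_measure A" and B: "finite_measure B" "space B \<noteq> {}"
    and P: "P \<in> Pol A B" and Q: "Q \<in> Pol B C"
    and 1: "is_pol_prod A B C Q P R" and 2: "is_pol_prod A B C Q P R'"
  shows "R = R'"
proof (rule Pol_eqI[OF A])
  show R: "R \<in> Pol A C" "R' \<in> Pol A C" using 1 2 by (auto simp: is_pol_prod_def)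
  fix M K S assume M: "M \<in> sets A" and K: "K \<in> sets C" and S: "S \<in> sets Rpos"
  obtain p q where pq: "is_disintegration B p (\<lambda>N. pol_block P M N)" "is_disintegration B q (\<lambda>N. pol_block Q N K)"
    "emeasure (pol_block R M K) S = (\<integral>\<^sup>+b. emeasure (mconv (q b) (p b)) S \<partial>B)"
    using 1 M K S by (fastforce simp: is_pol_prod_def)
  obtain p' q' where pq': "is_disintegration B p' (\<lambda>N. pol_block P M N)" "is_disintegration B q' (\<lambda>N. pol_block Q N K)"
    "emeasure (pol_block R' M K) S = (\<integral>\<^sup>+b. emeasure (mconv (q' b) (p' b)) S \<partial>B)"
    using 2 M K S by (fastforce simp: is_pol_prod_def)
  note k = pq(1,2)[THEN is_disintegration_kernel] pq'(1,2)[THEN is_disintegration_kernel]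
  have "(\<integral>\<^sup>+b. emeasure (mconv (q b) (p b)) S \<partial>B) = (\<integral>\<^sup>+b. emeasure (mconv (q b) (p' b)) S \<partial>B)"
    by (simp add: pol_prod_value_source[OF A B P M S pq(1) k(2)] pol_prod_value_source[OF A B P M S pq'(1) k(2)])
  also have "\<dots> = (\<integral>\<^sup>+b. emeasure (mconv (q' b) (p' b)) S \<partial>B)"
    by (simp add: pol_prod_value_target[OF B Q K S pq(2) k(3)] pol_prod_value_target[OF B Q K S pq'(2) k(3)])
  finally show "emeasure R (M \<times> K \<times> S) = emeasure R' (M \<times> K \<times> S)"
    unfolding polymorphism.emeasure_block[OF polymorphism.intro[OF R(1)] M K S, symmetric]
      polymorphism.emeasure_block[OF polymorphism.intro[OF R(2)] M K S, symmetric] pq(3) pq'(3) .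
qed

section \<open>Existence of the product\<close>

text \<open>An identification of \<open>C\<close>, modulo null sets, with the line carrying the image measure. The inverse \<open>g\<close> is
measurable only with respect to the completion, since \<open>C\<close> may contain all Lebesgue measurable sets.\<close>

definition real_model :: "'c measure \<Rightarrow> ('c \<Rightarrow> real) \<Rightarrow> (real \<Rightarrow> 'c) \<Rightarrow> bool" where
  "real_model C f g \<longleftrightarrow> f \<in> borel_measurable C \<and> g \<in> completion (distr C borel f) \<rightarrow>\<^sub>M C \<and>
     (AE c in C. g (f c) = c)"

abbreviation noise :: "(real \<times> real) measure" where "noise \<equiv> unif \<Otimes>\<^sub>M unif"

lemma prob_space_noise: "prob_space noise"
proof -
  interpret unif: prob_space unif by (rule prob_space_unif)
  interpret pair_prob_space unif unif ..
  show ?thesis by unfold_locales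
qed

locale composable = P: polymorphism A B P + Q: polymorphism B C Q
  for A :: "'a measure" and B :: "'b measure" and C :: "'c measure" and P Q +
  assumes A: "finite_measure A" and B: "finite_measure B" "space B \<noteq> {}" and C: "finite_measure C"

text \<open>With \<open>w\<close> uniform in the unit square, \<open>Q\<close> is the law of a triple \<open>(b, c(b,w), T(b,w))\<close> and \<open>R\<close> is the law
of \<open>(a, c(b,w), t T(b,w))\<close> under \<open>P\<close> times the law of \<open>w\<close>. The point \<open>c\<close> enters only through the events
\<open>V K\<close>, which stand for \<open>c \<in> K\<close> up to null sets.\<close>

definition randomized_product :: "'a measure \<Rightarrow> 'b measure \<Rightarrow> 'c measure \<Rightarrow> ('a \<times> 'b \<times> real) measure \<Rightarrow>
   ('b \<times> 'c \<times> real) measure \<Rightarrow> ('a \<times> 'c \<times> real) measure \<Rightarrow> ('b \<times> real \<times> real \<Rightarrow> real) \<Rightarrow> ('c set \<Rightarrow> ('b \<times> real \<times> real) set) \<Rightarrow> bool" where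
  "randomized_product A B C P Q R T V \<longleftrightarrow> T \<in> B \<Otimes>\<^sub>M noise \<rightarrow>\<^sub>M Rpos \<and> (\<forall>K\<in>sets C. V K \<in> sets (B \<Otimes>\<^sub>M noise)) \<and>
    (\<forall>K\<in>sets C. \<forall>\<phi>\<in>borel_measurable (B \<Otimes>\<^sub>M Rpos).
      (\<integral>\<^sup>+e. indicator K (tgt e) * \<phi> (fst e, ratio e) \<partial>Q) = (\<integral>\<^sup>+x. indicator (V K) x * \<phi> (fst x, T x) \<partial>(B \<Otimes>\<^sub>M noise))) \<and>
    (\<forall>K\<in>sets C. \<forall>\<phi>\<in>borel_measurable (A \<Otimes>\<^sub>M Rpos).
      (\<integral>\<^sup>+e. indicator K (tgt e) * \<phi> (fst e, ratio e) \<partial>R) =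
      (\<integral>\<^sup>+x. indicator (V K) (tgt (fst x), snd x) * \<phi> (fst (fst x), ratio (fst x) * T (tgt (fst x), snd x)) \<partial>(P \<Otimes>\<^sub>M noise)))"

context composable
begin

text \<open>Randomization is carried out on the real model of \<open>C\<close> and the result is transported back by \<open>g\<close>.\<close>

lemma randomized_product_exists:
  assumes std: "real_model C f g"
  shows "\<exists>R T V. R \<in> Pol A C \<and> randomized_product A B C P Q R T V"
proof -
  interpret noise: prob_space noise by (rule prob_space_noise)
  interpret B: finite_measure B by (rule B)
  interpret P': finite_measure P by (rule P.finite_P[OF A])
  interpret PN: pair_sigma_finite P noise ..
  have f[measurable]: "f \<in> borel_measurable C" and g: "g \<in> completion (distr C borel f) \<rightarrow>\<^sub>M C"
    and gf: "AE c in C. g (f c) = c" using std by (auto simp: real_model_def)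
  let ?D = "distr C borel f"
  have "distr Q B fst = B" using Q.Pol by (simp add: Pol_def case_prod_unfold)
  have fQ: "(\<lambda>e. f (tgt e)) \<in> borel_measurable Q" by measurable
  have tQ: "(\<lambda>e. ratio e) \<in> borel_measurable Q"
    using measurable_from_Rpos[OF Q.measurable_ratio] .
  from randomization_pair[OF B(1) Q.measurable_source fQ tQ \<open>distr Q B fst = B\<close>]
  obtain X T0 where [measurable]: "X \<in> borel_measurable (B \<Otimes>\<^sub>M noise)" "T0 \<in> borel_measurable (B \<Otimes>\<^sub>M noise)"
    and law: "distr Q (B \<Otimes>\<^sub>M borel \<Otimes>\<^sub>M borel) (\<lambda>e. (fst e, f (tgt e), ratio e))
      = distr (B \<Otimes>\<^sub>M noise) (B \<Otimes>\<^sub>M borel \<Otimes>\<^sub>M borel) (\<lambda>(b, w). (b, X (b, w), T0 (b, w)))"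
    by blast
  define T where "T e = clip_pos (T0 e)" for e
  have T[measurable]: "T \<in> B \<Otimes>\<^sub>M noise \<rightarrow>\<^sub>M Rpos" unfolding T_def
    by (rule measurable_compose[OF \<open>T0 \<in> borel_measurable _\<close> clip_pos_measurable])
  have Qlaw: "(\<integral>\<^sup>+e. \<phi> (fst e, f (tgt e), ratio e) \<partial>Q) = (\<integral>\<^sup>+x. \<phi> (fst x, X x, T x) \<partial>(B \<Otimes>\<^sub>M noise))"
    if [measurable]: "\<phi> \<in> borel_measurable (B \<Otimes>\<^sub>M borel \<Otimes>\<^sub>M Rpos)" for \<phi>
  proof -
    have m: "(\<lambda>(b, d, s). \<phi> (b, d, clip_pos s)) \<in> borel_measurable (B \<Otimes>\<^sub>M borel \<Otimes>\<^sub>M borel)" by measurable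
    have "(\<integral>\<^sup>+e. \<phi> (fst e, f (tgt e), ratio e) \<partial>Q) = (\<integral>\<^sup>+e. \<phi> (fst e, f (tgt e), clip_pos (ratio e)) \<partial>Q)"
      by (intro nn_integral_cong) (auto simp: Q.space_P clip_pos_def)
    also have "\<dots> = (\<integral>\<^sup>+y. (case y of (b, d, s) \<Rightarrow> \<phi> (b, d, clip_pos s)) \<partial>distr Q (B \<Otimes>\<^sub>M borel \<Otimes>\<^sub>M borel) (\<lambda>e. (fst e, f (tgt e), ratio e)))"
      using tQ m by (subst nn_integral_distr) auto
    also have "\<dots> = (\<integral>\<^sup>+x. \<phi> (fst x, X x, T x) \<partial>(B \<Otimes>\<^sub>M noise))"
      unfolding law using m by (subst nn_integral_distr) (auto simp: T_def case_prod_unfold)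
    finally show ?thesis .
  qed
  \<comment> \<open>Borel sets of the line that stand for the measurable sets of \<open>C\<close>.\<close>
  have "\<exists>K'\<in>sets borel. AE d in ?D. g d \<in> K \<longleftrightarrow> d \<in> K'" if K: "K \<in> sets C" for K
  proof -
    have "g -` K \<inter> space (completion ?D) \<in> sets (completion ?D)" by (rule measurable_sets[OF g K])
    then obtain S N N' where SN: "g -` K \<inter> UNIV = S \<union> N" "N \<subseteq> N'" "N' \<in> null_sets ?D" "S \<in> sets ?D"
      by (auto elim!: sets_completionE)
    have "AE d in ?D. g d \<in> K \<longleftrightarrow> d \<in> S"
      using AE_not_in[OF SN(3)] by eventually_elim (use SN in auto)
    then show ?thesis using SN by auto
  qed
  then obtain bs where bs[measurable]: "\<And>K. K \<in> sets C \<Longrightarrow> bs K \<in> sets borel"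
    and bsAE: "\<And>K. K \<in> sets C \<Longrightarrow> AE d in ?D. g d \<in> K \<longleftrightarrow> d \<in> bs K" by metis
  have bsC: "AE c in C. c \<in> K \<longleftrightarrow> f c \<in> bs K" if K: "K \<in> sets C" for K
  proof -
    from bsAE[OF K] have "AE c in C. g (f c) \<in> K \<longleftrightarrow> f c \<in> bs K" by (rule AE_distrD[OF f])
    with gf show ?thesis by eventually_elim auto
  qed
  have bsQ: "AE e in Q. tgt e \<in> K \<longleftrightarrow> f (tgt e) \<in> bs K" if K: "K \<in> sets C" for K
  proof -
    from bsC[OF K] obtain N where N: "N \<in> null_sets C" "{c\<in>space C. \<not> (c \<in> K \<longleftrightarrow> f c \<in> bs K)} \<subseteq> N"
      by (auto simp: eventually_ae_filter)
    from Q.null_target[OF N(1)] AE_space show ?thesis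
      by eventually_elim (use N in \<open>auto simp: Q.space_P\<close>)
  qed
  define V where "V K = X -` bs K \<inter> space (B \<Otimes>\<^sub>M noise)" for K
  have V[measurable]: "V K \<in> sets (B \<Otimes>\<^sub>M noise)" if [measurable]: "K \<in> sets C" for K
    unfolding V_def by measurable
  have Qrep: "(\<integral>\<^sup>+e. indicator K (tgt e) * \<phi> (fst e, ratio e) \<partial>Q) = (\<integral>\<^sup>+x. indicator (V K) x * \<phi> (fst x, T x) \<partial>(B \<Otimes>\<^sub>M noise))"
    if K[measurable]: "K \<in> sets C" and [measurable]: "\<phi> \<in> borel_measurable (B \<Otimes>\<^sub>M Rpos)" for K \<phi>
  proof -
    have "(\<integral>\<^sup>+e. indicator K (tgt e) * \<phi> (fst e, ratio e) \<partial>Q)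
      = (\<integral>\<^sup>+e. indicator (bs K) (f (tgt e)) * \<phi> (fst e, ratio e) \<partial>Q)"
      by (rule nn_integral_cong_AE) (use bsQ[OF K] in \<open>eventually_elim, auto simp: indicator_def\<close>)
    also have "\<dots> = (\<integral>\<^sup>+x. indicator (bs K) (X x) * \<phi> (fst x, T x) \<partial>(B \<Otimes>\<^sub>M noise))"
      using Qlaw[of "\<lambda>(b, d, s). indicator (bs K) d * \<phi> (b, s)"] by simp
    also have "\<dots> = (\<integral>\<^sup>+x. indicator (V K) x * \<phi> (fst x, T x) \<partial>(B \<Otimes>\<^sub>M noise))"
      by (intro nn_integral_cong) (auto simp: V_def indicator_def)
    finally show ?thesis .
  qed
  let ?bw = "\<lambda>x::(('a \<times> 'b \<times> real) \<times> real \<times> real). (tgt (fst x), snd x)"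
  let ?PN = "P \<Otimes>\<^sub>M noise"
  have bw[measurable]: "?bw \<in> ?PN \<rightarrow>\<^sub>M B \<Otimes>\<^sub>M noise" by measurable
  have Xbw[measurable]: "(\<lambda>x. X (?bw x)) \<in> borel_measurable ?PN"
    by (rule measurable_compose[OF bw]) measurable
  have Tbw[measurable]: "(\<lambda>x. T (?bw x)) \<in> ?PN \<rightarrow>\<^sub>M Rpos"
    by (rule measurable_compose[OF bw T])
  have t[measurable]: "(\<lambda>x. ratio (fst x)) \<in> ?PN \<rightarrow>\<^sub>M Rpos" by measurable
  let ?r = "\<lambda>x. ratio (fst x) * T (?bw x)"
  have r[measurable]: "?r \<in> ?PN \<rightarrow>\<^sub>M Rpos" by measurable
  \<comment> \<open>The image of the randomized triples, weighted by the ratio, on the real model is the image of \<open>C\<close>.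
    Hence null sets of the real model are avoided, and \<open>g\<close> may be applied.\<close>
  have targ: "(\<integral>\<^sup>+x. \<psi> (X (?bw x)) * ennreal (?r x) \<partial>?PN) = (\<integral>\<^sup>+c. \<psi> (f c) \<partial>C)"
    if [measurable]: "\<psi> \<in> borel_measurable borel" for \<psi>
  proof -
    have "(\<integral>\<^sup>+x. \<psi> (X (?bw x)) * ennreal (?r x) \<partial>?PN)
      = (\<integral>\<^sup>+e. \<integral>\<^sup>+w. \<psi> (X (tgt e, w)) * ennreal (ratio e * T (tgt e, w)) \<partial>noise \<partial>P)"
      by (subst noise.nn_integral_fst[symmetric]) auto
    also have "\<dots> = (\<integral>\<^sup>+e. (\<integral>\<^sup>+w. \<psi> (X (tgt e, w)) * ennreal (T (tgt e, w)) \<partial>noise) * ennreal (ratio e) \<partial>P)"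
    proof (intro nn_integral_cong)
      fix e assume e: "e \<in> space P"
      then have [measurable]: "tgt e \<in> space B" by (auto simp: P.space_P)
      have "(\<integral>\<^sup>+w. \<psi> (X (tgt e, w)) * ennreal (ratio e * T (tgt e, w)) \<partial>noise)
        = (\<integral>\<^sup>+w. \<psi> (X (tgt e, w)) * ennreal (T (tgt e, w)) * ennreal (ratio e) \<partial>noise)"
        using e by (intro nn_integral_cong) (auto simp: P.space_P ennreal_mult' mult_ac)
      also have "\<dots> = (\<integral>\<^sup>+w. \<psi> (X (tgt e, w)) * ennreal (T (tgt e, w)) \<partial>noise) * ennreal (ratio e)"
        by (rule nn_integral_multc) measurable
      finally show "(\<integral>\<^sup>+w. \<psi> (X (tgt e, w)) * ennreal (ratio e * T (tgt e, w)) \<partial>noise) = \<dots>" .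
    qed
    also have "\<dots> = (\<integral>\<^sup>+b. \<integral>\<^sup>+w. \<psi> (X (b, w)) * ennreal (T (b, w)) \<partial>noise \<partial>B)"
      by (rule P.nn_integral_target) measurable
    also have "\<dots> = (\<integral>\<^sup>+x. \<psi> (X x) * ennreal (T x) \<partial>(B \<Otimes>\<^sub>M noise))"
      by (subst noise.nn_integral_fst[symmetric]) auto
    also have "\<dots> = (\<integral>\<^sup>+e. \<psi> (f (tgt e)) * ennreal (ratio e) \<partial>Q)"
      using Qlaw[of "\<lambda>(b, d, s). \<psi> d * ennreal s"] by (simp add: measurable_from_Rpos)
    also have "\<dots> = (\<integral>\<^sup>+c. \<psi> (f c) \<partial>C)"
      by (rule Q.nn_integral_target) measurable
    finally show ?thesis .
  qed
  have nullX: "AE x in ?PN. X (?bw x) \<notin> N" if N: "N \<in> null_sets ?D" for N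
  proof -
    from N have [measurable]: "N \<in> sets borel" by auto
    have "(\<integral>\<^sup>+c. indicator N (f c) \<partial>C) = emeasure ?D N"
      by (rule emeasure_distr_eq_nn_integral[symmetric]) auto
    also have "\<dots> = 0" using N by auto
    finally have "(\<integral>\<^sup>+x. indicator N (X (?bw x)) * ennreal (?r x) \<partial>?PN) = 0"
      by (subst targ) auto
    then have "AE x in ?PN. indicator N (X (?bw x)) * ennreal (?r x) = 0"
      by (subst (asm) nn_integral_0_iff_AE) auto
    with AE_space show ?thesis
    proof eventually_elim
      case (elim x)
      then have "0 < ?r x" using measurable_space[OF r] by simp
      with elim show ?case by (auto simp: indicator_def split: if_splits)
    qed
  qed
  have AEX: "AE x in ?PN. pr (X (?bw x))" if "AE d in ?D. pr d" for pr
  proof -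
    from that obtain N where N: "N \<in> null_sets ?D" "{d. \<not> pr d} \<subseteq> N"
      by (auto simp: eventually_ae_filter)
    from nullX[OF N(1)] show ?thesis by eventually_elim (use N in auto)
  qed
  \<comment> \<open>Measurability needs the completion: preimages under \<open>g\<close> are Borel up to null sets only.\<close>
  have gX: "(\<lambda>x. g (X (?bw x))) \<in> completion ?PN \<rightarrow>\<^sub>M C"
  proof (rule measurableI)
    show "g (X (?bw x)) \<in> space C" for x
      using measurable_space[OF g] by simp
    fix K assume K[measurable]: "K \<in> sets C"
    have "Measurable.pred (completion ?PN) (\<lambda>x. (g (X (?bw x)) \<in> K) \<noteq> (X (?bw x) \<in> bs K))"
      by (rule sets_completion_AE) (use AEX[OF bsAE[OF K]] in auto)
    moreover have "Measurable.pred (completion ?PN) (\<lambda>x. X (?bw x) \<in> bs K)"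
      by (rule measurable_completion) measurable
    ultimately have "Measurable.pred (completion ?PN) (\<lambda>x. ((g (X (?bw x)) \<in> K) \<noteq> (X (?bw x) \<in> bs K)) \<noteq> (X (?bw x) \<in> bs K))"
      by measurable
    then have "Measurable.pred (completion ?PN) (\<lambda>x. g (X (?bw x)) \<in> K)"
      by (rule measurable_cong[THEN iffD1, rotated]) auto
    then show "(\<lambda>x. g (X (?bw x))) -` K \<inter> space (completion ?PN) \<in> sets (completion ?PN)"
      by (simp add: pred_def vimage_def Int_def conj_commute)
  qed
  let ?R = "distr (completion ?PN) (A \<Otimes>\<^sub>M C \<Otimes>\<^sub>M Rpos) (\<lambda>x. (fst (fst x), g (X (?bw x)), ?r x))"
  have aM: "(\<lambda>x. fst (fst x)) \<in> completion ?PN \<rightarrow>\<^sub>M A" by (rule measurable_completion) measurable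
  have rM: "?r \<in> completion ?PN \<rightarrow>\<^sub>M Rpos" by (rule measurable_completion) measurable
  note [measurable] = aM rM gX
  have mR: "(\<lambda>x. (fst (fst x), g (X (?bw x)), ?r x)) \<in> completion ?PN \<rightarrow>\<^sub>M A \<Otimes>\<^sub>M C \<Otimes>\<^sub>M Rpos"
    by measurable
  have Rrep: "(\<integral>\<^sup>+e. indicator K (tgt e) * \<phi> (fst e, ratio e) \<partial>?R) =
      (\<integral>\<^sup>+x. indicator (V K) (?bw x) * \<phi> (fst (fst x), ?r x) \<partial>?PN)"
    if K[measurable]: "K \<in> sets C" and \<phi>[measurable]: "\<phi> \<in> borel_measurable (A \<Otimes>\<^sub>M Rpos)" for K \<phi>
  proof -
    have "(\<integral>\<^sup>+e. indicator K (tgt e) * \<phi> (fst e, ratio e) \<partial>?R)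
      = (\<integral>\<^sup>+x. indicator K (g (X (?bw x))) * \<phi> (fst (fst x), ?r x) \<partial>completion ?PN)"
      by (subst nn_integral_distr[OF mR]) auto
    also have "\<dots> = (\<integral>\<^sup>+x. indicator (bs K) (X (?bw x)) * \<phi> (fst (fst x), ?r x) \<partial>completion ?PN)"
      by (rule nn_integral_cong_AE, rule AE_completion, use AEX[OF bsAE[OF K]] in eventually_elim) (auto simp: indicator_def)
    also have "\<dots> = (\<integral>\<^sup>+x. indicator (bs K) (X (?bw x)) * \<phi> (fst (fst x), ?r x) \<partial>?PN)"
      by (rule nn_integral_completion)
    also have "\<dots> = (\<integral>\<^sup>+x. indicator (V K) (?bw x) * \<phi> (fst (fst x), ?r x) \<partial>?PN)"
      using measurable_space[OF bw] by (intro nn_integral_cong) (auto simp: V_def indicator_def)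
    finally show ?thesis .
  qed
  have [measurable]: "(\<lambda>e. ennreal (ratio e)) \<in> borel_measurable ?R" by (simp add: measurable_from_Rpos)
  have "?R \<in> Pol A C"
    unfolding Pol_def mem_Collect_eq case_prod_unfold
  proof (intro conjI)
    show "distr ?R A fst = A"
    proof (rule measure_eqI)
      fix M assume "M \<in> sets (distr ?R A fst)"
      then have [measurable]: "M \<in> sets A" by simp
      have "emeasure (distr ?R A fst) M = (\<integral>\<^sup>+e. indicator M (fst e) \<partial>?R)"
        by (rule emeasure_distr_eq_nn_integral) auto
      also have "\<dots> = (\<integral>\<^sup>+x. indicator M (fst (fst x)) \<partial>completion ?PN)"
        by (subst nn_integral_distr[OF mR]) auto
      also have "\<dots> = (\<integral>\<^sup>+x. indicator M (fst (fst x)) \<partial>?PN)" by (rule nn_integral_completion)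
      also have "\<dots> = (\<integral>\<^sup>+e. indicator M (fst e) \<partial>P)"
        by (subst noise.nn_integral_fst[symmetric]) (auto simp: noise.emeasure_space_1)
      also have "\<dots> = emeasure A M" by (subst P.nn_integral_source) auto
      finally show "emeasure (distr ?R A fst) M = emeasure A M" .
    qed simp
    show "distr (density ?R (\<lambda>p. ennreal (ratio p))) C (\<lambda>p. tgt p) = C"
    proof (rule measure_eqI)
      fix K assume "K \<in> sets (distr (density ?R (\<lambda>p. ennreal (ratio p))) C (\<lambda>p. tgt p))"
      then have K[measurable]: "K \<in> sets C" by simp
      have "emeasure (distr (density ?R (\<lambda>p. ennreal (ratio p))) C (\<lambda>p. tgt p)) K
        = (\<integral>\<^sup>+e. ennreal (ratio e) * indicator K (tgt e) \<partial>?R)"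
        by (rule emeasure_weighted_image) auto
      also have "\<dots> = (\<integral>\<^sup>+x. indicator (V K) (?bw x) * ennreal (?r x) \<partial>?PN)"
        using Rrep[OF K, of "\<lambda>e. ennreal (snd e)"] by (simp add: mult.commute measurable_from_Rpos)
      also have "\<dots> = (\<integral>\<^sup>+x. indicator (bs K) (X (?bw x)) * ennreal (?r x) \<partial>?PN)"
        using measurable_space[OF bw] by (intro nn_integral_cong) (auto simp: V_def indicator_def)
      also have "\<dots> = (\<integral>\<^sup>+c. indicator (bs K) (f c) \<partial>C)" by (rule targ) simp
      also have "\<dots> = (\<integral>\<^sup>+c. indicator K c \<partial>C)"
        by (rule nn_integral_cong_AE) (use bsC[OF K] in \<open>eventually_elim, auto simp: indicator_def\<close>)
      finally show "emeasure (distr (density ?R (\<lambda>p. ennreal (ratio p))) C (\<lambda>p. tgt p)) K = emeasure C K"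
        by simp
    qed simp
  qed simp
  moreover have "randomized_product A B C P Q ?R T V"
    unfolding randomized_product_def using T V Qrep Rrep by blast
  ultimately show ?thesis by blast
qed

text \<open>A disintegration of \<open>Q\<close> can be read off from the randomization: \<open>q b\<close> is the law of \<open>T (b, w)\<close> restricted
to the event \<open>V K\<close>. It is set to zero at the points where its first moment is infinite.\<close>

lemma randomized_product_is_pol_prod:
  assumes R: "R \<in> Pol A C" and rand: "randomized_product A B C P Q R T V"
  shows "is_pol_prod A B C Q P R"
proof -
  interpret noise: prob_space noise by (rule prob_space_noise)
  interpret R: polymorphism A C R by unfold_locales fact
  interpret B: finite_measure B by (rule B)
  have T[measurable]: "T \<in> B \<Otimes>\<^sub>M noise \<rightarrow>\<^sub>M Rpos" and V[measurable]: "\<And>K. K \<in> sets C \<Longrightarrow> V K \<in> sets (B \<Otimes>\<^sub>M noise)"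
    and Qrep: "\<And>K \<phi>. K \<in> sets C \<Longrightarrow> \<phi> \<in> borel_measurable (B \<Otimes>\<^sub>M Rpos) \<Longrightarrow>
      (\<integral>\<^sup>+e. indicator K (tgt e) * \<phi> (fst e, ratio e) \<partial>Q) = (\<integral>\<^sup>+x. indicator (V K) x * \<phi> (fst x, T x) \<partial>(B \<Otimes>\<^sub>M noise))"
    and Rrep: "\<And>K \<phi>. K \<in> sets C \<Longrightarrow> \<phi> \<in> borel_measurable (A \<Otimes>\<^sub>M Rpos) \<Longrightarrow>
      (\<integral>\<^sup>+e. indicator K (tgt e) * \<phi> (fst e, ratio e) \<partial>R) =
      (\<integral>\<^sup>+x. indicator (V K) (tgt (fst x), snd x) * \<phi> (fst (fst x), ratio (fst x) * T (tgt (fst x), snd x)) \<partial>(P \<Otimes>\<^sub>M noise))"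
    using rand by (auto simp: randomized_product_def)
  have TB[measurable]: "(\<lambda>w. T (b, w)) \<in> noise \<rightarrow>\<^sub>M Rpos" if "b \<in> space B" for b using that by measurable
  have Vb[measurable]: "(\<lambda>w. indicator (V K) (b, w) :: ennreal) \<in> borel_measurable noise"
    if [measurable]: "K \<in> sets C" and b: "b \<in> space B" for K b
  proof -
    have "(\<lambda>w. (b, w)) \<in> noise \<rightarrow>\<^sub>M B \<Otimes>\<^sub>M noise" using b by measurable
    then show ?thesis by (rule measurable_compose) measurable
  qed
  show ?thesis
    unfolding is_pol_prod_def
  proof (intro conjI R ballI)
    fix M K assume M[measurable]: "M \<in> sets A" and K[measurable]: "K \<in> sets C"
    obtain p where p: "is_disintegration B p (\<lambda>N. pol_block P M N)"
      using P.block_disintegration_exists[OF A B(1) M] by blast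
    define good where "good b \<longleftrightarrow> (\<integral>\<^sup>+w. indicator (V K) (b, w) * ennreal (T (b, w)) \<partial>noise) < \<infinity>" for b
    have [measurable]: "Measurable.pred B good" unfolding good_def by measurable
    have "(\<integral>\<^sup>+b. \<integral>\<^sup>+w. indicator (V K) (b, w) * ennreal (T (b, w)) \<partial>noise \<partial>B)
        = (\<integral>\<^sup>+x. indicator (V K) x * ennreal (T x) \<partial>(B \<Otimes>\<^sub>M noise))"
      by (subst noise.nn_integral_fst[symmetric]) auto
    also have "\<dots> = (\<integral>\<^sup>+e. indicator K (tgt e) * ennreal (ratio e) \<partial>Q)"
      using Qrep[OF K, of "\<lambda>e. ennreal (snd e)"] by (simp add: measurable_from_Rpos)
    also have "\<dots> \<le> (\<integral>\<^sup>+e. ennreal (ratio e) \<partial>Q)" by (intro nn_integral_mono) (auto simp: indicator_def)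
    also have "\<dots> < \<infinity>" using C by (simp add: Q.nn_integral_ratio finite_measure.emeasure_finite less_top[symmetric])
    finally have good: "AE b in B. good b"
      using nn_integral_PInf_AE[of "\<lambda>b. \<integral>\<^sup>+w. indicator (V K) (b, w) * ennreal (T (b, w)) \<partial>noise" B]
      by (auto simp: good_def less_top)
    define q where "q b = (if good b then distr (density noise (\<lambda>w. indicator (V K) (b, w))) Rpos (\<lambda>w. T (b, w)) else null_measure Rpos)" for b
    have nnq: "(\<integral>\<^sup>+s. \<phi> s \<partial>q b) = (if good b then \<integral>\<^sup>+w. indicator (V K) (b, w) * \<phi> (T (b, w)) \<partial>noise else 0)"
      if b: "b \<in> space B" and [measurable]: "\<phi> \<in> borel_measurable Rpos" for b \<phi>
      using nn_integral_weighted_image[OF Vb[OF K b] TB[OF b] that(2)] by (simp add: q_def)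
    have sq[simp]: "sets (q b) = sets Rpos" "space (q b) = {0<..}" for b by (auto simp: q_def)
    have emq: "emeasure (q b) S = (if good b then \<integral>\<^sup>+w. indicator (V K) (b, w) * indicator S (T (b, w)) \<partial>noise else 0)"
      if b: "b \<in> space B" and [measurable]: "S \<in> sets Rpos" for b S
      using nnq[OF b, of "indicator S"] by simp
    have kq: "kernel B q"
      unfolding kernel_def
    proof safe
      fix b assume b: "b \<in> space B"
      have top: "{0<..} \<in> sets Rpos" using sets.top[of Rpos] by simp
      have "emeasure (q b) {0<..} \<le> (\<integral>\<^sup>+w. indicator (V K) (b, w) * indicator {0<..} (T (b, w)) \<partial>noise)"
        by (simp add: emq[OF b top])
      also have "\<dots> \<le> (\<integral>\<^sup>+w. 1 \<partial>noise)"
        by (intro nn_integral_mono) (auto simp: indicator_def)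
      finally have "emeasure (q b) (space (q b)) < \<infinity>"
        by (simp add: noise.emeasure_space_1 order_le_less_trans)
      moreover have "(\<integral>\<^sup>+t. ennreal t \<partial>q b) < \<infinity>"
        using b by (subst nnq) (auto simp: measurable_borel_Rpos good_def)
      ultimately show "q b \<in> Mtri" by (simp add: Mtri_def)
    next
      fix S assume [measurable]: "S \<in> sets Rpos"
      have "(\<lambda>b. if good b then \<integral>\<^sup>+w. indicator (V K) (b, w) * indicator S (T (b, w)) \<partial>noise else 0) \<in> borel_measurable B"
        by measurable
      then show "(\<lambda>b. emeasure (q b) S) \<in> borel_measurable B"
        by (rule measurable_cong[THEN iffD2, rotated]) (simp add: emq)
    qed
    have "emeasure (pol_block Q N K) S = (\<integral>\<^sup>+b\<in>N. emeasure (q b) S \<partial>B)"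
      if [measurable]: "N \<in> sets B" "S \<in> sets Rpos" for N S
    proof -
      have "emeasure (pol_block Q N K) S = (\<integral>\<^sup>+e. indicator K (tgt e) * (indicator N (fst e) * indicator S (ratio e)) \<partial>Q)"
        using Q.nn_integral_block[of N K "indicator S"] by (simp add: mult_ac)
      also have "\<dots> = (\<integral>\<^sup>+x. indicator (V K) x * (indicator N (fst x) * indicator S (T x)) \<partial>(B \<Otimes>\<^sub>M noise))"
        using Qrep[OF K, of "\<lambda>e. indicator N (fst e) * indicator S (snd e)"] by simp
      also have "\<dots> = (\<integral>\<^sup>+b. \<integral>\<^sup>+w. indicator (V K) (b, w) * (indicator N b * indicator S (T (b, w))) \<partial>noise \<partial>B)"
        by (subst noise.nn_integral_fst[symmetric]) auto
      also have "\<dots> = (\<integral>\<^sup>+b\<in>N. emeasure (q b) S \<partial>B)"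
      proof (rule nn_integral_cong_AE, use good AE_space in eventually_elim)
        fix b assume b: "good b" "b \<in> space B"
        have "(\<integral>\<^sup>+w. indicator (V K) (b, w) * (indicator N b * indicator S (T (b, w))) \<partial>noise)
          = (\<integral>\<^sup>+w. (indicator (V K) (b, w) * indicator S (T (b, w))) * indicator N b \<partial>noise)"
          by (intro nn_integral_cong) (simp add: mult_ac)
        also have "\<dots> = (\<integral>\<^sup>+w. indicator (V K) (b, w) * indicator S (T (b, w)) \<partial>noise) * indicator N b"
          using b by (intro nn_integral_multc) simp
        finally show "(\<integral>\<^sup>+w. indicator (V K) (b, w) * (indicator N b * indicator S (T (b, w))) \<partial>noise) = emeasure (q b) S * indicator N b"
          using b by (simp add: emq)
      qed
      finally show ?thesis .
    qed
    then have q: "is_disintegration B q (\<lambda>N. pol_block Q N K)"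
      using kq by (auto simp: is_disintegration_def kernel_def)
    have "emeasure (pol_block R M K) S = (\<integral>\<^sup>+b. emeasure (mconv (q b) (p b)) S \<partial>B)"
      if S[measurable]: "S \<in> sets Rpos" for S
    proof -
      have goodP: "AE e in P. good (tgt e)"
      proof -
        from good obtain N where N: "N \<in> null_sets B" "{b\<in>space B. \<not> good b} \<subseteq> N"
          by (auto simp: eventually_ae_filter)
        from P.null_target[OF N(1)] AE_space show ?thesis
          by eventually_elim (use N in \<open>auto simp: P.space_P\<close>)
      qed
      have "(\<integral>\<^sup>+e. \<integral>\<^sup>+w. indicator (V K) (tgt e, w) * (indicator M (fst e) * indicator S (ratio e * T (tgt e, w))) \<partial>noise \<partial>P)
        = (\<integral>\<^sup>+e. indicator M (fst e) * (\<integral>\<^sup>+s. indicator S (ratio e * s) \<partial>q (tgt e)) \<partial>P)"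
      proof (rule nn_integral_cong_AE, use goodP AE_space in eventually_elim)
        fix e assume e: "good (tgt e)" "e \<in> space P"
        then have b: "tgt e \<in> space B" and t: "0 < ratio e" by (auto simp: P.space_P)
        then have [measurable]: "(\<lambda>s. ratio e * s) \<in> Rpos \<rightarrow>\<^sub>M Rpos" by (auto simp: measurable_to_Rpos measurable_borel_Rpos)
        have [measurable]: "(\<lambda>w. ratio e * T (tgt e, w)) \<in> noise \<rightarrow>\<^sub>M Rpos"
          by (rule measurable_compose[OF TB[OF b]]) measurable
        have "(\<integral>\<^sup>+w. indicator (V K) (tgt e, w) * (indicator M (fst e) * indicator S (ratio e * T (tgt e, w))) \<partial>noise)
          = (\<integral>\<^sup>+w. indicator M (fst e) * (indicator (V K) (tgt e, w) * indicator S (ratio e * T (tgt e, w))) \<partial>noise)"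
          by (intro nn_integral_cong) (simp add: mult_ac)
        also have "\<dots> = indicator M (fst e) * (\<integral>\<^sup>+w. indicator (V K) (tgt e, w) * indicator S (ratio e * T (tgt e, w)) \<partial>noise)"
          using b by (intro nn_integral_cmult) simp
        finally show "(\<integral>\<^sup>+w. indicator (V K) (tgt e, w) * (indicator M (fst e) * indicator S (ratio e * T (tgt e, w))) \<partial>noise)
          = indicator M (fst e) * (\<integral>\<^sup>+s. indicator S (ratio e * s) \<partial>q (tgt e))"
          using e(1) b by (subst nnq) auto
      qed
      moreover have "emeasure (pol_block R M K) S = (\<integral>\<^sup>+e. indicator K (tgt e) * (indicator M (fst e) * indicator S (ratio e)) \<partial>R)"
        using R.nn_integral_block[of M K "indicator S"] by (simp add: mult_ac)
      moreover have "\<dots> = (\<integral>\<^sup>+x. indicator (V K) (tgt (fst x), snd x) * (indicator M (fst (fst x)) * indicator S (ratio (fst x) * T (tgt (fst x), snd x))) \<partial>(P \<Otimes>\<^sub>M noise))"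
        using Rrep[OF K, of "\<lambda>e. indicator M (fst e) * indicator S (snd e)"] by simp
      moreover have "\<dots> = (\<integral>\<^sup>+e. \<integral>\<^sup>+w. indicator (V K) (tgt e, w) * (indicator M (fst e) * indicator S (ratio e * T (tgt e, w))) \<partial>noise \<partial>P)"
      proof -
        have bw: "(\<lambda>x. (tgt (fst x), snd x)) \<in> P \<Otimes>\<^sub>M noise \<rightarrow>\<^sub>M B \<Otimes>\<^sub>M noise" by measurable
        note [measurable] = measurable_compose[OF bw T]
        have [measurable]: "(\<lambda>x. indicator (V K) (tgt (fst x), snd x) :: ennreal) \<in> borel_measurable (P \<Otimes>\<^sub>M noise)"
          by (rule measurable_compose[OF bw]) measurable
        show ?thesis by (subst noise.nn_integral_fst[symmetric]) auto
      qed
      ultimately show ?thesis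
        by (simp add: pol_prod_value_source[OF A B P.Pol M S p kq])
    qed
    then show "\<exists>p q. is_disintegration B p (\<lambda>N. pol_block P M N) \<and> is_disintegration B q (\<lambda>N. pol_block Q N K) \<and>
        (\<forall>S\<in>sets Rpos. emeasure (pol_block R M K) S = (\<integral>\<^sup>+b. emeasure (mconv (q b) (p b)) S \<partial>B))"
      using p q by blast
  qed
qed

lemma pol_prod_randomized:
  assumes std: "real_model C f g"
  shows "Q \<circ>\<^bsub>(A,B,C)\<^esub> P \<in> Pol A C" "\<exists>T V. randomized_product A B C P Q (Q \<circ>\<^bsub>(A,B,C)\<^esub> P) T V"
proof -
  obtain R T V where R: "R \<in> Pol A C" "randomized_product A B C P Q R T V"
    using randomized_product_exists[OF std] by blast
  have "Q \<circ>\<^bsub>(A,B,C)\<^esub> P = R"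
    unfolding pol_prod_def using randomized_product_is_pol_prod[OF R] is_pol_prod_unique[OF A B P.Pol Q.Pol]
    by (intro the_equality) auto
  with R show "Q \<circ>\<^bsub>(A,B,C)\<^esub> P \<in> Pol A C" "\<exists>T V. randomized_product A B C P Q (Q \<circ>\<^bsub>(A,B,C)\<^esub> P) T V" by auto
qed

end

section \<open>Real models of Lebesgue spaces and of countable quotients\<close>

text \<open>If the set function in \<open>sum_measure\<close> were not countably additive, \<open>measure_of\<close> would return the zero
measure; in either case a set on which the set function vanishes is null.\<close>

lemma sum_measure_null:
  assumes S: "S \<in> sets M" and T: "T \<in> sets N"
    and eM: "emeasure M S = 0" and eN: "emeasure N T = 0"
  shows "emeasure (sum_measure M N) (S <+> T) = 0"
proof -
  let ?G = "{S <+> T | S T. S \<in> sets M \<and> T \<in> sets N}"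
  have G: "?G \<subseteq> Pow (space M <+> space N)"
    using sets.sets_into_space[of _ M] sets.sets_into_space[of _ N] by fastforce
  have "Inl -` (S <+> T) = S" "Inr -` (S <+> T) = T" by auto
  then have "emeasure M (Inl -` (S <+> T)) + emeasure N (Inr -` (S <+> T)) = 0"
    using eM eN by simp
  then show ?thesis
    unfolding sum_measure_def by (subst emeasure_measure_of_conv) auto
qed

lemma space_sum_measure: "space (sum_measure M N) = space M <+> space N"
proof -
  have "{S <+> T | S T. S \<in> sets M \<and> T \<in> sets N} \<subseteq> Pow (space M <+> space N)"
    using sets.sets_into_space[of _ M] sets.sets_into_space[of _ N] by fastforce
  then show ?thesis unfolding sum_measure_def by (rule space_measure_of)
qed

lemma sets_sum_measureI:
  assumes "S \<in> sets M" "T \<in> sets N" shows "S <+> T \<in> sets (sum_measure M N)"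
proof -
  have "{S <+> T | S T. S \<in> sets M \<and> T \<in> sets N} \<subseteq> Pow (space M <+> space N)"
    using sets.sets_into_space[of _ M] sets.sets_into_space[of _ N] by fastforce
  then show ?thesis unfolding sum_measure_def using assms by (subst sets_measure_of) auto
qed

lemma sets_sum_measureD:
  assumes "U \<in> sets (sum_measure M N)"
  shows "Inl -` U \<in> sets M" "Inr -` U \<in> sets N"
proof -
  have "{S <+> T | S T. S \<in> sets M \<and> T \<in> sets N} \<subseteq> Pow (space M <+> space N)"
    using sets.sets_into_space[of _ M] sets.sets_into_space[of _ N] by fastforce
  then have "U \<in> sigma_sets (space M <+> space N) {S <+> T | S T. S \<in> sets M \<and> T \<in> sets N}"
    using assms unfolding sum_measure_def by (subst (asm) sets_measure_of)
  then have "Inl -` U \<in> sets M \<and> Inr -` U \<in> sets N"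
  proof induction
    case (Basic a)
    then obtain S T where "a = S <+> T" "S \<in> sets M" "T \<in> sets N" by auto
    moreover have "Inl -` (S <+> T) = S" "Inr -` (S <+> T) = T" by auto
    ultimately show ?case by simp
  next
    case (Compl a)
    have "Inl -` (space M <+> space N - a) = space M - Inl -` a"
      "Inr -` (space M <+> space N - a) = space N - Inr -` a" by auto
    with Compl show ?case by (auto intro!: sets.Diff)
  next
    case (Union a)
    then show ?case by (auto simp: vimage_UN)
  qed simp
  then show "Inl -` U \<in> sets M" "Inr -` U \<in> sets N" by auto
qed

text \<open>The points are numbered, and every function on a countable discrete space is measurable.\<close>

lemma real_model_quot:
  assumes X: "countable_partition A X" and ne: "space A \<noteq> {}"
  shows "\<exists>f g. real_model (quot_space A X) f g"
proof -
  have cX: "countable X" and pX: "partition_on (space A) X" using X by (auto simp: countable_partition_def)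
  have Xne: "X \<noteq> {}" using pX ne by (auto simp: partition_on_def)
  let ?C = "quot_space A X" and ?f = "\<lambda>S. real (to_nat_on X S)" and ?g = "\<lambda>y::real. from_nat_into X (nat \<lfloor>y\<rfloor>)"
  have f: "?f \<in> borel_measurable ?C"
    by (simp add: quot_space_def)
  have "from_nat_into X \<in> count_space UNIV \<rightarrow>\<^sub>M ?C"
    using from_nat_into[OF Xne] by (simp add: quot_space_def space_point_measure)
  moreover have "(\<lambda>y::real. nat \<lfloor>y\<rfloor>) \<in> borel \<rightarrow>\<^sub>M count_space UNIV"
    by measurable
  ultimately have "?g \<in> borel \<rightarrow>\<^sub>M ?C" by (rule measurable_compose[rotated])
  then have "?g \<in> completion (distr ?C borel ?f) \<rightarrow>\<^sub>M ?C"
    by (intro measurable_completion) (simp cong: measurable_cong_sets)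
  moreover have "AE c in ?C. ?g (?f c) = c"
    using cX by (intro AE_I2) (simp add: quot_space_def space_point_measure)
  ultimately show ?thesis using f unfolding real_model_def by blast
qed

text \<open>The segment is squeezed into the open unit interval and the atom with index \<open>n\<close> is placed at \<open>n + 1\<close>.
Decoding is measurable up to null sets: a Lebesgue set of the segment differs from a Borel set by a
part of a Borel null set \<open>Z'\<close>, and \<open>Z'\<close> is null for the image of \<open>C\<close> because the isomorphism preserves
the measure.\<close>

lemma real_model_lebesgue:
  assumes C: "lebesgue_space C"
  shows "\<exists>f g. real_model C f g"
proof -
  from C obtain a b I w where pos: "emeasure C (space C) > 0"
    and iso: "iso_mod0 (completion C) (lebesgue_model a b I w)" by (auto simp: lebesgue_space_def)
  define L where "L = lebesgue_model a b I w"
  from iso obtain M' N' f g where M': "M' \<in> sets (completion C)" "space C - M' \<in> null_sets (completion C)"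
    and N': "N' \<in> sets L" and f: "f \<in> restrict_space (completion C) M' \<rightarrow>\<^sub>M restrict_space L N'"
    and g: "g \<in> restrict_space L N' \<rightarrow>\<^sub>M restrict_space (completion C) M'"
    and gf: "\<And>x. x \<in> M' \<Longrightarrow> g (f x) = x"
    and d: "distr (restrict_space (completion C) M') (restrict_space L N') f = restrict_space L N'"
    unfolding iso_mod0_def L_def[symmetric] by auto
  have spL: "space L = {a..b} <+> I"
    by (simp add: L_def lebesgue_model_def space_sum_measure space_point_measure)
  have M'sp: "M' \<subseteq> space C" using sets.sets_into_space[OF M'(1)] by simp
  have N'sp: "N' \<subseteq> space L" using sets.sets_into_space[OF N'] .
  define enc where "enc z = (case z of Inl x \<Rightarrow> to_unit x | Inr n \<Rightarrow> real n + 1)" for z :: "real + nat"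
  define dec :: "real \<Rightarrow> real + nat" where "dec y = (if 0 < y \<and> y < 1 then Inl (from_unit y) else Inr (nat (\<lfloor>y\<rfloor> - 1)))" for y
  have dec_enc: "dec (enc z) = z" for z
    by (cases z) (auto simp: enc_def dec_def to_unit from_to_unit)
  have enc: "enc \<in> borel_measurable L"
  proof (rule measurableI)
    fix S :: "real set" assume S: "S \<in> sets borel"
    have "{a..b} \<inter> to_unit -` S \<in> sets borel" using measurable_sets_borel[OF to_unit_measurable S] by simp
    then have "{a..b} \<inter> to_unit -` S \<in> sets (lebesgue_on {a..b})"
      by (auto simp: sets_restrict_space intro!: image_eqI[of _ _ "to_unit -` S"] sets_completionI_sets measurable_sets_borel[OF to_unit_measurable] S)
    then have "({a..b} \<inter> to_unit -` S) <+> {n\<in>I. real n + 1 \<in> S} \<in> sets L"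
      unfolding L_def lebesgue_model_def by (rule sets_sum_measureI) (auto simp: sets_point_measure)
    also have "({a..b} \<inter> to_unit -` S) <+> {n\<in>I. real n + 1 \<in> S} = enc -` S \<inter> space L"
      by (auto simp: enc_def spL split: sum.splits)
    finally show "enc -` S \<inter> space L \<in> sets L" .
  qed simp
  define f1 where "f1 c = (if c \<in> M' then enc (f c) else 0)" for c
  have fM': "c \<in> M' \<Longrightarrow> f c \<in> N'" for c
    using measurable_space[OF f] M'sp N'sp by (auto simp: space_restrict_space)
  have "(\<lambda>c. enc (f c)) \<in> borel_measurable (restrict_space (completion C) M')"
    using f by (rule measurable_compose) (rule measurable_restrict_space1[OF enc])
  then have "f1 \<in> borel_measurable (completion C)"
    unfolding f1_def by (subst measurable_restrict_space_iff[symmetric]) (use M' M'sp in \<open>auto simp: Int_absorb2\<close>)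
  from completion_ex_borel_measurable_real[OF this] obtain f2 where f2: "f2 \<in> borel_measurable C"
    and f12: "AE c in C. f1 c = f2 c" by blast
  let ?D = "distr C borel f2"
  have inM: "AE c in C. c \<in> M'"
  proof -
    have "AE c in completion C. c \<in> M'"
      using AE_not_in[OF M'(2)] AE_space by eventually_elim auto
    then show ?thesis by (simp add: AE_completion_iff)
  qed
  have dec_meas: "dec -` U \<in> sets (completion ?D)" if U: "U \<in> sets L" for U
  proof -
    have UL: "Inl -` U \<in> sets (lebesgue_on {a..b})"
      using sets_sum_measureD(1)[OF U[unfolded L_def lebesgue_model_def]] .
    then have leb: "Inl -` U \<in> sets lebesgue" by (auto simp: sets_restrict_space intro!: sets.Int)
    have sub: "Inl -` U \<subseteq> {a..b}" using sets.sets_into_space[OF UL] by simp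
    from leb obtain S Z Z' where Z: "Inl -` U = S \<union> Z" "Z \<subseteq> Z'" "Z' \<in> null_sets lborel" "S \<in> sets lborel"
      by (rule sets_completionE)
    have [measurable]: "S \<in> sets borel" "Z' \<in> sets borel" using Z by auto
    let ?I = "{y. 0 < y \<and> y < (1::real)}"
    have A: "{y\<in>?I. from_unit y \<in> S} \<in> sets borel" by measurable
    have B: "{y\<in>?I. from_unit y \<in> Z'} \<in> sets borel" by measurable
    have "(\<lambda>y::real. nat (\<lfloor>y\<rfloor> - 1)) \<in> borel \<rightarrow>\<^sub>M count_space UNIV" by measurable
    then have C: "{y. y \<notin> ?I \<and> Inr (nat (\<lfloor>y\<rfloor> - 1)) \<in> U} \<in> sets borel"
      by measurable
    have "emeasure ?D {y\<in>?I. from_unit y \<in> Z'} = emeasure C (f2 -` {y\<in>?I. from_unit y \<in> Z'} \<inter> space C)"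
      using B f2 by (intro emeasure_distr) auto
    also have "\<dots> = emeasure (completion C) (f2 -` {y\<in>?I. from_unit y \<in> Z'} \<inter> space C)"
      using B measurable_sets[OF f2, of "{y\<in>?I. from_unit y \<in> Z'}"]
      by (subst emeasure_completion) (auto simp: main_part_sets)
    also have "\<dots> = emeasure (completion C) (f -` ((Z' \<inter> {a..b} <+> {}) \<inter> N') \<inter> M')"
    proof (rule emeasure_eq_AE)
      show "f2 -` {y\<in>?I. from_unit y \<in> Z'} \<inter> space C \<in> sets (completion C)"
        using B measurable_sets[OF f2, of "{y\<in>?I. from_unit y \<in> Z'}"] by auto
      have "Z' \<inter> {a..b} <+> {} \<in> sets L"
        unfolding L_def lebesgue_model_def
        by (rule sets_sum_measureI) (auto simp: sets_restrict_space intro!: image_eqI[of _ _ Z'] sets_completionI_sets)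
      then have "(Z' \<inter> {a..b} <+> {}) \<inter> N' \<in> sets (restrict_space L N')"
        using N' by (auto simp: sets_restrict_space)
      from measurable_sets[OF f this] show "f -` ((Z' \<inter> {a..b} <+> {}) \<inter> N') \<inter> M' \<in> sets (completion C)"
        using M' M'sp by (subst (asm) sets_restrict_space_iff) (auto simp: space_restrict_space Int_absorb2)
      have "AE c in C. (c \<in> f2 -` {y\<in>?I. from_unit y \<in> Z'} \<inter> space C) = (c \<in> f -` ((Z' \<inter> {a..b} <+> {}) \<inter> N') \<inter> M')"
        using inM f12
      proof eventually_elim
        case (elim c)
        then have c: "c \<in> M'" "f2 c = enc (f c)" "f c \<in> N'" "c \<in> space C" using fM' M'sp by (auto simp: f1_def)
        moreover have "f c \<in> {a..b} <+> I" using c N'sp spL by auto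
        ultimately show ?case
          by (cases "f c") (auto simp: enc_def to_unit from_to_unit)
      qed
      then show "AE c in completion C. (c \<in> f2 -` {y\<in>?I. from_unit y \<in> Z'} \<inter> space C) = (c \<in> f -` ((Z' \<inter> {a..b} <+> {}) \<inter> N') \<inter> M')"
        by (rule AE_completion)
    qed
    also have "\<dots> = emeasure L ((Z' \<inter> {a..b} <+> {}) \<inter> N')"
    proof -
      have Z'L: "Z' \<inter> {a..b} <+> {} \<in> sets L"
        unfolding L_def lebesgue_model_def
        by (rule sets_sum_measureI) (auto simp: sets_restrict_space intro!: image_eqI[of _ _ Z'] sets_completionI_sets)
      then have W: "(Z' \<inter> {a..b} <+> {}) \<inter> N' \<in> sets (restrict_space L N')"
        using N' by (auto simp: sets_restrict_space)
      have "emeasure L ((Z' \<inter> {a..b} <+> {}) \<inter> N') = emeasure (restrict_space L N') ((Z' \<inter> {a..b} <+> {}) \<inter> N')"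
        using N' N'sp by (intro emeasure_restrict_space[symmetric]) (auto simp: Int_absorb2)
      also have "\<dots> = emeasure (restrict_space (completion C) M') (f -` ((Z' \<inter> {a..b} <+> {}) \<inter> N') \<inter> space (restrict_space (completion C) M'))"
        by (subst d[symmetric], rule emeasure_distr[OF f W])
      also have "\<dots> = emeasure (completion C) (f -` ((Z' \<inter> {a..b} <+> {}) \<inter> N') \<inter> M')"
        using M' M'sp by (subst emeasure_restrict_space) (auto simp: space_restrict_space Int_absorb2)
      finally show ?thesis by simp
    qed
    also have "\<dots> \<le> emeasure L (Z' \<inter> {a..b} <+> {})"
      unfolding L_def lebesgue_model_def
      by (intro emeasure_mono sets_sum_measureI) (auto simp: sets_restrict_space intro!: image_eqI[of _ _ Z'] sets_completionI_sets)
    also have "\<dots> = 0"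
      unfolding L_def lebesgue_model_def
    proof (rule sum_measure_null)
      show "Z' \<inter> {a..b} \<in> sets (lebesgue_on {a..b})"
        by (auto simp: sets_restrict_space intro!: image_eqI[of _ _ Z'] sets_completionI_sets)
      have "emeasure (lebesgue_on {a..b}) (Z' \<inter> {a..b}) = emeasure lebesgue (Z' \<inter> {a..b})"
        by (intro emeasure_restrict_space) auto
      also have "\<dots> \<le> emeasure lebesgue Z'" by (intro emeasure_mono) auto
      also have "\<dots> = 0" using Z(3) by (simp add: null_sets_def)
      finally show "emeasure (lebesgue_on {a..b}) (Z' \<inter> {a..b}) = 0" by simp
    qed auto
    finally have null: "{y\<in>?I. from_unit y \<in> Z'} \<in> null_sets ?D" using B by (auto simp: null_sets_def)
    have eq: "dec -` U = ({y\<in>?I. from_unit y \<in> S} \<union> {y. y \<notin> ?I \<and> Inr (nat (\<lfloor>y\<rfloor> - 1)) \<in> U}) \<union> {y\<in>?I. from_unit y \<in> Z}"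
      using Z(1) by (auto simp: dec_def split: if_splits)
    show ?thesis
      by (rule sets_completionI[OF eq _ null]) (use Z(2) A C in auto)
  qed
  obtain c0 where c0: "c0 \<in> space C" using pos by (metis emeasure_empty ex_in_conv less_irrefl)
  define g2 where "g2 y = (if dec y \<in> N' then g (dec y) else c0)" for y
  have gN': "z \<in> N' \<Longrightarrow> g z \<in> M'" for z
    using measurable_space[OF g] M'sp N'sp by (auto simp: space_restrict_space)
  have "g2 \<in> completion ?D \<rightarrow>\<^sub>M C"
  proof (rule measurableI)
    show "g2 y \<in> space C" for y using gN' M'sp c0 by (auto simp: g2_def)
    fix K assume K: "K \<in> sets C"
    then have "K \<inter> M' \<in> sets (restrict_space (completion C) M')"
      using M' by (auto simp: sets_restrict_space intro!: image_eqI[of _ _ K])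
    from measurable_sets[OF g this] have GK: "g -` (K \<inter> M') \<inter> N' \<in> sets L"
      using N' N'sp by (subst (asm) sets_restrict_space_iff) (auto simp: space_restrict_space Int_absorb2)
    have "g2 -` K = dec -` (g -` (K \<inter> M') \<inter> N') \<union> (if c0 \<in> K then space (completion ?D) - dec -` N' else {})"
      using gN' by (auto simp: g2_def split: if_splits)
    also have "\<dots> \<in> sets (completion ?D)"
      using sets.Un[OF dec_meas[OF GK] sets.compl_sets[OF dec_meas[OF N']]] dec_meas[OF GK] by simp
    finally show "g2 -` K \<inter> space (completion ?D) \<in> sets (completion ?D)" by simp
  qed
  moreover have "AE c in C. g2 (f2 c) = c"
    using inM f12
  proof eventually_elim
    case (elim c)
    then have "dec (f2 c) = f c" using dec_enc[of "f c"] by (simp add: f1_def)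
    with elim show ?case using fM'[of c] by (simp add: g2_def gf)
  qed
  ultimately show ?thesis using f2 unfolding real_model_def by blast
qed

section \<open>Mellin transforms of polymorphisms\<close>

lemma integrable_indicator_complex:
  assumes "M \<in> sets A" "emeasure A M < \<infinity>"
  shows "integrable A (indicator M :: 'a \<Rightarrow> complex)"
proof -
  have "integrable A (\<lambda>x. complex_of_real (indicator M x))"
    using assms by (intro integrable_of_real integrable_real_indicator)
  moreover have "(\<lambda>x. complex_of_real (indicator M x)) = indicator M" by (auto simp: indicator_def)
  ultimately show ?thesis by simp
qed

text \<open>The power \<open>t\<^sup>z\<close>, with \<open>z = 1 + \<i> l\<close> if \<open>v\<close> is true and \<open>z = \<i> l\<close> otherwise.\<close>

definition mellin :: "bool \<Rightarrow> real \<Rightarrow> real \<Rightarrow> complex" where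
  "mellin v l t = complex_of_real (if v then t else 1) * iexp (l * ln t)"

lemma mellin_measurable[measurable]: "mellin v l \<in> borel_measurable borel"
  unfolding mellin_def by measurable

lemma mellin_mult: "0 < s \<Longrightarrow> 0 < t \<Longrightarrow> mellin v l (s * t) = mellin v l s * mellin v l t"
  by (simp add: mellin_def ln_mult distrib_left exp_add)

lemma norm_mellin: "0 < t \<Longrightarrow> norm (mellin v l t) = (if v then t else 1)"
  by (simp add: mellin_def norm_mult)

lemma mellin_1[simp]: "mellin v l 1 = 1"
  by (simp add: mellin_def)

lemma mellin_meas_Rpos[measurable (raw)]:
  "f \<in> M \<rightarrow>\<^sub>M Rpos \<Longrightarrow> (\<lambda>x. mellin v l (f x)) \<in> borel_measurable M"
  by (rule measurable_compose[OF measurable_from_Rpos mellin_measurable])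

text \<open>The operator of \<open>P\<close> for \<open>z = \<i> l\<close>. Here \<open>\<bar>t\<^sup>z\<bar> = 1\<close>, and the image of \<open>P\<close> in \<open>A\<close> is \<open>A\<close>, so this is the
direction in which \<open>L\<^sup>1\<close> norms are controlled.\<close>

definition mellin_fwd :: "'a measure \<Rightarrow> 'b measure \<Rightarrow> ('a \<times> 'b \<times> real) measure \<Rightarrow> real \<Rightarrow> ('a \<Rightarrow> complex) \<Rightarrow> ('b \<Rightarrow> complex) \<Rightarrow> bool" where
  "mellin_fwd A B P l = coupling_op P fst (\<lambda>e. tgt e) (\<lambda>e. mellin False l (ratio e)) A B"

text \<open>The transposed operator of \<open>P\<close> for \<open>z = 1 + \<i> l\<close>. Here \<open>\<bar>t\<^sup>z\<bar> = t\<close>, and the image of \<open>t P\<close> in \<open>B\<close> is \<open>B\<close>,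
so \<open>L\<^sup>1\<close> norms are controlled from \<open>B\<close> to \<open>A\<close>.\<close>

definition mellin_bwd :: "'a measure \<Rightarrow> 'b measure \<Rightarrow> ('a \<times> 'b \<times> real) measure \<Rightarrow> real \<Rightarrow> ('b \<Rightarrow> complex) \<Rightarrow> ('a \<Rightarrow> complex) \<Rightarrow> bool" where
  "mellin_bwd A B P l = coupling_op P (\<lambda>e. tgt e) fst (\<lambda>e. mellin True l (ratio e)) B A"

context polymorphism
begin

lemma coupling_fwd:
  assumes B: "finite_measure B"
  shows "coupling P fst (\<lambda>e. tgt e) (\<lambda>e. mellin False l (ratio e)) A B"
proof (rule coupling.intro)
  show "(\<integral>\<^sup>+ e. \<phi> (fst e) * ennreal (cmod (mellin False l (ratio e))) \<partial>P) = integral\<^sup>N A \<phi>"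
    if "\<phi> \<in> borel_measurable A" for \<phi>
    unfolding nn_integral_source[OF that, symmetric]
    by (intro nn_integral_cong) (simp add: space_P norm_mellin mem_Times_iff)
qed (use B null_target in auto)

lemma coupling_bwd:
  assumes A: "finite_measure A"
  shows "coupling P (\<lambda>e. tgt e) fst (\<lambda>e. mellin True l (ratio e)) B A"
proof (rule coupling.intro)
  show "(\<integral>\<^sup>+ e. \<phi> (tgt e) * ennreal (cmod (mellin True l (ratio e))) \<partial>P) = integral\<^sup>N B \<phi>"
    if "\<phi> \<in> borel_measurable B" for \<phi>
    unfolding nn_integral_target[OF that, symmetric]
    by (intro nn_integral_cong) (auto simp add: space_P norm_mellin)
qed (use A null_source in auto)

lemma fwd_contraction: "finite_measure B \<Longrightarrow> L1_contraction A B (mellin_fwd A B P l)"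
  unfolding mellin_fwd_def by (rule coupling.L1_contraction_op[OF coupling_fwd])

lemma bwd_contraction: "finite_measure A \<Longrightarrow> L1_contraction B A (mellin_bwd A B P l)"
  unfolding mellin_bwd_def by (rule coupling.L1_contraction_op[OF coupling_bwd])

lemma integrable_mellin:
  assumes A: "finite_measure A" and B: "finite_measure B"
  shows "integrable P (\<lambda>e. mellin v l (ratio e))"
proof (rule integrableI_bounded)
  have "(\<integral>\<^sup>+e. ennreal (norm (mellin v l (ratio e))) \<partial>P) = (\<integral>\<^sup>+e. (if v then ennreal (ratio e) else 1) \<partial>P)"
    by (intro nn_integral_cong) (auto simp: space_P norm_mellin)
  also have "\<dots> < \<infinity>"
    using A B by (cases v) (auto simp: nn_integral_ratio emeasure_space_P finite_measure.emeasure_finite less_top[symmetric])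
  finally show "(\<integral>\<^sup>+e. ennreal (norm (mellin v l (ratio e))) \<partial>P) < \<infinity>" .
qed measurable

lemma integrable_mellin_indicator:
  assumes A: "finite_measure A" and B: "finite_measure B" and [measurable]: "M \<in> sets A" "N \<in> sets B"
  shows "integrable P (\<lambda>e. indicator M (fst e) * indicator N (tgt e) * mellin v l (ratio e))"
  by (rule Bochner_Integration.integrable_bound[OF integrable_mellin[OF A B, of v l]]) (auto simp: indicator_def)

end

lemma integral_weighted_image:
  fixes f :: "'l \<Rightarrow> complex"
  assumes w: "(\<lambda>e. indicator (W e) (c e) :: real) \<in> borel_measurable m" and g: "g \<in> m \<rightarrow>\<^sub>M L" and f: "f \<in> borel_measurable L"
    and \<kappa>: "\<kappa> = distr (density m (\<lambda>e. indicator (W e) (c e))) L g"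
  shows "(\<integral>x. f x \<partial>\<kappa>) = (\<integral>e. indicator (W e) (c e) * f (g e) \<partial>m)"
    and "integrable \<kappa> f \<longleftrightarrow> integrable m (\<lambda>e. indicator (W e) (c e) * f (g e))"
proof -
  have \<kappa>': "\<kappa> = distr (density m (\<lambda>e. ennreal (indicator (W e) (c e)))) L g"
    unfolding \<kappa> by (simp add: ennreal_indicator)
  have eq: "indicator (W e) (c e) *\<^sub>R f (g e) = indicator (W e) (c e) * f (g e)" for e
    by (simp add: indicator_def)
  have g': "g \<in> density m (\<lambda>e. ennreal (indicator (W e) (c e))) \<rightarrow>\<^sub>M L" using g by simp
  have fg: "(\<lambda>e. f (g e)) \<in> borel_measurable m" using measurable_compose[OF g f] .
  show "(\<integral>x. f x \<partial>\<kappa>) = (\<integral>e. indicator (W e) (c e) * f (g e) \<partial>m)"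
    unfolding \<kappa>' integral_distr[OF g' f] by (subst integral_density[OF fg w]) (auto simp: eq)
  show "integrable \<kappa> f \<longleftrightarrow> integrable m (\<lambda>e. indicator (W e) (c e) * f (g e))"
    unfolding \<kappa>' integrable_distr_eq[OF g' f] by (subst integrable_density[OF fg w]) (auto simp: eq)
qed

context composable
begin

text \<open>The function \<open>g b = E[t\<^sup>z; c \<in> K | b]\<close> is the conditional Mellin transform of \<open>Q\<close> given \<open>b\<close>. Since
\<open>(t s)\<^sup>z = t\<^sup>z s\<^sup>z\<close>, integrating out the randomness first in the randomized product leaves the integral
of \<open>t\<^sup>z g\<close> over \<open>P\<close>.\<close>

lemma product_transform:
  assumes R: "R \<in> Pol A C" and rand: "randomized_product A B C P Q R T V" and K[measurable]: "K \<in> sets C"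
  shows "\<exists>g. integrable B g \<and> (\<not> v \<longrightarrow> (\<forall>b\<in>space B. norm (g b) \<le> 1)) \<and>
    (\<forall>N\<in>sets B. (\<integral>e. indicator K (tgt e) * mellin v l (ratio e) * indicator N (fst e) \<partial>Q) = (\<integral>b. g b * indicator N b \<partial>B)) \<and>
    (\<forall>M\<in>sets A. integrable P (\<lambda>e. indicator M (fst e) * mellin v l (ratio e) * g (tgt e)) \<and>
      (\<integral>e. indicator M (fst e) * indicator K (tgt e) * mellin v l (ratio e) \<partial>R) =
      (\<integral>e. indicator M (fst e) * mellin v l (ratio e) * g (tgt e) \<partial>P))"
proof -
  interpret noise: prob_space noise by (rule prob_space_noise)
  interpret R: polymorphism A C R by unfold_locales fact
  interpret B: finite_measure B by (rule B)
  interpret P': finite_measure P by (rule P.finite_P[OF A])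
  interpret BN: pair_sigma_finite B noise ..
  interpret PN: pair_sigma_finite P noise ..
  let ?u = "mellin v l" and ?PN = "P \<Otimes>\<^sub>M noise" and ?BN = "B \<Otimes>\<^sub>M noise"
  let ?bw = "\<lambda>x::(('a \<times> 'b \<times> real) \<times> real \<times> real). (tgt (fst x), snd x)"
  have T[measurable]: "T \<in> ?BN \<rightarrow>\<^sub>M Rpos" and V[measurable]: "V K \<in> sets ?BN"
    and Qrep: "\<And>\<phi>. \<phi> \<in> borel_measurable (B \<Otimes>\<^sub>M Rpos) \<Longrightarrow>
      (\<integral>\<^sup>+e. indicator K (tgt e) * \<phi> (fst e, ratio e) \<partial>Q) = (\<integral>\<^sup>+x. indicator (V K) x * \<phi> (fst x, T x) \<partial>?BN)"
    and Rrep: "\<And>\<phi>. \<phi> \<in> borel_measurable (A \<Otimes>\<^sub>M Rpos) \<Longrightarrow>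
      (\<integral>\<^sup>+e. indicator K (tgt e) * \<phi> (fst e, ratio e) \<partial>R) =
      (\<integral>\<^sup>+x. indicator (V K) (?bw x) * \<phi> (fst (fst x), ratio (fst x) * T (?bw x)) \<partial>?PN)"
    using rand K by (auto simp: randomized_product_def)
  have bw[measurable]: "?bw \<in> ?PN \<rightarrow>\<^sub>M ?BN" by measurable
  have Tbw[measurable]: "(\<lambda>x. T (?bw x)) \<in> ?PN \<rightarrow>\<^sub>M Rpos"
    by (rule measurable_compose[OF bw T])
  let ?r = "\<lambda>x. ratio (fst x) * T (?bw x)"
  have r[measurable]: "?r \<in> ?PN \<rightarrow>\<^sub>M Rpos" by measurable
  have Vbw[measurable]: "(\<lambda>x. indicator (V K) (?bw x) :: real) \<in> borel_measurable ?PN"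
    by (rule measurable_compose[OF bw]) measurable
  have Vbwe[measurable]: "(\<lambda>x. indicator (V K) (?bw x) :: ennreal) \<in> borel_measurable ?PN"
    by (rule measurable_compose[OF bw]) measurable
  \<comment> \<open>The two defining identities, for nonnegative functions, as equalities of measures; in this form they
    apply to complex integrands.\<close>
  have sliceQ: "Q.target_slice K = distr (density ?BN (indicator (V K))) (B \<Otimes>\<^sub>M Rpos) (\<lambda>x. (fst x, T x))"
  proof (rule measure_eqI)
    fix E assume "E \<in> sets (Q.target_slice K)"
    then have [measurable]: "E \<in> sets (B \<Otimes>\<^sub>M Rpos)" by simp
    have "emeasure (Q.target_slice K) E = (\<integral>\<^sup>+e. indicator K (tgt e) * indicator E (fst e, ratio e) \<partial>Q)"
      unfolding Q.target_slice_def by (rule emeasure_weighted_image) measurable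
    also have "\<dots> = emeasure (distr (density ?BN (indicator (V K))) (B \<Otimes>\<^sub>M Rpos) (\<lambda>x. (fst x, T x))) E"
      by (subst emeasure_weighted_image) (auto intro!: Qrep)
    finally show "emeasure (Q.target_slice K) E = \<dots>" .
  qed simp
  have sliceR: "R.target_slice K = distr (density ?PN (\<lambda>x. indicator (V K) (?bw x))) (A \<Otimes>\<^sub>M Rpos) (\<lambda>x. (fst (fst x), ?r x))"
  proof (rule measure_eqI)
    fix E assume "E \<in> sets (R.target_slice K)"
    then have [measurable]: "E \<in> sets (A \<Otimes>\<^sub>M Rpos)" by simp
    have "emeasure (R.target_slice K) E = (\<integral>\<^sup>+e. indicator K (tgt e) * indicator E (fst e, ratio e) \<partial>R)"
      unfolding R.target_slice_def by (rule emeasure_weighted_image) measurable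
    also have "\<dots> = emeasure (distr (density ?PN (\<lambda>x. indicator (V K) (?bw x))) (A \<Otimes>\<^sub>M Rpos) (\<lambda>x. (fst (fst x), ?r x))) E"
      by (subst emeasure_weighted_image) (auto intro!: Rrep)
    finally show "emeasure (R.target_slice K) E = \<dots>" .
  qed simp
  have Qint: "(\<integral>e. indicator K (tgt e) * \<phi> (fst e, ratio e) \<partial>Q) = (\<integral>x. indicator (V K) x * \<phi> (fst x, T x) \<partial>?BN)"
      "integrable Q (\<lambda>e. indicator K (tgt e) * \<phi> (fst e, ratio e)) \<longleftrightarrow> integrable ?BN (\<lambda>x. indicator (V K) x * \<phi> (fst x, T x))"
    if [measurable]: "\<phi> \<in> borel_measurable (B \<Otimes>\<^sub>M Rpos)" for \<phi> :: "'b \<times> real \<Rightarrow> complex"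
    using integral_weighted_image[OF _ _ that Q.target_slice_def[of K]] integral_weighted_image[OF _ _ that sliceQ]
    by auto
  have Rint: "(\<integral>e. indicator K (tgt e) * \<phi> (fst e, ratio e) \<partial>R) = (\<integral>x. indicator (V K) (?bw x) * \<phi> (fst (fst x), ?r x) \<partial>?PN)"
      "integrable R (\<lambda>e. indicator K (tgt e) * \<phi> (fst e, ratio e)) \<longleftrightarrow> integrable ?PN (\<lambda>x. indicator (V K) (?bw x) * \<phi> (fst (fst x), ?r x))"
    if [measurable]: "\<phi> \<in> borel_measurable (A \<Otimes>\<^sub>M Rpos)" for \<phi> :: "'a \<times> real \<Rightarrow> complex"
    using integral_weighted_image[OF _ _ that R.target_slice_def[of K]] integral_weighted_image[OF _ _ that sliceR]
    by auto
  define g where "g b = (\<integral>w. indicator (V K) (b, w) * ?u (T (b, w)) \<partial>noise)" for b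
  have iQ: "integrable Q (\<lambda>e. indicator K (tgt e) * (?u (ratio e) * indicator N (fst e)))" if "N \<in> sets B" for N
    using Q.integrable_mellin_indicator[OF B(1) C that K, of v l] by (simp add: mult_ac)
  have iBN: "integrable ?BN (\<lambda>x. indicator (V K) x * (?u (T x) * indicator N (fst x)))" if [measurable]: "N \<in> sets B" for N
    using iQ[OF that] Qint(2)[of "\<lambda>e. ?u (snd e) * indicator N (fst e)"] by simp
  have iBN0: "integrable ?BN (\<lambda>x. indicator (V K) x * ?u (T x))"
    using iBN[OF sets.top] by (rule Bochner_Integration.integrable_cong[THEN iffD1, rotated 2]) (auto simp: space_pair_measure)
  have g1: "integrable B g" unfolding g_def using BN.integrable_fst'[OF iBN0] by simp
  have g2: "norm (g b) \<le> 1" if "\<not> v" and b: "b \<in> space B" for b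
  proof -
    have Tb[measurable]: "(\<lambda>w. T (b, w)) \<in> noise \<rightarrow>\<^sub>M Rpos" using b by measurable
    have "(\<lambda>w. (b, w)) \<in> noise \<rightarrow>\<^sub>M ?BN" using b by measurable
    then have Vb[measurable]: "(\<lambda>w. indicator (V K) (b, w) :: complex) \<in> borel_measurable noise"
      by (rule measurable_compose) measurable
    have bd: "norm (indicator (V K) (b, w) * ?u (T (b, w))) \<le> 1" if "w \<in> space noise" for w
      using measurable_space[OF Tb that] \<open>\<not> v\<close> by (auto simp: norm_mult norm_mellin indicator_def)
    have "norm (g b) \<le> (\<integral>w. norm (indicator (V K) (b, w) * ?u (T (b, w))) \<partial>noise)"
      unfolding g_def by (rule integral_norm_bound)
    also have "\<dots> \<le> 1"
    proof (rule noise.integral_le_const)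
      show "integrable noise (\<lambda>w. norm (indicator (V K) (b, w) * ?u (T (b, w))))"
        using bd by (intro integrable_norm noise.integrable_const_bound[of _ 1] AE_I2) measurable
      show "AE w in noise. norm (indicator (V K) (b, w) * ?u (T (b, w))) \<le> 1"
        using bd by (intro AE_I2)
    qed
    finally show ?thesis .
  qed
  have g3: "(\<integral>e. indicator K (tgt e) * ?u (ratio e) * indicator N (fst e) \<partial>Q) = (\<integral>b. g b * indicator N b \<partial>B)"
    if [measurable]: "N \<in> sets B" for N
  proof -
    have "(\<integral>e. indicator K (tgt e) * ?u (ratio e) * indicator N (fst e) \<partial>Q)
      = (\<integral>x. indicator (V K) x * (?u (T x) * indicator N (fst x)) \<partial>?BN)"
      using Qint(1)[of "\<lambda>e. ?u (snd e) * indicator N (fst e)"] by (simp add: mult.assoc)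
    also have "\<dots> = (\<integral>b. \<integral>w. indicator (V K) (b, w) * ?u (T (b, w)) * indicator N b \<partial>noise \<partial>B)"
      using BN.integral_fst'[OF iBN[OF that]] by (simp add: mult.assoc)
    also have "\<dots> = (\<integral>b. g b * indicator N b \<partial>B)"
      by (simp add: g_def)
    finally show ?thesis .
  qed
  have g4: "integrable P (\<lambda>e. indicator M (fst e) * ?u (ratio e) * g (tgt e)) \<and>
      (\<integral>e. indicator M (fst e) * indicator K (tgt e) * ?u (ratio e) \<partial>R) =
      (\<integral>e. indicator M (fst e) * ?u (ratio e) * g (tgt e) \<partial>P)"
    if [measurable]: "M \<in> sets A" for M
  proof -
    have "integrable R (\<lambda>e. indicator K (tgt e) * (indicator M (fst e) * ?u (ratio e)))"
      using R.integrable_mellin_indicator[OF A C that K, of v l] by (simp add: mult_ac)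
    then have iPN: "integrable ?PN (\<lambda>x. indicator (V K) (?bw x) * (indicator M (fst (fst x)) * ?u (?r x)))"
      using Rint(2)[of "\<lambda>e. indicator M (fst e) * ?u (snd e)"] by simp
    have inner: "(\<integral>w. indicator (V K) (tgt e, w) * (indicator M (fst e) * ?u (ratio e * T (tgt e, w))) \<partial>noise)
      = indicator M (fst e) * ?u (ratio e) * g (tgt e)" if e: "e \<in> space P" for e
    proof -
      have b: "tgt e \<in> space B" and t: "0 < ratio e" using e by (auto simp: P.space_P)
      have Tb: "(\<lambda>w. T (tgt e, w)) \<in> noise \<rightarrow>\<^sub>M Rpos" using b by measurable
      have "?u (ratio e * T (tgt e, w)) = ?u (ratio e) * ?u (T (tgt e, w))" if "w \<in> space noise" for w
        using t measurable_space[OF Tb that] by (intro mellin_mult) auto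
      then have "(\<integral>w. indicator (V K) (tgt e, w) * (indicator M (fst e) * ?u (ratio e * T (tgt e, w))) \<partial>noise)
        = (\<integral>w. indicator M (fst e) * ?u (ratio e) * (indicator (V K) (tgt e, w) * ?u (T (tgt e, w))) \<partial>noise)"
        by (intro Bochner_Integration.integral_cong) (auto simp: mult_ac)
      then show ?thesis by (simp add: g_def)
    qed
    have "integrable P (\<lambda>e. indicator M (fst e) * ?u (ratio e) * g (tgt e))"
      using PN.integrable_fst'[OF iPN] by (rule Bochner_Integration.integrable_cong[THEN iffD1, rotated 2]) (simp_all add: inner)
    moreover have "(\<integral>e. indicator M (fst e) * indicator K (tgt e) * ?u (ratio e) \<partial>R)
      = (\<integral>x. indicator (V K) (?bw x) * (indicator M (fst (fst x)) * ?u (?r x)) \<partial>?PN)"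
      using Rint(1)[of "\<lambda>e. indicator M (fst e) * ?u (snd e)"] by (simp add: mult_ac)
    moreover have "\<dots> = (\<integral>e. indicator M (fst e) * ?u (ratio e) * g (tgt e) \<partial>P)"
      unfolding PN.integral_fst'[OF iPN, symmetric]
      by (intro Bochner_Integration.integral_cong) (simp_all add: inner)
    ultimately show ?thesis by simp
  qed
  show ?thesis using g1 g2 g3 g4 by (intro exI[of _ g]) blast
qed

text \<open>On an indicator \<open>1\<^sub>M\<close> with image \<open>h\<close>, the form of \<open>R\<close> at \<open>(M, K)\<close> is the pairing of \<open>h\<close> with the
conditional transform \<open>g\<close> of \<open>Q\<close>. As \<open>\<bar>g\<bar> \<le> 1\<close>, this pairing makes sense for \<open>h\<close> in \<open>L\<^sup>1\<close>, and it is the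
form of \<open>Q\<close> at \<open>(h, K)\<close>.\<close>

lemma fwd_prod:
  assumes R: "R \<in> Pol A C" and rand: "randomized_product A B C P Q R T V"
    and "mellin_fwd A B P l f h" "mellin_fwd B C Q l h k"
  shows "mellin_fwd A C R l f k"
proof (rule L1_contraction_eqI[of A C "mellin_fwd A B P l OO mellin_fwd B C Q l"])
  interpret R: polymorphism A C R by unfold_locales fact
  interpret fP: L1_contraction A B "mellin_fwd A B P l" by (rule P.fwd_contraction[OF B(1)])
  interpret fQ: L1_contraction B C "mellin_fwd B C Q l" by (rule Q.fwd_contraction[OF C])
  show "L1_contraction A C (mellin_fwd A B P l OO mellin_fwd B C Q l)"
    by (rule L1_contraction_relcompp) unfold_locales
  show "L1_contraction A C (mellin_fwd A C R l)" by (rule R.fwd_contraction[OF C])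
  show "(mellin_fwd A B P l OO mellin_fwd B C Q l) f k" using assms(3,4) by blast
  fix M assume M[measurable]: "M \<in> sets A" and Mfin: "emeasure A M < \<infinity>"
  then have iM: "integrable A (indicator M :: 'a \<Rightarrow> complex)" by (rule integrable_indicator_complex)
  obtain h where h: "mellin_fwd A B P l (indicator M) h" using fP.total[OF iM] by blast
  obtain k where k: "mellin_fwd B C Q l h k" using fQ.total[OF fP.ran[OF h]] by blast
  have h': "integrable B h" "\<And>N. N \<in> sets B \<Longrightarrow> (\<integral>e. indicator M (fst e) * mellin False l (ratio e) * indicator N (tgt e) \<partial>P) = (\<integral>b. h b * indicator N b \<partial>B)"
    using h by (auto simp: mellin_fwd_def coupling_op_def)
  have k': "integrable C k" "\<And>K. K \<in> sets C \<Longrightarrow> (\<integral>e. h (fst e) * mellin False l (ratio e) * indicator K (tgt e) \<partial>Q) = (\<integral>c. k c * indicator K c \<partial>C)"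
    using k by (auto simp: mellin_fwd_def coupling_op_def)
  note [measurable] = borel_measurable_integrable[OF h'(1)]
  have "(\<integral>e. indicator M (fst e) * mellin False l (ratio e) * indicator K (tgt e) \<partial>R) = (\<integral>c. k c * indicator K c \<partial>C)"
    if K[measurable]: "K \<in> sets C" for K
  proof -
    from product_transform[OF R rand K, of False l] obtain g where g: "integrable B g" "\<And>b. b \<in> space B \<Longrightarrow> norm (g b) \<le> 1"
      "\<And>N. N \<in> sets B \<Longrightarrow> (\<integral>e. indicator K (tgt e) * mellin False l (ratio e) * indicator N (fst e) \<partial>Q) = (\<integral>b. g b * indicator N b \<partial>B)"
      "integrable P (\<lambda>e. indicator M (fst e) * mellin False l (ratio e) * g (tgt e))"
      "(\<integral>e. indicator M (fst e) * indicator K (tgt e) * mellin False l (ratio e) \<partial>R) =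
      (\<integral>e. indicator M (fst e) * mellin False l (ratio e) * g (tgt e) \<partial>P)"
      using M by auto
    note [measurable] = borel_measurable_integrable[OF g(1)]
    have ihg: "integrable B (\<lambda>b. h b * g b)"
      by (rule Bochner_Integration.integrable_bound[OF h'(1)])
         (use g(2) in \<open>auto simp: norm_mult intro!: AE_I2 mult_left_le\<close>)
    have iM': "integrable P (\<lambda>e. indicator M (fst e) * mellin False l (ratio e))"
      using coupling.integrable_pull[OF P.coupling_fwd[OF B(1)] iM] .
    have iK': "integrable Q (\<lambda>e. indicator K (tgt e) * mellin False l (ratio e))"
      using Q.integrable_mellin_indicator[OF B(1) C sets.top K, of False l]
      by (rule Bochner_Integration.integrable_cong[THEN iffD1, rotated 2]) (auto simp: Q.space_P)
    have ih': "integrable Q (\<lambda>e. indicator K (tgt e) * mellin False l (ratio e) * h (fst e))"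
      by (rule Bochner_Integration.integrable_bound[OF coupling.integrable_pull[OF Q.coupling_fwd[OF C] h'(1)]])
         (auto simp: indicator_def mult.commute)
    have "(\<integral>e. indicator M (fst e) * mellin False l (ratio e) * indicator K (tgt e) \<partial>R)
        = (\<integral>e. indicator M (fst e) * mellin False l (ratio e) * g (tgt e) \<partial>P)"
      using g(5) by (simp add: mult_ac)
    also have "\<dots> = (\<integral>b. h b * g b \<partial>B)"
      by (rule pairing_extend[OF iM' h'(1) P.measurable_target h'(2) borel_measurable_integrable[OF g(1)] g(4) ihg])
    also have "\<dots> = (\<integral>b. g b * h b \<partial>B)" by (simp add: mult.commute)
    also have "\<dots> = (\<integral>e. indicator K (tgt e) * mellin False l (ratio e) * h (fst e) \<partial>Q)"
      by (rule pairing_extend[OF iK' g(1) Q.measurable_source g(3) _ ih', symmetric]) (use ihg in \<open>auto simp: mult.commute\<close>)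
    also have "\<dots> = (\<integral>c. k c * indicator K c \<partial>C)" using k'(2)[OF K] by (simp add: mult_ac)
    finally show ?thesis .
  qed
  then have "mellin_fwd A C R l (indicator M) k"
    using iM k'(1) by (simp add: mellin_fwd_def coupling_op_def)
  then show "\<exists>k. (mellin_fwd A B P l OO mellin_fwd B C Q l) (indicator M) k \<and> mellin_fwd A C R l (indicator M) k"
    using h k by blast
qed

text \<open>On an indicator \<open>1\<^sub>K\<close> the transposed operator of \<open>Q\<close> gives the conditional transform \<open>g\<close>, and the
form of \<open>R\<close> at \<open>(M, K)\<close> is by construction the form of \<open>P\<close> at \<open>(M, g)\<close>.\<close>

lemma bwd_prod:
  assumes R: "R \<in> Pol A C" and rand: "randomized_product A B C P Q R T V"
    and "mellin_bwd B C Q l k h" "mellin_bwd A B P l h f"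
  shows "mellin_bwd A C R l k f"
proof (rule L1_contraction_eqI[of C A "mellin_bwd B C Q l OO mellin_bwd A B P l"])
  interpret R: polymorphism A C R by unfold_locales fact
  interpret fP: L1_contraction B A "mellin_bwd A B P l" by (rule P.bwd_contraction[OF A])
  interpret fQ: L1_contraction C B "mellin_bwd B C Q l" by (rule Q.bwd_contraction[OF B(1)])
  show "L1_contraction C A (mellin_bwd B C Q l OO mellin_bwd A B P l)"
    by (rule L1_contraction_relcompp) unfold_locales
  show "L1_contraction C A (mellin_bwd A C R l)" by (rule R.bwd_contraction[OF A])
  show "(mellin_bwd B C Q l OO mellin_bwd A B P l) k f" using assms(3,4) by blast
  fix K assume K[measurable]: "K \<in> sets C" and Kfin: "emeasure C K < \<infinity>"
  then have iK: "integrable C (indicator K :: 'c \<Rightarrow> complex)" by (rule integrable_indicator_complex)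
  from product_transform[OF R rand K, of True l] obtain g where g: "integrable B g"
    "\<And>N. N \<in> sets B \<Longrightarrow> (\<integral>e. indicator K (tgt e) * mellin True l (ratio e) * indicator N (fst e) \<partial>Q) = (\<integral>b. g b * indicator N b \<partial>B)"
    "\<And>M. M \<in> sets A \<Longrightarrow> (\<integral>e. indicator M (fst e) * indicator K (tgt e) * mellin True l (ratio e) \<partial>R) =
    (\<integral>e. indicator M (fst e) * mellin True l (ratio e) * g (tgt e) \<partial>P)" by auto
  have Qg: "mellin_bwd B C Q l (indicator K) g"
    using g(1,2) iK by (simp add: mellin_bwd_def coupling_op_def)
  obtain f where f: "mellin_bwd A B P l g f" using fP.total[OF g(1)] by blast
  then have f': "integrable A f" "\<And>M. M \<in> sets A \<Longrightarrow> (\<integral>e. g (tgt e) * mellin True l (ratio e) * indicator M (fst e) \<partial>P) = (\<integral>a. f a * indicator M a \<partial>A)"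
    by (auto simp: mellin_bwd_def coupling_op_def)
  have "(\<integral>e. indicator K (tgt e) * mellin True l (ratio e) * indicator M (fst e) \<partial>R) = (\<integral>a. f a * indicator M a \<partial>A)"
    if "M \<in> sets A" for M
    using g(3)[OF that] f'(2)[OF that] by (simp add: mult_ac)
  then have "mellin_bwd A C R l (indicator K) f"
    using iK f'(1) by (simp add: mellin_bwd_def coupling_op_def)
  then show "\<exists>k. (mellin_bwd B C Q l OO mellin_bwd A B P l) (indicator K) k \<and> mellin_bwd A C R l (indicator K) k"
    using Qg f by blast
qed

end

section \<open>Strong convergence of averages over approximating partitions\<close>

text \<open>Contractions \<open>E n\<close> that behave like conditional expectations with respect to the partitions \<open>X n\<close>: they
leave unions of blocks unchanged.\<close>

locale L1_averaging =
  fixes A :: "'a measure" and X :: "nat \<Rightarrow> 'a set set"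
    and E :: "nat \<Rightarrow> ('a \<Rightarrow> complex) \<Rightarrow> ('a \<Rightarrow> complex) \<Rightarrow> bool"
  assumes A: "finite_measure A" and X: "approximating A X"
    and E: "\<And>n. L1_contraction A A (E n)"
    and fixes_blocks: "\<And>n U. U \<subseteq> X n \<Longrightarrow> E n (indicator (\<Union>U)) (indicator (\<Union>U))"
begin

lemmas E_dom = L1_contraction.dom[OF E] and E_ran = L1_contraction.ran[OF E]
  and E_total = L1_contraction.total[OF E] and E_add = L1_contraction.add[OF E]
  and E_scale = L1_contraction.scale[OF E] and E_dist_le = L1_contraction.dist_le[OF E]
  and E_unique = L1_contraction.unique[OF E]

text \<open>One sequence of images is as good as any other, because the images of \<open>f\<close> under \<open>E n\<close> agree almost
everywhere.\<close>

definition converges :: "('a \<Rightarrow> complex) \<Rightarrow> bool" where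
  "converges f \<longleftrightarrow> (\<exists>h. (\<forall>n. E n f (h n)) \<and> (\<lambda>n. \<integral>x. norm (h n x - f x) \<partial>A) \<longlonglongrightarrow> 0)"

lemma converges_integrable: "converges f \<Longrightarrow> integrable A f"
  unfolding converges_def using E_dom by blast

lemma converges_add:
  assumes "converges f" "converges g" shows "converges (\<lambda>x. f x + g x)"
proof -
  obtain h k where h: "\<And>n. E n f (h n)" "(\<lambda>n. \<integral>x. norm (h n x - f x) \<partial>A) \<longlonglongrightarrow> 0"
    and k: "\<And>n. E n g (k n)" "(\<lambda>n. \<integral>x. norm (k n x - g x) \<partial>A) \<longlonglongrightarrow> 0"
    using assms unfolding converges_def by blast
  note [simp] = converges_integrable[OF assms(1)] converges_integrable[OF assms(2)]
    E_ran[OF h(1)] E_ran[OF k(1)]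
  have "(\<integral>x. norm ((h n x + k n x) - (f x + g x)) \<partial>A) \<le> (\<integral>x. norm (h n x - f x) \<partial>A) + (\<integral>x. norm (k n x - g x) \<partial>A)" for n
  proof -
    have "(\<integral>x. norm ((h n x + k n x) - (f x + g x)) \<partial>A) \<le> (\<integral>x. norm (h n x - f x) + norm (k n x - g x) \<partial>A)"
      by (intro integral_mono norm_diff_triangle_ineq) auto
    then show ?thesis by simp
  qed
  note le = this
  have sum: "(\<lambda>n. (\<integral>x. norm (h n x - f x) \<partial>A) + (\<integral>x. norm (k n x - g x) \<partial>A)) \<longlonglongrightarrow> 0"
    using tendsto_add[OF h(2) k(2)] by simp
  have "(\<lambda>n. \<integral>x. norm ((h n x + k n x) - (f x + g x)) \<partial>A) \<longlonglongrightarrow> 0"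
    by (rule tendsto_sandwich[OF _ always_eventually[OF allI[OF le]] tendsto_const sum]) simp
  then show ?thesis unfolding converges_def using E_add[OF h(1) k(1)]
    by (intro exI[of _ "\<lambda>n x. h n x + k n x"]) auto
qed

lemma converges_scale:
  assumes "converges f" shows "converges (\<lambda>x. c * f x)"
proof -
  obtain h where h: "\<And>n. E n f (h n)" "(\<lambda>n. \<integral>x. norm (h n x - f x) \<partial>A) \<longlonglongrightarrow> 0"
    using assms unfolding converges_def by blast
  have "(\<integral>x. norm (c * h n x - c * f x) \<partial>A) = norm c * (\<integral>x. norm (h n x - f x) \<partial>A)" for n
    by (simp add: norm_mult flip: right_diff_distrib)
  with tendsto_mult[OF tendsto_const[of "norm c"] h(2)]
  have "(\<lambda>n. \<integral>x. norm (c * h n x - c * f x) \<partial>A) \<longlonglongrightarrow> 0" by simp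
  then show ?thesis unfolding converges_def using E_scale[OF h(1)]
    by (intro exI[of _ "\<lambda>n x. c * h n x"]) auto
qed

text \<open>The usual argument with three times \<open>r / 3\<close>: the \<open>E n\<close> are uniformly bounded, so strong convergence on
a dense set is enough.\<close>

lemma converges_lim:
  assumes s: "\<And>i. converges (s i)" and f: "integrable A f" and lim: "(\<lambda>i. \<integral>x. norm (s i x - f x) \<partial>A) \<longlonglongrightarrow> 0"
  shows "converges f"
proof -
  obtain h where h: "\<And>n. E n f (h n)" using E_total[OF f] by metis
  have "(\<lambda>n. \<integral>x. norm (h n x - f x) \<partial>A) \<longlonglongrightarrow> 0"
  proof (rule LIMSEQ_I)
    fix r :: real assume r: "0 < r"
    from LIMSEQ_D[OF lim, of "r / 3"] r obtain i where i: "(\<integral>x. norm (s i x - f x) \<partial>A) < r / 3" by auto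
    obtain k where k: "\<And>n. E n (s i) (k n)" "(\<lambda>n. \<integral>x. norm (k n x - s i x) \<partial>A) \<longlonglongrightarrow> 0"
      using s[of i] unfolding converges_def by blast
    from LIMSEQ_D[OF k(2), of "r / 3"] r obtain N where N: "\<And>n. n \<ge> N \<Longrightarrow> (\<integral>x. norm (k n x - s i x) \<partial>A) < r / 3" by auto
    have "norm ((\<integral>x. norm (h n x - f x) \<partial>A) - 0) < r" if "n \<ge> N" for n
    proof -
      note int = E_ran[OF h] E_ran[OF k(1)] converges_integrable[OF s[of i]] f
      have "(\<integral>x. norm (h n x - k n x) \<partial>A) \<le> (\<integral>x. norm (f x - s i x) \<partial>A)"
        by (rule E_dist_le[OF h k(1)])
      also have "\<dots> < r / 3" using i by (simp add: norm_minus_commute)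
      finally have "(\<integral>x. norm (h n x - k n x) \<partial>A) < r / 3" .
      moreover have "(\<integral>x. norm (h n x - f x) \<partial>A) \<le> (\<integral>x. norm (h n x - k n x) \<partial>A) + (\<integral>x. norm (k n x - f x) \<partial>A)"
        by (rule L1_dist_triangle) (use int in auto)
      moreover have "(\<integral>x. norm (k n x - f x) \<partial>A) \<le> (\<integral>x. norm (k n x - s i x) \<partial>A) + (\<integral>x. norm (s i x - f x) \<partial>A)"
        by (rule L1_dist_triangle) (use int in auto)
      ultimately have "(\<integral>x. norm (h n x - f x) \<partial>A) < r" using N[OF that] i by linarith
      then show ?thesis by simp
    qed
    then show "\<exists>no. \<forall>n\<ge>no. norm ((\<integral>x. norm (h n x - f x) \<partial>A) - 0) < r" by blast
  qed
  then show ?thesis unfolding converges_def using h by blast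
qed

lemma converges_cong_AE:
  assumes "converges f" "g \<in> borel_measurable A" "AE x in A. f x = g x" shows "converges g"
proof (rule converges_lim[of "\<lambda>_. f"])
  have f: "integrable A f" by (rule converges_integrable[OF assms(1)])
  show "integrable A g" using f assms by (subst integrable_cong_AE[symmetric, of f A g]) auto
  have "(\<integral>x. norm (f x - g x) \<partial>A) = (\<integral>x. 0 \<partial>A)"
    by (rule integral_cong_AE) (use f assms in auto)
  then show "(\<lambda>i. \<integral>x. norm (f x - g x) \<partial>A) \<longlonglongrightarrow> 0" by simp
qed fact

lemma converges_eventually:
  assumes f: "integrable A f" and ev: "\<And>n. n \<ge> N \<Longrightarrow> E n f f"
  shows "converges f"
proof -
  obtain h where h: "\<And>n. E n f (h n)" using E_total[OF f] by metis
  have "(\<integral>x. norm (h n x - f x) \<partial>A) = 0" if "n \<ge> N" for n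
    using E_dist_le[OF h ev[OF that]] by (intro antisym) auto
  then have "(\<lambda>n. \<integral>x. norm (h n x - f x) \<partial>A) \<longlonglongrightarrow> 0"
    by (intro tendsto_eventually) (auto simp: eventually_sequentially)
  then show ?thesis unfolding converges_def using h by blast
qed

lemma integrable_indicator_set: "S \<in> sets A \<Longrightarrow> integrable A (indicator S :: 'a \<Rightarrow> complex)"
  using A by (intro integrable_indicator_complex) (auto simp: finite_measure.emeasure_finite less_top[symmetric])

lemma part: "partition_on (space A) (X n)" "countable (X n)" "X n \<subseteq> sets A"
  using X by (auto simp: approximating_def countable_partition_def)

lemma refine: "n \<le> m \<Longrightarrow> T \<in> X m \<Longrightarrow> \<exists>S\<in>X n. T \<subseteq> S"
proof (induction m arbitrary: T rule: dec_induct)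
  case (step m)
  have "refines (space A) (X (Suc m)) (X m)" using X by (auto simp: approximating_def)
  then obtain T' where "T' \<in> X m" "T \<subseteq> T'" using step.prems by (auto simp: refines_def)
  with step.IH[OF this(1)] show ?case by blast
qed blast

lemma block_cases: "n \<le> m \<Longrightarrow> S \<in> X n \<Longrightarrow> T \<in> X m \<Longrightarrow> T \<subseteq> S \<or> S \<inter> T = {}"
  using refine[of n m T] part(1)[of n] unfolding partition_on_def disjoint_def by blast

lemma converges_block: assumes "S \<in> X n" shows "converges (indicator S)"
proof (rule converges_eventually[of _ n])
  show "integrable A (indicator S :: 'a \<Rightarrow> complex)" using part(3)[of n] assms by (intro integrable_indicator_set) auto
  fix m assume "n \<le> m"
  have "S = \<Union>{T\<in>X m. T \<subseteq> S}"
  proof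
    have "S \<subseteq> \<Union>(X m)" using part(1)[of n] part(1)[of m] assms by (auto simp: partition_on_def)
    then show "S \<subseteq> \<Union>{T\<in>X m. T \<subseteq> S}" using block_cases[OF \<open>n \<le> m\<close> assms] by blast
  qed auto
  then show "E m (indicator S) (indicator S)" using fixes_blocks[of "{T\<in>X m. T \<subseteq> S}" m] by simp
qed

lemma converges_empty: "converges (indicator {})"
proof (rule converges_eventually[of _ 0])
  show "integrable A (indicator {} :: 'a \<Rightarrow> complex)" by (rule integrable_indicator_set) simp
  show "E n (indicator {}) (indicator {})" for n
    using fixes_blocks[of "{}" n] unfolding Union_empty by blast
qed

text \<open>Blocks of the various partitions are nested or disjoint, so together with the empty set they are
closed under intersections, and the sets with convergent indicator form a Dynkin system.\<close>

lemma converges_sigma: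
  assumes "S \<in> sigma_sets (space A) (\<Union>n. X n)"
  shows "converges (indicator S)"
proof -
  let ?G = "insert {} (\<Union>n. X n)"
  have G: "?G \<subseteq> sets A" using part(3) by auto
  have sub: "sigma_sets (space A) ?G \<subseteq> sets A" using G by (rule sets.sigma_sets_subset)
  have int: "S \<inter> T \<in> ?G" if "S \<in> X n" "T \<in> X m" for S T n m
  proof (cases "n \<le> m")
    case True
    from block_cases[OF True that] show ?thesis using that by (auto simp: Int_absorb1)
  next
    case False
    then have "m \<le> n" by simp
    from block_cases[OF this that(2,1)] have "S \<inter> T = S \<or> S \<inter> T = {}" by blast
    then show ?thesis using that by auto
  qed
  have "Int_stable ?G"
  proof (rule Int_stableI)
    fix S T assume "S \<in> ?G" "T \<in> ?G"
    then consider "S = {} \<or> T = {}" | n m where "S \<in> X n" "T \<in> X m" by auto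
    then show "S \<inter> T \<in> ?G" using int by cases auto
  qed
  moreover have "?G \<subseteq> Pow (space A)" using G sets.sets_into_space by auto
  moreover have "S \<in> sigma_sets (space A) ?G"
    using assms by (rule sigma_sets_mono'[THEN subsetD, rotated]) auto
  ultimately show ?thesis
  proof (induction rule: sigma_sets_induct_disjoint)
    case (basic S)
    then consider "S = {}" | n where "S \<in> X n" by auto
    then show ?case using converges_block converges_empty by cases blast+
  next
    case empty
    show ?case by (rule converges_empty)
  next
    case (compl S)
    have "converges (indicator (space A))"
      using fixes_blocks[of "X n" n for n] part(1) by (auto intro!: converges_eventually[of _ 0] integrable_indicator_set simp: partition_on_def)
    from converges_add[OF this converges_scale[OF compl(2), of "-1"]]
    show ?case
    proof (rule converges_cong_AE)
      show "indicator (space A - S) \<in> borel_measurable A" using compl(1) sub by auto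
      show "AE x in A. indicator (space A) x + - 1 * indicator S x = (indicator (space A - S) x :: complex)"
        by (intro AE_I2) (auto simp: indicator_def)
    qed
  next
    case (union F)
    have F: "F i \<in> sets A" for i using union(2) sub by auto
    have fin: "converges (indicator (\<Union>i<n. F i))" for n
    proof (induction n)
      case 0
      have "(\<Union>i<0. F i) = {}" by simp
      with converges_empty show ?case by (simp only:)
    next
      case (Suc n)
      have "(indicator (\<Union>i<Suc n. F i) :: 'a \<Rightarrow> complex) = (\<lambda>x. indicator (\<Union>i<n. F i) x + indicator (F n) x)"
      proof
        fix x
        have "F n \<inter> F i = {}" if "i < n" for i
          using union(1) that by (intro disjoint_family_onD[of F UNIV]) auto
        then have "F n \<inter> (\<Union>i<n. F i) = {}" by blast
        then show "indicator (\<Union>i<Suc n. F i) x = (indicator (\<Union>i<n. F i) x + indicator (F n) x :: complex)"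
          by (auto simp: indicator_def less_Suc_eq)
      qed
      with converges_add[OF Suc union(3)[of n]] show ?case by simp
    qed
    show ?case
    proof (rule converges_lim[OF fin])
      show i: "integrable A (indicator (\<Union>i. F i) :: 'a \<Rightarrow> complex)" using F by (intro integrable_indicator_set) auto
      show "(\<lambda>n. \<integral>x. norm (indicator (\<Union>i<n. F i) x - indicator (\<Union>i. F i) x :: complex) \<partial>A) \<longlonglongrightarrow> 0"
      proof (rule L1_dist_simple_tendsto)
        show "(\<lambda>n. indicator (\<Union>i<n. F i) x :: complex) \<longlonglongrightarrow> indicator (\<Union>i. F i) x" for x
          by (rule LIMSEQ_indicator_UN)
        show "norm (indicator (\<Union>i<n. F i) x :: complex) \<le> 2 * norm (indicator (\<Union>i. F i) x :: complex)" for n x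
          by (auto simp: indicator_def)
        show "integrable A (indicator (\<Union>i<n. F i) :: 'a \<Rightarrow> complex)" for n using F by (intro integrable_indicator_set) auto
      qed fact
    qed
  qed
qed

lemma converges_sets: assumes S: "S \<in> sets A" shows "converges (indicator S)"
proof -
  from X S obtain T where T: "T \<in> sigma_sets (space A) (\<Union>n. X n)" "sym_diff S T \<in> null_sets A"
    by (auto simp: approximating_def)
  have "AE x in A. indicator T x = (indicator S x :: complex)"
    using AE_not_in[OF T(2)] by eventually_elim (auto simp: indicator_def)
  then show ?thesis using converges_cong_AE[OF converges_sigma[OF T(1)]] S by simp
qed

lemma converges_all: "integrable A f \<Longrightarrow> converges f"
proof (induction rule: integrable_induct)
  case (base S c)
  have "(\<lambda>x. c * indicator S x) = (\<lambda>x. indicator S x *\<^sub>R c)" by (auto simp: indicator_def)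
  with converges_scale[OF converges_sets[OF base(1)], of c] show ?case by simp
next
  case (lim f s)
  show ?case by (rule converges_lim[OF lim(5) lim(4) L1_dist_simple_tendsto]) (use lim in auto)
qed (rule converges_add)

lemma averaging_tendsto:
  assumes h: "\<And>n. E n f (h n)"
  shows "(\<lambda>n. \<integral>x. norm (h n x - f x) \<partial>A) \<longlonglongrightarrow> 0"
proof -
  from converges_all[OF E_dom[OF h]] obtain k
    where k: "\<And>n. E n f (k n)" "(\<lambda>n. \<integral>x. norm (k n x - f x) \<partial>A) \<longlonglongrightarrow> 0" unfolding converges_def by blast
  note int = E_ran[OF h] E_ran[OF k(1)] E_dom[OF h]
  have "(\<integral>x. norm (h n x - f x) \<partial>A) = (\<integral>x. norm (k n x - f x) \<partial>A)" for n
    by (rule integral_cong_AE) (use int E_unique[OF h k(1), of n] in \<open>auto elim!: eventually_mono\<close>)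
  with k(2) show ?thesis by simp
qed

end

section \<open>Quotient polymorphisms act by averaging\<close>

text \<open>The polymorphisms \<open>pol_m\<close> and \<open>pol_l\<close> are of this form: a correspondence with ratio constantly \<open>1\<close>.\<close>

lemma graph_in_Pol:
  assumes f[measurable]: "f1 \<in> E \<rightarrow>\<^sub>M A" "f2 \<in> E \<rightarrow>\<^sub>M B" and d: "distr E A f1 = A" "distr E B f2 = B"
  shows "distr E (A \<Otimes>\<^sub>M B \<Otimes>\<^sub>M Rpos) (\<lambda>e. (f1 e, f2 e, 1)) \<in> Pol A B"
proof -
  have [measurable]: "(\<lambda>e. 1) \<in> E \<rightarrow>\<^sub>M Rpos" by (simp add: measurable_to_Rpos)
  let ?G = "distr E (A \<Otimes>\<^sub>M B \<Otimes>\<^sub>M Rpos) (\<lambda>e. (f1 e, f2 e, 1))"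
  have "distr ?G A fst = A"
    by (subst distr_distr) (auto simp: comp_def d)
  moreover have "distr (density ?G (\<lambda>p. ennreal (ratio p))) B (\<lambda>p. tgt p) = B"
  proof (rule measure_eqI)
    fix N assume "N \<in> sets (distr (density ?G (\<lambda>p. ennreal (ratio p))) B (\<lambda>p. tgt p))"
    then have [measurable]: "N \<in> sets B" by simp
    have "emeasure (distr (density ?G (\<lambda>p. ennreal (ratio p))) B (\<lambda>p. tgt p)) N
      = (\<integral>\<^sup>+p. ennreal (ratio p) * indicator N (tgt p) \<partial>?G)"
      by (rule emeasure_weighted_image) measurable
    also have "\<dots> = (\<integral>\<^sup>+e. indicator N (f2 e) \<partial>E)" by (subst nn_integral_distr) auto
    also have "\<dots> = emeasure (distr E B f2) N" by (rule emeasure_distr_eq_nn_integral[symmetric]) auto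
    finally show "emeasure (distr (density ?G (\<lambda>p. ennreal (ratio p))) B (\<lambda>p. tgt p)) N = emeasure B N"
      by (simp add: d)
  qed simp
  ultimately show ?thesis by (simp add: Pol_def case_prod_unfold)
qed

lemma mellin_fwd_graph:
  assumes f[measurable]: "f1 \<in> E \<rightarrow>\<^sub>M A" "f2 \<in> E \<rightarrow>\<^sub>M B"
    and int: "integrable A f" "integrable B h"
    and eq: "\<And>N. N \<in> sets B \<Longrightarrow> (\<integral>e. f (f1 e) * indicator N (f2 e) \<partial>E) = (\<integral>b. h b * indicator N b \<partial>B)"
  shows "mellin_fwd A B (distr E (A \<Otimes>\<^sub>M B \<Otimes>\<^sub>M Rpos) (\<lambda>e. (f1 e, f2 e, 1))) l f h"
  unfolding mellin_fwd_def coupling_op_def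
proof (intro conjI int ballI)
  fix N assume [measurable]: "N \<in> sets B"
  have [measurable]: "(\<lambda>e. 1) \<in> E \<rightarrow>\<^sub>M Rpos" by (simp add: measurable_to_Rpos)
  note [measurable] = borel_measurable_integrable[OF int(1)]
  show "(\<integral>e. f (fst e) * mellin False l (ratio e) * indicator N (tgt e) \<partial>distr E (A \<Otimes>\<^sub>M B \<Otimes>\<^sub>M Rpos) (\<lambda>e. (f1 e, f2 e, 1)))
    = (\<integral>b. h b * indicator N b \<partial>B)"
    by (subst integral_distr) (auto simp: eq)
qed

lemma mellin_bwd_graph:
  assumes f[measurable]: "f1 \<in> E \<rightarrow>\<^sub>M A" "f2 \<in> E \<rightarrow>\<^sub>M B"
    and int: "integrable B f" "integrable A h"
    and eq: "\<And>N. N \<in> sets A \<Longrightarrow> (\<integral>e. f (f2 e) * indicator N (f1 e) \<partial>E) = (\<integral>a. h a * indicator N a \<partial>A)"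
  shows "mellin_bwd A B (distr E (A \<Otimes>\<^sub>M B \<Otimes>\<^sub>M Rpos) (\<lambda>e. (f1 e, f2 e, 1))) l f h"
  unfolding mellin_bwd_def coupling_op_def
proof (intro conjI int ballI)
  fix N assume [measurable]: "N \<in> sets A"
  have [measurable]: "(\<lambda>e. 1) \<in> E \<rightarrow>\<^sub>M Rpos" by (simp add: measurable_to_Rpos)
  note [measurable] = borel_measurable_integrable[OF int(1)]
  show "(\<integral>e. f (tgt e) * mellin True l (ratio e) * indicator N (fst e) \<partial>distr E (A \<Otimes>\<^sub>M B \<Otimes>\<^sub>M Rpos) (\<lambda>e. (f1 e, f2 e, 1)))
    = (\<integral>a. h a * indicator N a \<partial>A)"
    by (subst integral_distr) (auto simp: eq)
qed

locale partitioned =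
  fixes A :: "'a measure" and X :: "'a set set"
  assumes A: "finite_measure A" and X: "countable_partition A X"
begin

lemma part: "partition_on (space A) X" "countable X" "X \<subseteq> sets A"
  using X by (auto simp: countable_partition_def)

lemma quot_proj_eq: "S \<in> X \<Longrightarrow> a \<in> S \<Longrightarrow> quot_proj X a = S"
  unfolding quot_proj_def using part(1) by (intro the_equality) (auto simp: partition_on_def disjoint_def)

lemma quot_proj: "a \<in> space A \<Longrightarrow> quot_proj X a \<in> X" "a \<in> space A \<Longrightarrow> a \<in> quot_proj X a"
proof -
  assume "a \<in> space A"
  then obtain S where "S \<in> X" "a \<in> S" using part(1) by (auto simp: partition_on_def)
  then show "quot_proj X a \<in> X" "a \<in> quot_proj X a" using quot_proj_eq by auto
qed

lemma sets_quot: "sets (quot_space A X) = Pow X" and space_quot: "space (quot_space A X) = X"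
  by (simp_all add: quot_space_def sets_point_measure space_point_measure)

lemma quot_proj_vimage: "S \<in> X \<Longrightarrow> quot_proj X -` {S} \<inter> space A = S"
  using quot_proj quot_proj_eq part(3) sets.sets_into_space by (auto; blast)

lemma quot_proj_measurable[measurable]: "quot_proj X \<in> A \<rightarrow>\<^sub>M quot_space A X"
proof -
  have "quot_proj X \<in> A \<rightarrow>\<^sub>M count_space X"
    using part(2,3) quot_proj by (subst measurable_count_space_eq_countable) (auto simp: quot_proj_vimage)
  then show ?thesis
    by (subst measurable_cong_sets[of A A _ "count_space X"]) (simp_all add: sets_quot)
qed

lemma distr_quot_proj: "distr A (quot_space A X) (quot_proj X) = quot_space A X"
proof (rule measure_eqI_countable[of _ X])
  fix S assume S: "S \<in> X"
  have "emeasure (distr A (quot_space A X) (quot_proj X)) {S} = emeasure A S"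
    using S by (subst emeasure_distr) (auto simp: sets_quot quot_proj_vimage)
  also have "\<dots> = emeasure (quot_space A X) {S}"
    using S by (simp add: quot_space_def emeasure_point_measure_finite2)
  finally show "emeasure (distr A (quot_space A X) (quot_proj X)) {S} = emeasure (quot_space A X) {S}" .
qed (auto simp: sets_quot part)

lemma finite_quot: "finite_measure (quot_space A X)"
  using finite_measure.finite_measure_distr[OF A quot_proj_measurable] by (simp add: distr_quot_proj)

lemma pol_m_Pol: "pol_m A X \<in> Pol A (quot_space A X)"
  unfolding pol_m_def by (rule graph_in_Pol) (auto simp: distr_quot_proj distr_id2)

lemma pol_l_Pol: "pol_l A X \<in> Pol (quot_space A X) A"
  unfolding pol_l_def by (rule graph_in_Pol) (auto simp: distr_quot_proj distr_id2)

lemma integrable_lift: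
  assumes "integrable (quot_space A X) (\<phi> :: _ \<Rightarrow> complex)" shows "integrable A (\<lambda>a. \<phi> (quot_proj X a))"
proof -
  have "integrable (distr A (quot_space A X) (quot_proj X)) \<phi>"
    unfolding distr_quot_proj by fact
  then show ?thesis
    by (subst (asm) integrable_distr_eq[OF quot_proj_measurable borel_measurable_integrable[OF assms]])
qed

lemma integral_lift:
  assumes "\<phi> \<in> borel_measurable (quot_space A X)"
  shows "(\<integral>a. \<phi> (quot_proj X a) \<partial>A) = (\<integral>S. (\<phi> S :: complex) \<partial>quot_space A X)"
  using integral_distr[OF quot_proj_measurable assms] unfolding distr_quot_proj by simp

lemma fwd_m:
  assumes \<phi>: "integrable (quot_space A X) \<phi>"
  shows "mellin_fwd A (quot_space A X) (pol_m A X) l (\<lambda>a. \<phi> (quot_proj X a)) \<phi>"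
  unfolding pol_m_def
  by (rule mellin_fwd_graph[OF _ _ integrable_lift[OF \<phi>] \<phi>])
     (auto intro!: integral_lift borel_measurable_times borel_measurable_integrable[OF \<phi>])

lemma fwd_l:
  assumes \<phi>: "integrable (quot_space A X) \<phi>"
  shows "mellin_fwd (quot_space A X) A (pol_l A X) l \<phi> (\<lambda>a. \<phi> (quot_proj X a))"
  unfolding pol_l_def
  by (rule mellin_fwd_graph[OF _ _ \<phi> integrable_lift[OF \<phi>]]) auto

lemma bwd_m:
  assumes \<phi>: "integrable (quot_space A X) \<phi>"
  shows "mellin_bwd A (quot_space A X) (pol_m A X) l \<phi> (\<lambda>a. \<phi> (quot_proj X a))"
  unfolding pol_m_def
  by (rule mellin_bwd_graph[OF _ _ \<phi> integrable_lift[OF \<phi>]]) auto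

lemma bwd_l:
  assumes \<phi>: "integrable (quot_space A X) \<phi>"
  shows "mellin_bwd (quot_space A X) A (pol_l A X) l (\<lambda>a. \<phi> (quot_proj X a)) \<phi>"
  unfolding pol_l_def
  by (rule mellin_bwd_graph[OF _ _ integrable_lift[OF \<phi>] \<phi>])
     (auto intro!: integral_lift borel_measurable_times borel_measurable_integrable[OF \<phi>])

text \<open>Both \<open>avg_fwd\<close> and \<open>avg_bwd\<close> are the conditional expectation with respect to the partition: push a
function to the quotient and lift it back.\<close>

definition avg_fwd :: "real \<Rightarrow> ('a \<Rightarrow> complex) \<Rightarrow> ('a \<Rightarrow> complex) \<Rightarrow> bool" where
  "avg_fwd l = mellin_fwd A (quot_space A X) (pol_m A X) l OO mellin_fwd (quot_space A X) A (pol_l A X) l"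

definition avg_bwd :: "real \<Rightarrow> ('a \<Rightarrow> complex) \<Rightarrow> ('a \<Rightarrow> complex) \<Rightarrow> bool" where
  "avg_bwd l = mellin_bwd (quot_space A X) A (pol_l A X) l OO mellin_bwd A (quot_space A X) (pol_m A X) l"

lemma avg_contraction: "L1_contraction A A (avg_fwd l)" "L1_contraction A A (avg_bwd l)"
  unfolding avg_fwd_def avg_bwd_def
  by (intro L1_contraction_relcompp[of A "quot_space A X"] polymorphism.fwd_contraction polymorphism.bwd_contraction
        polymorphism.intro pol_m_Pol pol_l_Pol A finite_quot)+

lemma avg_fixes:
  assumes U: "U \<subseteq> X"
  shows "avg_fwd l (indicator (\<Union>U)) (indicator (\<Union>U))" "avg_bwd l (indicator (\<Union>U)) (indicator (\<Union>U))"
proof -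
  interpret f: L1_contraction A A "avg_fwd l" by (rule avg_contraction)
  interpret b: L1_contraction A A "avg_bwd l" by (rule avg_contraction)
  have i: "integrable (quot_space A X) (indicator U :: _ \<Rightarrow> complex)"
    using U finite_quot by (intro integrable_indicator_complex) (auto simp: sets_quot finite_measure.emeasure_finite less_top[symmetric])
  have "\<Union>U \<in> sets A" using U part(2,3) by (intro sets.countable_Union) (auto intro: countable_subset)
  then have i': "integrable A (indicator (\<Union>U) :: _ \<Rightarrow> complex)"
    using A by (intro integrable_indicator_complex) (auto simp: finite_measure.emeasure_finite less_top[symmetric])
  have AE: "AE a in A. indicator U (quot_proj X a) = (indicator (\<Union>U) a :: complex)"
  proof (rule AE_I2)
    fix a assume a: "a \<in> space A"
    have "a \<in> \<Union>U" if "quot_proj X a \<in> U" using that quot_proj(2)[OF a] by blast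
    moreover have "quot_proj X a \<in> U" if "S \<in> U" "a \<in> S" for S
      using that U quot_proj_eq[of S a] by auto
    ultimately have "quot_proj X a \<in> U \<longleftrightarrow> a \<in> \<Union>U" by blast
    then show "indicator U (quot_proj X a) = (indicator (\<Union>U) a :: complex)"
      unfolding indicator_def by simp
  qed
  have "avg_fwd l (\<lambda>a. indicator U (quot_proj X a)) (\<lambda>a. indicator U (quot_proj X a))"
    unfolding avg_fwd_def using fwd_m[OF i] fwd_l[OF i] by blast
  from f.cong[OF this i' i' AE AE] show "avg_fwd l (indicator (\<Union>U)) (indicator (\<Union>U))" .
  have "avg_bwd l (\<lambda>a. indicator U (quot_proj X a)) (\<lambda>a. indicator U (quot_proj X a))"
    unfolding avg_bwd_def using bwd_m[OF i] bwd_l[OF i] by blast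
  from b.cong[OF this i' i' AE AE] show "avg_bwd l (indicator (\<Union>U)) (indicator (\<Union>U))" .
qed

end

lemma L1_averaging_avg:
  assumes A: "finite_measure A" and X: "approximating A X"
  shows "L1_averaging A X (\<lambda>n. partitioned.avg_fwd A (X n) l)" "L1_averaging A X (\<lambda>n. partitioned.avg_bwd A (X n) l)"
proof -
  have p: "partitioned A (X n)" for n using A X by (simp add: partitioned_def approximating_def)
  show "L1_averaging A X (\<lambda>n. partitioned.avg_fwd A (X n) l)" "L1_averaging A X (\<lambda>n. partitioned.avg_bwd A (X n) l)"
    using A X partitioned.avg_contraction[OF p] partitioned.avg_fixes[OF p]
    by (auto simp: L1_averaging_def)
qed

section \<open>Chains of contractions\<close>

text \<open>The error is telescoped from the outside to the inside: replacing the averaged functions one after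
the other by the functions themselves costs at most \<open>a i\<close>, \<open>b j\<close> and \<open>c k\<close>, because each step of the
chain is a contraction. Each cost depends on a single index, which gives the joint limit.\<close>

lemma chain_limit:
  assumes UX: "L1_averaging A X UX" and UY: "L1_averaging B Y UY" and UZ: "L1_averaging C Z UZ"
    and P: "L1_contraction A B P" and Q: "L1_contraction B C Q" and f: "integrable A f"
  obtains r a b c where "(P OO Q) f r" "a \<longlonglongrightarrow> (0::real)" "b \<longlonglongrightarrow> (0::real)" "c \<longlonglongrightarrow> (0::real)"
    "\<And>i j k. \<exists>r'. (UX i OO P OO UY j OO Q OO UZ k) f r' \<and> (\<integral>x. norm (r' x - r x) \<partial>C) \<le> a i + b j + c k"
proof -
  interpret P: L1_contraction A B P by fact
  interpret Q: L1_contraction B C Q by fact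
  interpret UX: L1_averaging A X UX by fact
  interpret UY: L1_averaging B Y UY by fact
  interpret UZ: L1_averaging C Z UZ by fact
  obtain h where h: "P f h" using P.total[OF f] by blast
  obtain r where r: "Q h r" using Q.total[OF P.ran[OF h]] by blast
  obtain f' where f': "\<And>i. UX i f (f' i)" using UX.E_total[OF f] by metis
  obtain h' where h': "\<And>j. UY j h (h' j)" using UY.E_total[OF P.ran[OF h]] by metis
  obtain r' where r': "\<And>k. UZ k r (r' k)" using UZ.E_total[OF Q.ran[OF r]] by metis
  have "\<exists>s. (UX i OO P OO UY j OO Q OO UZ k) f s \<and> (\<integral>x. norm (s x - r x) \<partial>C)
    \<le> (\<integral>x. norm (f' i x - f x) \<partial>A) + (\<integral>x. norm (h' j x - h x) \<partial>B) + (\<integral>x. norm (r' k x - r x) \<partial>C)" for i j k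
  proof -
    obtain h1 where h1: "P (f' i) h1" using P.total[OF UX.E_ran[OF f']] by blast
    obtain h2 where h2: "UY j h1 h2" using UY.E_total[OF P.ran[OF h1]] by blast
    obtain r1 where r1: "Q h2 r1" using Q.total[OF UY.E_ran[OF h2]] by blast
    obtain s where s: "UZ k r1 s" using UZ.E_total[OF Q.ran[OF r1]] by blast
    have "(\<integral>x. norm (s x - r x) \<partial>C) \<le> (\<integral>x. norm (s x - r' k x) \<partial>C) + (\<integral>x. norm (r' k x - r x) \<partial>C)"
      by (rule L1_dist_triangle[OF UZ.E_ran[OF s] UZ.E_ran[OF r'] Q.ran[OF r]])
    moreover have "(\<integral>x. norm (s x - r' k x) \<partial>C) \<le> (\<integral>x. norm (r1 x - r x) \<partial>C)"
      by (rule UZ.E_dist_le[OF s r'])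
    moreover have "(\<integral>x. norm (r1 x - r x) \<partial>C) \<le> (\<integral>x. norm (h2 x - h x) \<partial>B)"
      by (rule Q.dist_le[OF r1 r])
    moreover have "(\<integral>x. norm (h2 x - h x) \<partial>B) \<le> (\<integral>x. norm (h2 x - h' j x) \<partial>B) + (\<integral>x. norm (h' j x - h x) \<partial>B)"
      by (rule L1_dist_triangle[OF UY.E_ran[OF h2] UY.E_ran[OF h'] P.ran[OF h]])
    moreover have "(\<integral>x. norm (h2 x - h' j x) \<partial>B) \<le> (\<integral>x. norm (h1 x - h x) \<partial>B)"
      by (rule UY.E_dist_le[OF h2 h'])
    moreover have "(\<integral>x. norm (h1 x - h x) \<partial>B) \<le> (\<integral>x. norm (f' i x - f x) \<partial>A)"
      by (rule P.dist_le[OF h1 h])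
    ultimately have "(\<integral>x. norm (s x - r x) \<partial>C)
      \<le> (\<integral>x. norm (f' i x - f x) \<partial>A) + (\<integral>x. norm (h' j x - h x) \<partial>B) + (\<integral>x. norm (r' k x - r x) \<partial>C)" by linarith
    moreover have "(UX i OO P OO UY j OO Q OO UZ k) f s" using f' h1 h2 r1 s by blast
    ultimately show ?thesis by blast
  qed
  moreover have "(P OO Q) f r" using h r by blast
  ultimately show ?thesis
    using UX.averaging_tendsto[OF f'] UY.averaging_tendsto[OF h'] UZ.averaging_tendsto[OF r']
    by (intro that[of r "\<lambda>i. \<integral>x. norm (f' i x - f x) \<partial>A" "\<lambda>j. \<integral>x. norm (h' j x - h x) \<partial>B" "\<lambda>k. \<integral>x. norm (r' k x - r x) \<partial>C"])
qed

section \<open>From Mellin transforms to weak convergence\<close>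

text \<open>Levy's continuity theorem for finite measures. At \<open>l = 0\<close> the hypothesis gives convergence of the
total masses; if their limit is positive the measures can be normalized, and otherwise all
the integrals tend to zero.\<close>

lemma bounded_continuous_tendsto_of_char:
  fixes \<kappa> :: "nat \<Rightarrow> real measure" and g :: "real \<Rightarrow> real"
  assumes fin: "\<And>n. finite_measure (\<kappa> n)" "finite_measure \<mu>"
    and sets: "\<And>n. sets (\<kappa> n) = sets borel" "sets \<mu> = sets borel"
    and char: "\<And>l. (\<lambda>n. \<integral>x. iexp (l * x) \<partial>\<kappa> n) \<longlonglongrightarrow> (\<integral>x. iexp (l * x) \<partial>\<mu>)"
    and g: "\<And>x. isCont g x" "\<And>x. norm (g x) \<le> D"
  shows "(\<lambda>n. \<integral>x. g x \<partial>\<kappa> n) \<longlonglongrightarrow> (\<integral>x. g x \<partial>\<mu>)"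
proof -
  define c where "c n = measure (\<kappa> n) UNIV" for n
  define d where "d = measure \<mu> UNIV"
  have sp: "space (\<kappa> n) = UNIV" "space \<mu> = UNIV" for n
    using sets[THEN sets_eq_imp_space_eq] by simp_all
  have "(\<integral>x. iexp (0 * x) \<partial>\<kappa> n) = complex_of_real (c n)" "(\<integral>x. iexp (0 * x) \<partial>\<mu>) = complex_of_real d" for n
    using sp by (simp_all add: c_def d_def of_real_def)
  with char[of 0] have "(\<lambda>n. complex_of_real (c n)) \<longlonglongrightarrow> complex_of_real d" by simp
  then have cd: "c \<longlonglongrightarrow> d" by (simp only: tendsto_of_real_iff)
  have gm: "g \<in> borel_measurable borel"
    using g(1) by (intro borel_measurable_continuous_onI) (simp add: continuous_at_imp_continuous_on)
  have D: "0 \<le> D" using g(2)[of 0] norm_ge_zero order_trans by blast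
  have bound: "\<bar>\<integral>x. g x \<partial>M\<bar> \<le> D * measure M UNIV"
    if M: "finite_measure M" "sets M = sets borel" for M
  proof -
    interpret finite_measure M by fact
    have [measurable_cong]: "sets M = sets borel" by fact
    have i: "integrable M g" using g(2) gm by (intro integrable_const_bound[of _ D]) (auto simp: measurable_cong_sets[OF M(2) refl])
    have "\<bar>\<integral>x. g x \<partial>M\<bar> \<le> (\<integral>x. norm (g x) \<partial>M)" using integral_norm_bound[of M g] by simp
    also have "\<dots> \<le> (\<integral>x. D \<partial>M)" using g(2) i by (intro integral_mono) auto
    also have "\<dots> = D * measure M UNIV" using sets_eq_imp_space_eq[OF M(2)] by simp
    finally show ?thesis .
  qed
  show ?thesis
  proof (cases "d = 0")
    case True
    have "(\<integral>x. g x \<partial>\<mu>) = 0" using bound[OF fin(2) sets(2)] True by (simp add: d_def)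
    moreover have "(\<lambda>n. \<integral>x. g x \<partial>\<kappa> n) \<longlonglongrightarrow> 0"
    proof (rule Lim_null_comparison)
      show "\<forall>\<^sub>F n in sequentially. norm (\<integral>x. g x \<partial>\<kappa> n) \<le> D * c n"
        using bound[OF fin(1) sets(1)] by (simp add: c_def)
      show "(\<lambda>n. D * c n) \<longlonglongrightarrow> 0" using tendsto_mult[OF tendsto_const[of D] cd] True by simp
    qed
    ultimately show ?thesis by simp
  next
    case False
    then have d: "0 < d" by (simp add: d_def order.not_eq_order_implies_strict)
    \<comment> \<open>Normalization. The point mass is a default for the null measure, which occurs for finitely many
      \<open>n\<close> only.\<close>
    define N where "N M = (if 0 < measure M UNIV then density M (\<lambda>_. ennreal (1 / measure M UNIV)) else return borel 0)" for M :: "real measure"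
    have N: "real_distribution (N M)" if M: "finite_measure M" "sets M = sets borel" for M
    proof (cases "0 < measure M UNIV")
      case True
      interpret finite_measure M by fact
      have spM: "space M = UNIV" using sets_eq_imp_space_eq[OF M(2)] by simp
      have "emeasure (N M) (space (N M)) = ennreal (1 / measure M UNIV) * emeasure M UNIV"
        using True by (simp add: N_def spM emeasure_density_const M(2))
      also have "\<dots> = ennreal (1 / measure M UNIV) * ennreal (measure M UNIV)"
        using emeasure_eq_measure[of UNIV] by simp
      also have "\<dots> = 1" using True by (subst ennreal_mult[symmetric]) auto
      finally have "prob_space (N M)" by (rule prob_spaceI)
      then show ?thesis
        using True by (simp add: real_distribution_def real_distribution_axioms_def N_def M(2))
    next
      case False
      then show ?thesis
        by (simp add: N_def real_distribution_def real_distribution_axioms_def prob_space_return)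
    qed
    have intN: "(\<integral>x. f x \<partial>N M) = (1 / measure M UNIV) *\<^sub>R (\<integral>x. f x \<partial>M)"
      if "0 < measure M UNIV" "sets M = sets borel" "f \<in> borel_measurable borel" for M and f :: "real \<Rightarrow> 'z::{banach, second_countable_topology}"
    proof -
      have "f \<in> borel_measurable M" using that(3) by (simp add: measurable_cong_sets[OF that(2) refl])
      then show ?thesis using that(1) by (simp add: N_def integral_density)
    qed
    have ev: "\<forall>\<^sub>F n in sequentially. 0 < measure (\<kappa> n) UNIV"
      using order_tendstoD(1)[OF cd d] by (simp add: c_def)
    have ie: "(\<lambda>x. iexp (l * x)) \<in> borel_measurable borel" for l by measurable
    have inv: "(\<lambda>n. 1 / c n) \<longlonglongrightarrow> 1 / d" using cd False by (intro tendsto_intros) auto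
    have "weak_conv_m (\<lambda>n. N (\<kappa> n)) (N \<mu>)"
    proof (rule levy_continuity)
      show "real_distribution (N (\<kappa> n))" for n by (rule N[OF fin(1) sets(1)])
      show "real_distribution (N \<mu>)" by (rule N[OF fin(2) sets(2)])
      fix l
      have "(\<lambda>n. (1 / c n) *\<^sub>R (\<integral>x. iexp (l * x) \<partial>\<kappa> n)) \<longlonglongrightarrow> (1 / d) *\<^sub>R (\<integral>x. iexp (l * x) \<partial>\<mu>)"
        by (intro tendsto_scaleR inv char)
      moreover have "(1 / d) *\<^sub>R (\<integral>x. iexp (l * x) \<partial>\<mu>) = Characteristic_Functions.char (N \<mu>) l"
        unfolding char_def using d by (subst intN[OF _ sets(2) ie]) (auto simp: d_def)
      moreover have "\<forall>\<^sub>F n in sequentially. (1 / c n) *\<^sub>R (\<integral>x. iexp (l * x) \<partial>\<kappa> n) = Characteristic_Functions.char (N (\<kappa> n)) l"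
        using ev by eventually_elim (simp only: char_def intN[OF _ sets(1) ie] c_def)
      ultimately show "(\<lambda>n. Characteristic_Functions.char (N (\<kappa> n)) l) \<longlonglongrightarrow> Characteristic_Functions.char (N \<mu>) l"
        by (auto elim: Lim_transform_eventually)
    qed
    then have "(\<lambda>n. \<integral>x. g x \<partial>N (\<kappa> n)) \<longlonglongrightarrow> (\<integral>x. g x \<partial>N \<mu>)"
      by (rule weak_conv_imp_integral_bdd_continuous_conv[OF N[OF fin(1) sets(1)] N[OF fin(2) sets(2)]]) (use g in auto)
    then have "(\<lambda>n. c n * (\<integral>x. g x \<partial>N (\<kappa> n))) \<longlonglongrightarrow> d * (\<integral>x. g x \<partial>N \<mu>)"
      by (intro tendsto_mult cd)
    moreover have "d * (\<integral>x. g x \<partial>N \<mu>) = (\<integral>x. g x \<partial>\<mu>)"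
      using d by (subst intN[OF _ sets(2) gm]) (auto simp: d_def)
    moreover have "\<forall>\<^sub>F n in sequentially. c n * (\<integral>x. g x \<partial>N (\<kappa> n)) = (\<integral>x. g x \<partial>\<kappa> n)"
      using ev by eventually_elim (simp add: intN[OF _ sets(1) gm] c_def)
    ultimately show ?thesis by (auto elim: Lim_transform_eventually)
  qed
qed

text \<open>In the coordinate \<open>ln t\<close> the Mellin transform on the imaginary axis is the characteristic function.\<close>

lemma weak_tendsto_of_mellin_seq:
  fixes m :: "nat \<Rightarrow> real measure" and f :: "real \<Rightarrow> real"
  assumes fin: "\<And>n. finite_measure (m n)" "finite_measure \<mu>"
    and sets: "\<And>n. sets (m n) = sets Rpos" "sets \<mu> = sets Rpos"
    and mel: "\<And>l. (\<lambda>n. \<integral>t. mellin False l t \<partial>m n) \<longlonglongrightarrow> (\<integral>t. mellin False l t \<partial>\<mu>)"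
    and f: "continuous_on {0<..} f" "\<And>t. 0 < t \<Longrightarrow> \<bar>f t\<bar> \<le> D"
  shows "(\<lambda>n. \<integral>t. f t \<partial>m n) \<longlonglongrightarrow> (\<integral>t. f t \<partial>\<mu>)"
proof -
  have ln: "ln \<in> \<nu> \<rightarrow>\<^sub>M borel"
    and sp: "space \<nu> = {0<..}" if "sets \<nu> = sets Rpos" for \<nu>
  proof -
    have "ln \<in> borel_measurable Rpos" by (rule measurable_borel_Rpos) simp
    then show "ln \<in> \<nu> \<rightarrow>\<^sub>M borel" by (simp add: measurable_cong_sets[OF that refl])
    show "space \<nu> = {0<..}" using sets_eq_imp_space_eq[OF that] by simp
  qed
  have cont: "isCont (\<lambda>x. f (exp x)) x" for x
  proof -
    have "isCont f (exp x)" using f(1) by (simp add: continuous_on_eq_continuous_at open_greaterThan)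
    then show ?thesis by (rule isCont_o2[OF isCont_exp])
  qed
  have fe: "(\<lambda>x. f (exp x)) \<in> borel_measurable borel"
    using cont by (intro borel_measurable_continuous_onI) (simp add: continuous_at_imp_continuous_on)
  have int: "(\<integral>x. f (exp x) \<partial>distr \<nu> borel ln) = (\<integral>t. f t \<partial>\<nu>)"
    "(\<integral>x. iexp (l * x) \<partial>distr \<nu> borel ln) = (\<integral>t. mellin False l t \<partial>\<nu>)" if "sets \<nu> = sets Rpos" for \<nu> l
  proof -
    have "(\<integral>x. f (exp x) \<partial>distr \<nu> borel ln) = (\<integral>t. f (exp (ln t)) \<partial>\<nu>)"
      by (rule integral_distr[OF ln[OF that] fe])
    also have "\<dots> = (\<integral>t. f t \<partial>\<nu>)"
      by (intro Bochner_Integration.integral_cong) (auto simp: sp[OF that])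
    finally show "(\<integral>x. f (exp x) \<partial>distr \<nu> borel ln) = (\<integral>t. f t \<partial>\<nu>)" .
    have "(\<lambda>x. iexp (l * x)) \<in> borel_measurable borel" by measurable
    from integral_distr[OF ln[OF that] this]
    show "(\<integral>x. iexp (l * x) \<partial>distr \<nu> borel ln) = (\<integral>t. mellin False l t \<partial>\<nu>)"
      by (simp add: mellin_def)
  qed
  have "(\<lambda>n. \<integral>x. f (exp x) \<partial>distr (m n) borel ln) \<longlonglongrightarrow> (\<integral>x. f (exp x) \<partial>distr \<mu> borel ln)"
  proof (rule bounded_continuous_tendsto_of_char)
    show "finite_measure (distr (m n) borel ln)" "finite_measure (distr \<mu> borel ln)" for n
      by (intro finite_measure.finite_measure_distr fin ln sets)+
    show "(\<lambda>n. \<integral>x. iexp (l * x) \<partial>distr (m n) borel ln) \<longlonglongrightarrow> (\<integral>x. iexp (l * x) \<partial>distr \<mu> borel ln)" for l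
      unfolding int(2)[OF sets(1)] int(2)[OF sets(2)] by (rule mel)
    show "norm (f (exp x)) \<le> D" for x using f(2)[of "exp x"] by simp
  qed (use cont in auto)
  then show ?thesis by (simp add: int(1) sets)
qed

lemma t_times_Mtri:
  assumes \<mu>: "\<mu> \<in> Mtri"
  shows "finite_measure (t_times \<mu>)" "sets (t_times \<mu>) = sets Rpos"
    "(\<integral>t. mellin False l t \<partial>t_times \<mu>) = (\<integral>t. mellin True l t \<partial>\<mu>)"
proof -
  note m = Mtri_finite[OF \<mu>]
  have t: "(\<lambda>t. t) \<in> borel_measurable \<mu>"
    using measurable_borel_Rpos[of "\<lambda>t. t"] by (simp add: measurable_cong_sets[OF m(2) refl])
  then have te: "(\<lambda>t. ennreal t) \<in> borel_measurable \<mu>" by measurable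
  have "emeasure (t_times \<mu>) (space (t_times \<mu>)) = (\<integral>\<^sup>+t. ennreal t \<partial>\<mu>)"
    unfolding t_times_def by (simp add: emeasure_density te cong: nn_integral_cong)
  then show "finite_measure (t_times \<mu>)"
    using \<mu> by (intro finite_measureI) (auto simp: Mtri_def)
  show "sets (t_times \<mu>) = sets Rpos" by (simp add: t_times_def m)
  have "mellin False l \<in> borel_measurable \<mu>"
    using measurable_borel_Rpos[OF mellin_measurable] by (simp add: measurable_cong_sets[OF m(2) refl])
  moreover have "AE t in \<mu>. 0 \<le> t" using m(3) by (intro AE_I2) simp
  ultimately have "(\<integral>t. mellin False l t \<partial>t_times \<mu>) = (\<integral>t. t *\<^sub>R mellin False l t \<partial>\<mu>)"
    unfolding t_times_def by (rule integral_density[OF _ t])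
  also have "\<dots> = (\<integral>t. mellin True l t \<partial>\<mu>)"
    by (simp add: mellin_def scaleR_conv_of_real)
  finally show "(\<integral>t. mellin False l t \<partial>t_times \<mu>) = (\<integral>t. mellin True l t \<partial>\<mu>)" .
qed

abbreviation (input) triple_seq :: "(nat \<times> nat \<times> nat) filter" where
  "triple_seq \<equiv> sequentially \<times>\<^sub>F sequentially \<times>\<^sub>F sequentially"

text \<open>The product filter has a countable base, so sequences are enough to test convergence along it. This
makes Levy's theorem applicable, which concerns sequences.\<close>

lemma tendsto_triple_sequentially:
  fixes f :: "nat \<times> nat \<times> nat \<Rightarrow> 'z::topological_space"
  assumes "\<And>s. filterlim s triple_seq sequentially \<Longrightarrow> (\<lambda>n. f (s n)) \<longlonglongrightarrow> L"
  shows "(f \<longlongrightarrow> L) triple_seq"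
proof (rule ccontr)
  assume "\<not> (f \<longlongrightarrow> L) triple_seq"
  then obtain S where S: "open S" "L \<in> S"
    and nev: "\<not> (\<forall>\<^sub>F x in triple_seq. f x \<in> S)"
    unfolding tendsto_def by blast
  have "\<exists>x. n \<le> fst x \<and> n \<le> fst (snd x) \<and> n \<le> snd (snd x) \<and> f x \<notin> S" for n
  proof (rule ccontr)
    assume *: "\<not> ?thesis"
    have "\<forall>\<^sub>F x in triple_seq. n \<le> fst x \<and> n \<le> fst (snd x) \<and> n \<le> snd (snd x)"
      by (intro eventually_conj
          filterlim_compose[OF filterlim_ident filterlim_fst, THEN filterlim_iff[THEN iffD1], rule_format]
          filterlim_compose[OF filterlim_fst filterlim_snd, THEN filterlim_iff[THEN iffD1], rule_format]
          filterlim_compose[OF filterlim_snd filterlim_snd, THEN filterlim_iff[THEN iffD1], rule_format]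
          eventually_ge_at_top)
    then have "\<forall>\<^sub>F x in triple_seq. f x \<in> S"
      by eventually_elim (use * in blast)
    with nev show False by blast
  qed
  then obtain s where s: "\<And>n. n \<le> fst (s n)" "\<And>n. n \<le> fst (snd (s n))" "\<And>n. n \<le> snd (snd (s n))" "\<And>n. f (s n) \<notin> S"
    by metis
  have top: "filterlim g sequentially sequentially" if "\<And>n. n \<le> g n" for g :: "nat \<Rightarrow> nat"
    by (rule filterlim_at_top_mono[OF filterlim_ident]) (use that in auto)
  have "filterlim (\<lambda>n. (fst (s n), fst (snd (s n)), snd (snd (s n)))) triple_seq sequentially"
    by (intro filterlim_Pair top s)
  then have "(\<lambda>n. f (s n)) \<longlonglongrightarrow> L" by (intro assms) simp
  then have "\<forall>\<^sub>F n in sequentially. f (s n) \<in> S" using S by (rule topological_tendstoD)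
  then show False using s(4) by (auto simp: eventually_sequentially)
qed

lemma Mtri_tendsto_of_mellin:
  fixes m :: "nat \<times> nat \<times> nat \<Rightarrow> real measure"
  assumes m: "\<And>x. m x \<in> Mtri" and \<mu>: "\<mu> \<in> Mtri"
    and mel: "\<And>v l. ((\<lambda>x. \<integral>t. mellin v l t \<partial>m x) \<longlongrightarrow> (\<integral>t. mellin v l t \<partial>\<mu>)) triple_seq"
  shows "Mtri_tendsto triple_seq m \<mu>"
  unfolding Mtri_tendsto_def weak_tendsto_def
proof (intro conjI allI impI m \<mu>; elim conjE)
  fix f :: "real \<Rightarrow> real" assume f: "continuous_on {0<..} f" "bounded (f ` {0<..})"
  then obtain D where D: "\<And>t. 0 < t \<Longrightarrow> \<bar>f t\<bar> \<le> D" by (auto simp: bounded_iff)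
  show "((\<lambda>x. \<integral>t. f t \<partial>m x) \<longlongrightarrow> (\<integral>t. f t \<partial>\<mu>)) triple_seq"
    by (rule tendsto_triple_sequentially, rule weak_tendsto_of_mellin_seq[OF _ _ _ _ _ f(1) D])
       (auto simp: Mtri_finite(2)[OF m] Mtri_finite(2)[OF \<mu>] intro: Mtri_finite(1) m \<mu> filterlim_compose[OF mel])
  show "((\<lambda>x. \<integral>t. f t \<partial>t_times (m x)) \<longlongrightarrow> (\<integral>t. f t \<partial>t_times \<mu>)) triple_seq"
    by (rule tendsto_triple_sequentially, rule weak_tendsto_of_mellin_seq[OF _ _ _ _ _ f(1) D])
       (auto simp: t_times_Mtri(2,3)[OF m] t_times_Mtri(2,3)[OF \<mu>] intro: t_times_Mtri(1) m \<mu> filterlim_compose[OF mel])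
qed

section \<open>The triple limit\<close>

lemma (in polymorphism) integral_block:
  assumes [measurable]: "M \<in> sets A" "N \<in> sets B" and f: "f \<in> borel_measurable borel"
  shows "(\<integral>t. (f t :: complex) \<partial>pol_block P M N)
    = (\<integral>e. indicator M (fst e) * indicator N (tgt e) * f (ratio e) \<partial>P)"
proof -
  have sp: "M \<times> N \<times> {0<..} \<in> sets P"
    using assms sets.top[of Rpos] by (intro Times_in_sets) auto
  have "(\<lambda>e. ratio e) \<in> restrict_space P (M \<times> N \<times> {0<..}) \<rightarrow>\<^sub>M Rpos"
    by (intro measurable_restrict_space1) measurable
  then have "(\<integral>t. f t \<partial>pol_block P M N) = (\<integral>e. f (ratio e) \<partial>restrict_space P (M \<times> N \<times> {0<..}))"
    unfolding pol_block_def case_prod_unfold by (rule integral_distr) (rule measurable_borel_Rpos[OF f])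
  also have "\<dots> = (\<integral>e. indicator (M \<times> N \<times> {0<..}) e *\<^sub>R f (ratio e) \<partial>P)"
    using sp sets.sets_into_space[OF sp] by (subst integral_restrict_space) (auto simp: Int_absorb2)
  also have "\<dots> = (\<integral>e. indicator M (fst e) * indicator N (tgt e) * f (ratio e) \<partial>P)"
    by (intro Bochner_Integration.integral_cong) (auto simp: space_P indicator_def)
  finally show ?thesis .
qed

text \<open>What the three spaces of a product have to satisfy. The property passes from a Lebesgue space to its
quotients by countable partitions.\<close>

definition real_modelled :: "'a measure \<Rightarrow> bool" where
  "real_modelled C \<longleftrightarrow> finite_measure C \<and> space C \<noteq> {} \<and> (\<exists>f g. real_model C f g)"

lemma real_modelled_lebesgue: "lebesgue_space C \<Longrightarrow> real_modelled C"
  unfolding real_modelled_def using real_model_lebesgue[of C] by (auto simp: lebesgue_space_def)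

lemma real_modelled_quot:
  assumes "real_modelled A" "countable_partition A X" shows "real_modelled (quot_space A X)"
proof -
  interpret partitioned A X using assms by (simp add: partitioned_def real_modelled_def)
  have "X \<noteq> {}" using part(1) assms by (auto simp: partition_on_def real_modelled_def)
  then show ?thesis
    using finite_quot real_model_quot[of A X] assms by (simp add: real_modelled_def space_quot)
qed

lemma pol_prod:
  assumes "real_modelled A" "real_modelled B" "real_modelled C" "P \<in> Pol A B" "Q \<in> Pol B C"
  shows pol_prod_Pol: "Q \<circ>\<^bsub>(A,B,C)\<^esub> P \<in> Pol A C"
    and pol_prod_fwd: "\<And>l f h k. mellin_fwd A B P l f h \<Longrightarrow> mellin_fwd B C Q l h k \<Longrightarrow> mellin_fwd A C (Q \<circ>\<^bsub>(A,B,C)\<^esub> P) l f k"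
    and pol_prod_bwd: "\<And>l f h k. mellin_bwd B C Q l k h \<Longrightarrow> mellin_bwd A B P l h f \<Longrightarrow> mellin_bwd A C (Q \<circ>\<^bsub>(A,B,C)\<^esub> P) l k f"
proof -
  interpret composable A B C P Q
    using assms by (auto simp: composable_def composable_axioms_def polymorphism_def real_modelled_def)
  obtain f g where "real_model C f g" using assms(3) by (auto simp: real_modelled_def)
  note * = pol_prod_randomized[OF this]
  then obtain T V where TV: "randomized_product A B C P Q (Q \<circ>\<^bsub>(A,B,C)\<^esub> P) T V" by blast
  show "Q \<circ>\<^bsub>(A,B,C)\<^esub> P \<in> Pol A C" by (rule *)
  show "mellin_fwd A C (Q \<circ>\<^bsub>(A,B,C)\<^esub> P) l f k" if "mellin_fwd A B P l f h" "mellin_fwd B C Q l h k" for l f h k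
    by (rule fwd_prod[OF *(1) TV that])
  show "mellin_bwd A C (Q \<circ>\<^bsub>(A,B,C)\<^esub> P) l k f" if "mellin_bwd B C Q l k h" "mellin_bwd A B P l h f" for l f h k
    by (rule bwd_prod[OF *(1) TV that])
qed

lemma norm_integral_indicator_diff_le:
  fixes r s :: "'a \<Rightarrow> complex"
  assumes r: "integrable A r" and s: "integrable A s" and K[measurable]: "K \<in> sets A"
  shows "norm ((\<integral>x. r x * indicator K x \<partial>A) - (\<integral>x. s x * indicator K x \<partial>A)) \<le> (\<integral>x. norm (r x - s x) \<partial>A)"
proof -
  note [measurable] = borel_measurable_integrable[OF r] borel_measurable_integrable[OF s]
  have i: "integrable A (\<lambda>x. r x * indicator K x)" "integrable A (\<lambda>x. s x * indicator K x)"
    by (rule integrable_times_indicator[OF r _ K] integrable_times_indicator[OF s _ K]; simp)+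
  have "norm ((\<integral>x. r x * indicator K x \<partial>A) - (\<integral>x. s x * indicator K x \<partial>A)) = norm (\<integral>x. r x * indicator K x - s x * indicator K x \<partial>A)"
    using i by simp
  also have "\<dots> \<le> (\<integral>x. norm (r x * indicator K x - s x * indicator K x) \<partial>A)" by (rule integral_norm_bound)
  also have "\<dots> \<le> (\<integral>x. norm (r x - s x) \<partial>A)"
    using i r s by (intro integral_mono integrable_norm Bochner_Integration.integrable_diff) (auto simp: indicator_def)
  finally show ?thesis .
qed

lemma tendsto_triple_sum:
  fixes a b c :: "nat \<Rightarrow> real"
  assumes "a \<longlonglongrightarrow> 0" "b \<longlonglongrightarrow> 0" "c \<longlonglongrightarrow> 0"
  shows "((\<lambda>x. a (fst x) + b (fst (snd x)) + c (snd (snd x))) \<longlongrightarrow> 0) triple_seq"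
  using tendsto_add[OF tendsto_add[OF
      filterlim_compose[OF assms(1) filterlim_fst]
      filterlim_compose[OF assms(2) filterlim_compose[OF filterlim_fst filterlim_snd]]]
      filterlim_compose[OF assms(3) filterlim_compose[OF filterlim_snd filterlim_snd]]]
  by simp

text \<open>Whatever its bracketing, a product that acts by the chain of operators converges: the two kinds of
Mellin transforms of its blocks are values of the chain on indicators.\<close>

lemma pol_tendsto_of_chain:
  fixes R :: "nat \<Rightarrow> nat \<Rightarrow> nat \<Rightarrow> ('a \<times> 'c \<times> real) measure"
  assumes std: "real_modelled A" "real_modelled B" "real_modelled C"
    and X: "approximating A X" and Y: "approximating B Y" and Z: "approximating C Z"
    and P: "P \<in> Pol A B" and Q: "Q \<in> Pol B C" and R0: "\<And>i j k. R i j k \<in> Pol A C"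
    and fwd: "\<And>i j k l f r. (partitioned.avg_fwd A (X i) l OO mellin_fwd A B P l OO partitioned.avg_fwd B (Y j) l
      OO mellin_fwd B C Q l OO partitioned.avg_fwd C (Z k) l) f r \<Longrightarrow> mellin_fwd A C (R i j k) l f r"
    and bwd: "\<And>i j k l f r. (partitioned.avg_bwd C (Z k) l OO mellin_bwd B C Q l OO partitioned.avg_bwd B (Y j) l
      OO mellin_bwd A B P l OO partitioned.avg_bwd A (X i) l) f r \<Longrightarrow> mellin_bwd A C (R i j k) l f r"
  shows "pol_tendsto A C triple_seq (\<lambda>(i, j, k). R i j k) (Q \<circ>\<^bsub>(A,B,C)\<^esub> P)"
proof -
  define T where "T x = R (fst x) (fst (snd x)) (snd (snd x))" for x
  have T: "T x \<in> Pol A C" for x unfolding T_def by (rule R0)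
  let ?F = triple_seq
  let ?S = "Q \<circ>\<^bsub>(A,B,C)\<^esub> P"
  have A: "finite_measure A" and B: "finite_measure B" and C: "finite_measure C" using std by (auto simp: real_modelled_def)
  have S: "?S \<in> Pol A C" by (rule pol_prod_Pol[OF std P Q])
  interpret P: polymorphism A B P by unfold_locales fact
  interpret Q: polymorphism B C Q by unfold_locales fact
  interpret S: polymorphism A C ?S by unfold_locales fact
  have R': "polymorphism A C (T x)" for x by unfold_locales (rule T)
  have main: "((\<lambda>x. \<integral>t. mellin v l t \<partial>pol_block (T x) M K) \<longlongrightarrow> (\<integral>t. mellin v l t \<partial>pol_block ?S M K)) ?F"
    if M: "M \<in> sets A" and K: "K \<in> sets C" for M K v l
  proof (cases v)
    case False
    have iM: "integrable A (indicator M :: 'a \<Rightarrow> complex)"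
      using A M by (intro integrable_indicator_complex) (auto simp: finite_measure.emeasure_finite less_top[symmetric])
    obtain r a b c where r: "(mellin_fwd A B P l OO mellin_fwd B C Q l) (indicator M) r"
      and lim: "a \<longlonglongrightarrow> (0::real)" "b \<longlonglongrightarrow> (0::real)" "c \<longlonglongrightarrow> (0::real)"
      and r': "\<And>i j k. \<exists>r'. (partitioned.avg_fwd A (X i) l OO mellin_fwd A B P l OO partitioned.avg_fwd B (Y j) l
          OO mellin_fwd B C Q l OO partitioned.avg_fwd C (Z k) l) (indicator M) r' \<and> (\<integral>x. norm (r' x - r x) \<partial>C) \<le> a i + b j + c k"
      by (rule chain_limit[OF L1_averaging_avg(1)[OF A X, of l] L1_averaging_avg(1)[OF B Y, of l] L1_averaging_avg(1)[OF C Z, of l]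
            P.fwd_contraction[OF B, of l] Q.fwd_contraction[OF C, of l] iM]) (rule that)
    have block: "(\<integral>t. mellin v l t \<partial>pol_block U M K) = (\<integral>c. s c * indicator K c \<partial>C)" "integrable C s"
      if "U \<in> Pol A C" "mellin_fwd A C U l (indicator M) s" for U s
      using that K False polymorphism.integral_block[OF polymorphism.intro[OF that(1)] M K mellin_measurable, of v l]
      by (auto simp: mellin_fwd_def coupling_op_def mult_ac)
    have fS: "mellin_fwd A C ?S l (indicator M) r" using r pol_prod_fwd[OF std P Q] by blast
    have "norm ((\<integral>t. mellin v l t \<partial>pol_block (T x) M K) - (\<integral>t. mellin v l t \<partial>pol_block ?S M K))
      \<le> a (fst x) + b (fst (snd x)) + c (snd (snd x))" for x
    proof -
      from r'[of "fst x" "fst (snd x)" "snd (snd x)"] obtain s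
        where chain: "(partitioned.avg_fwd A (X (fst x)) l OO mellin_fwd A B P l OO partitioned.avg_fwd B (Y (fst (snd x))) l
          OO mellin_fwd B C Q l OO partitioned.avg_fwd C (Z (snd (snd x))) l) (indicator M) s"
        and le: "(\<integral>y. norm (s y - r y) \<partial>C) \<le> a (fst x) + b (fst (snd x)) + c (snd (snd x))"
        by (elim exE conjE)
      note s = fwd[OF chain, folded T_def] le
      show ?thesis
        unfolding block(1)[OF T s(1)] block(1)[OF S fS]
        using norm_integral_indicator_diff_le[OF block(2)[OF T s(1)] block(2)[OF S fS] K] s(2) by linarith
    qed
    then have "((\<lambda>x. (\<integral>t. mellin v l t \<partial>pol_block (T x) M K) - (\<integral>t. mellin v l t \<partial>pol_block ?S M K)) \<longlongrightarrow> 0) ?F"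
      by (intro Lim_null_comparison[OF always_eventually tendsto_triple_sum[OF lim]]) blast
    then show ?thesis by (rule LIM_zero_cancel)
  next
    case True
    have iK: "integrable C (indicator K :: 'c \<Rightarrow> complex)"
      using C K by (intro integrable_indicator_complex) (auto simp: finite_measure.emeasure_finite less_top[symmetric])
    obtain r a b c where r: "(mellin_bwd B C Q l OO mellin_bwd A B P l) (indicator K) r"
      and lim: "a \<longlonglongrightarrow> (0::real)" "b \<longlonglongrightarrow> (0::real)" "c \<longlonglongrightarrow> (0::real)"
      and r': "\<And>k j i. \<exists>r'. (partitioned.avg_bwd C (Z k) l OO mellin_bwd B C Q l OO partitioned.avg_bwd B (Y j) l
          OO mellin_bwd A B P l OO partitioned.avg_bwd A (X i) l) (indicator K) r' \<and> (\<integral>x. norm (r' x - r x) \<partial>A) \<le> a k + b j + c i"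
      by (rule chain_limit[OF L1_averaging_avg(2)[OF C Z, of l] L1_averaging_avg(2)[OF B Y, of l] L1_averaging_avg(2)[OF A X, of l]
            Q.bwd_contraction[OF B, of l] P.bwd_contraction[OF A, of l] iK]) (rule that)
    have block: "(\<integral>t. mellin v l t \<partial>pol_block U M K) = (\<integral>a. s a * indicator M a \<partial>A)" "integrable A s"
      if "U \<in> Pol A C" "mellin_bwd A C U l (indicator K) s" for U s
      using that M True polymorphism.integral_block[OF polymorphism.intro[OF that(1)] M K mellin_measurable, of v l]
      by (auto simp: mellin_bwd_def coupling_op_def mult_ac)
    have fS: "mellin_bwd A C ?S l (indicator K) r" using r pol_prod_bwd[OF std P Q] by blast
    have "norm ((\<integral>t. mellin v l t \<partial>pol_block (T x) M K) - (\<integral>t. mellin v l t \<partial>pol_block ?S M K))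
      \<le> c (fst x) + b (fst (snd x)) + a (snd (snd x))" for x
    proof -
      from r'[where i="fst x" and j="fst (snd x)" and k="snd (snd x)"] obtain s
        where chain: "(partitioned.avg_bwd C (Z (snd (snd x))) l OO mellin_bwd B C Q l OO partitioned.avg_bwd B (Y (fst (snd x))) l
          OO mellin_bwd A B P l OO partitioned.avg_bwd A (X (fst x)) l) (indicator K) s"
        and le: "(\<integral>y. norm (s y - r y) \<partial>A) \<le> a (snd (snd x)) + b (fst (snd x)) + c (fst x)"
        by (elim exE conjE)
      note s = bwd[OF chain, folded T_def] le
      show ?thesis
        unfolding block(1)[OF T s(1)] block(1)[OF S fS]
        using norm_integral_indicator_diff_le[OF block(2)[OF T s(1)] block(2)[OF S fS] M] s(2) by linarith
    qed
    then have "((\<lambda>x. (\<integral>t. mellin v l t \<partial>pol_block (T x) M K) - (\<integral>t. mellin v l t \<partial>pol_block ?S M K)) \<longlongrightarrow> 0) ?F"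
      by (intro Lim_null_comparison[OF always_eventually tendsto_triple_sum[OF lim(3,2,1)]]) blast
    then show ?thesis by (rule LIM_zero_cancel)
  qed
  have "(\<lambda>(i, j, k). R i j k) = T" by (auto simp: T_def)
  show ?thesis
    unfolding pol_tendsto_def \<open>(\<lambda>(i, j, k). R i j k) = T\<close>
  proof (intro conjI allI ballI T S)
    fix M K assume MK: "M \<in> sets A" "K \<in> sets C"
    show "Mtri_tendsto ?F (\<lambda>x. pol_block (T x) M K) (pol_block ?S M K)"
      by (intro Mtri_tendsto_of_mellin main MK polymorphism.block_in_Mtri[OF R' A C] S.block_in_Mtri[OF A C])
  qed
qed

lemma partitioned_approximating: "finite_measure A \<Longrightarrow> approximating A X \<Longrightarrow> partitioned A (X n)"
  by (simp add: partitioned_def approximating_def)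

text \<open>As \<open>pol_t\<close> is the product of \<open>pol_l\<close> and \<open>pol_m\<close>, it acts by averaging in both directions.\<close>

lemma pol_t_avg:
  assumes std: "real_modelled A" and cX: "countable_partition A X"
  shows pol_t_Pol: "pol_t A X \<in> Pol A A"
    and pol_t_fwd: "\<And>l f g. partitioned.avg_fwd A X l f g \<Longrightarrow> mellin_fwd A A (pol_t A X) l f g"
    and pol_t_bwd: "\<And>l f g. partitioned.avg_bwd A X l f g \<Longrightarrow> mellin_bwd A A (pol_t A X) l f g"
proof -
  interpret partitioned A X using assms by (simp add: partitioned_def real_modelled_def)
  note prod = pol_prod[OF std real_modelled_quot[OF std cX] std pol_m_Pol pol_l_Pol, folded pol_t_def]
  show "pol_t A X \<in> Pol A A" by (rule prod)
  show "mellin_fwd A A (pol_t A X) l f g" if "avg_fwd l f g" for l f g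
    using that prod(2) unfolding avg_fwd_def by blast
  show "mellin_bwd A A (pol_t A X) l f g" if "avg_bwd l f g" for l f g
    using that prod(3) unfolding avg_bwd_def by blast
qed

theorem proposition5p11:
  fixes A :: "'a measure" and B :: "'b measure" and C :: "'c measure"
    and X :: "nat \<Rightarrow> 'a set set" and Y :: "nat \<Rightarrow> 'b set set" and Z :: "nat \<Rightarrow> 'c set set"
    and P :: "('a \<times> 'b \<times> real) measure" and Q :: "('b \<times> 'c \<times> real) measure"
  assumes "lebesgue_space A" and "lebesgue_space B" and "lebesgue_space C"
    and "approximating A X" and "approximating B Y" and "approximating C Z"
    and "P \<in> Pol A B" and "Q \<in> Pol B C"
  shows "pol_tendsto A C (sequentially \<times>\<^sub>F sequentially \<times>\<^sub>F sequentially)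
      (\<lambda>(i, j, k).
        pol_t C (Z k) \<circ>\<^bsub>(A,C,C)\<^esub> Q \<circ>\<^bsub>(A,B,C)\<^esub> pol_t B (Y j) \<circ>\<^bsub>(A,B,B)\<^esub> P \<circ>\<^bsub>(A,A,B)\<^esub> pol_t A (X i))
      (Q \<circ>\<^bsub>(A,B,C)\<^esub> P)
    \<and> pol_tendsto A C (sequentially \<times>\<^sub>F sequentially \<times>\<^sub>F sequentially)
      (\<lambda>(i, j, k).
        let A' = quot_space A (X i); B' = quot_space B (Y j); C' = quot_space C (Z k) in
        pol_l C (Z k)
          \<circ>\<^bsub>(A,C',C)\<^esub> (pol_m C (Z k) \<circ>\<^bsub>(B',C,C')\<^esub> Q \<circ>\<^bsub>(B',B,C)\<^esub> pol_l B (Y j))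
          \<circ>\<^bsub>(A,B',C')\<^esub> (pol_m B (Y j) \<circ>\<^bsub>(A',B,B')\<^esub> P \<circ>\<^bsub>(A',A,B)\<^esub> pol_l A (X i))
          \<circ>\<^bsub>(A,A',B')\<^esub> pol_m A (X i))
      (Q \<circ>\<^bsub>(A,B,C)\<^esub> P)"
proof -
  have stdA: "real_modelled A" and stdB: "real_modelled B" and stdC: "real_modelled C"
    using assms(1-3) real_modelled_lebesgue by auto
  note P = \<open>P \<in> Pol A B\<close> and Q = \<open>Q \<in> Pol B C\<close>
  have pA: "partitioned A (X i)" and pB: "partitioned B (Y i)" and pC: "partitioned C (Z i)" for i
    using assms(4-6) stdA stdB stdC by (auto simp: real_modelled_def intro: partitioned_approximating)
  have stdA': "real_modelled (quot_space A (X i))" and stdB': "real_modelled (quot_space B (Y i))"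
    and stdC': "real_modelled (quot_space C (Z i))" for i
    using assms(4-6) stdA stdB stdC by (auto simp: approximating_def intro: real_modelled_quot)
  note mA = partitioned.pol_m_Pol[OF pA] and mB = partitioned.pol_m_Pol[OF pB] and mC = partitioned.pol_m_Pol[OF pC]
    and lA = partitioned.pol_l_Pol[OF pA] and lB = partitioned.pol_l_Pol[OF pB] and lC = partitioned.pol_l_Pol[OF pC]
  note avg = partitioned.avg_fwd_def[OF pA] partitioned.avg_fwd_def[OF pB] partitioned.avg_fwd_def[OF pC]
    partitioned.avg_bwd_def[OF pA] partitioned.avg_bwd_def[OF pB] partitioned.avg_bwd_def[OF pC]
  have cX: "countable_partition A (X i)" and cY: "countable_partition B (Y i)" and cZ: "countable_partition C (Z i)" for i
    using assms(4-6) by (auto simp: approximating_def)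
  note tA = pol_t_avg[OF stdA cX] and tB = pol_t_avg[OF stdB cY] and tC = pol_t_avg[OF stdC cZ]
  have "pol_tendsto A C (sequentially \<times>\<^sub>F sequentially \<times>\<^sub>F sequentially)
      (\<lambda>(i, j, k).
        pol_t C (Z k) \<circ>\<^bsub>(A,C,C)\<^esub> Q \<circ>\<^bsub>(A,B,C)\<^esub> pol_t B (Y j) \<circ>\<^bsub>(A,B,B)\<^esub> P \<circ>\<^bsub>(A,A,B)\<^esub> pol_t A (X i))
      (Q \<circ>\<^bsub>(A,B,C)\<^esub> P)"
  proof (rule pol_tendsto_of_chain[OF stdA stdB stdC assms(4-8)])
    fix i j k :: nat
    note p1 = pol_prod[OF stdA stdA stdB tA(1)[of i] P]
    note p2 = pol_prod[OF stdA stdB stdB p1(1) tB(1)[of j]]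
    note p3 = pol_prod[OF stdA stdB stdC p2(1) Q]
    note p4 = pol_prod[OF stdA stdC stdC p3(1) tC(1)[of k]]
    let ?R = "pol_t C (Z k) \<circ>\<^bsub>(A,C,C)\<^esub> Q \<circ>\<^bsub>(A,B,C)\<^esub> pol_t B (Y j) \<circ>\<^bsub>(A,B,B)\<^esub> P \<circ>\<^bsub>(A,A,B)\<^esub> pol_t A (X i)"
    show "?R \<in> Pol A C" by (rule p4(1))
    fix l
    show "mellin_fwd A C ?R l f r"
      if "(partitioned.avg_fwd A (X i) l OO mellin_fwd A B P l OO partitioned.avg_fwd B (Y j) l
        OO mellin_fwd B C Q l OO partitioned.avg_fwd C (Z k) l) f r" for f r
      using that by (elim relcomppE) (intro p4(2)[OF p3(2)[OF p2(2)[OF p1(2)]]] tA(2) tB(2) tC(2))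
    show "mellin_bwd A C ?R l f r"
      if "(partitioned.avg_bwd C (Z k) l OO mellin_bwd B C Q l OO partitioned.avg_bwd B (Y j) l
        OO mellin_bwd A B P l OO partitioned.avg_bwd A (X i) l) f r" for f r
      using that by (elim relcomppE) (intro p4(3)[OF _ p3(3)[OF _ p2(3)[OF _ p1(3)]]] tA(3) tB(3) tC(3))
  qed
  moreover have "pol_tendsto A C (sequentially \<times>\<^sub>F sequentially \<times>\<^sub>F sequentially)
      (\<lambda>(i, j, k).
        let A' = quot_space A (X i); B' = quot_space B (Y j); C' = quot_space C (Z k) in
        pol_l C (Z k)
          \<circ>\<^bsub>(A,C',C)\<^esub> (pol_m C (Z k) \<circ>\<^bsub>(B',C,C')\<^esub> Q \<circ>\<^bsub>(B',B,C)\<^esub> pol_l B (Y j))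
          \<circ>\<^bsub>(A,B',C')\<^esub> (pol_m B (Y j) \<circ>\<^bsub>(A',B,B')\<^esub> P \<circ>\<^bsub>(A',A,B)\<^esub> pol_l A (X i))
          \<circ>\<^bsub>(A,A',B')\<^esub> pol_m A (X i))
      (Q \<circ>\<^bsub>(A,B,C)\<^esub> P)"
    unfolding Let_def
  proof (rule pol_tendsto_of_chain[OF stdA stdB stdC assms(4-8)])
    fix i j k :: nat
    let ?A' = "quot_space A (X i)" and ?B' = "quot_space B (Y j)" and ?C' = "quot_space C (Z k)"
    note p1 = pol_prod[OF stdA'[of i] stdA stdB lA[of i] P]
    note p2 = pol_prod[OF stdA'[of i] stdB stdB'[of j] p1(1) mB[of j]]
    note p3 = pol_prod[OF stdA stdA'[of i] stdB'[of j] mA[of i] p2(1)]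
    note q1 = pol_prod[OF stdB'[of j] stdB stdC lB[of j] Q]
    note q2 = pol_prod[OF stdB'[of j] stdC stdC'[of k] q1(1) mC[of k]]
    note r1 = pol_prod[OF stdA stdB'[of j] stdC'[of k] p3(1) q2(1)]
    note r2 = pol_prod[OF stdA stdC'[of k] stdC r1(1) lC[of k]]
    let ?R = "pol_l C (Z k)
          \<circ>\<^bsub>(A,?C',C)\<^esub> (pol_m C (Z k) \<circ>\<^bsub>(?B',C,?C')\<^esub> Q \<circ>\<^bsub>(?B',B,C)\<^esub> pol_l B (Y j))
          \<circ>\<^bsub>(A,?B',?C')\<^esub> (pol_m B (Y j) \<circ>\<^bsub>(?A',B,?B')\<^esub> P \<circ>\<^bsub>(?A',A,B)\<^esub> pol_l A (X i))
          \<circ>\<^bsub>(A,?A',?B')\<^esub> pol_m A (X i)"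
    show "?R \<in> Pol A C" by (rule r2(1))
    fix l
    show "mellin_fwd A C ?R l f r"
      if "(partitioned.avg_fwd A (X i) l OO mellin_fwd A B P l OO partitioned.avg_fwd B (Y j) l
        OO mellin_fwd B C Q l OO partitioned.avg_fwd C (Z k) l) f r" for f r
      using that unfolding avg
      by (elim relcomppE) (rule r2(2)[OF r1(2)[OF p3(2)[OF _ p2(2)[OF p1(2)]] q2(2)[OF q1(2)]]]; assumption)
    show "mellin_bwd A C ?R l f r"
      if "(partitioned.avg_bwd C (Z k) l OO mellin_bwd B C Q l OO partitioned.avg_bwd B (Y j) l
        OO mellin_bwd A B P l OO partitioned.avg_bwd A (X i) l) f r" for f r
      using that unfolding avg
      by (elim relcomppE) (rule r2(3)[OF _ r1(3)[OF q2(3)[OF _ q1(3)] p3(3)[OF p2(3)[OF _ p1(3)]]]]; assumption)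
  qed
  ultimately show ?thesis by blast
qed

end
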